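(* Let $Q$ satisfy (Q1)–(Q4), let $M>0$, and let $(f_n)\subset\mathcal F_M$ be a minimizing sequence of $\mathcal H_C$ over $\mathcal F_M$. Then there exist $f_0\in\mathcal F_M$, a subsequence $(f_{n_k})$ and a sequence $(a_k)\subset\mathbb R^3$ such that $\mathcal H_C(f_0)=h_M$, $f_{n_k}^{a_k}\rightharpoonup f_0$ weakly in $L^{1+1/k_1}(\mathbb R^6)$, and $\nabla U_{f_{n_k}^{a_k}}\to\nabla U_{f_0}$ strongly in $L^2(\mathbb R^3)$, where $f^a(x,v):=f(x+a,v)$.
   Context: Standing assumptions on $Q$: $Q\in C^1([0,\infty))\cap C^2((0,\infty))$, $Q\ge0$, and there are constants $C_1,C_2>0$, $F_0>0$, $0<k_1,k_2,k_3<3/2$ with: (Q1) $Q(f)\ge C_1f^{1+1/k_1}$ for $f\ge F_0$; (Q2) $Q(f)\le C_2 f^{1+1/k_2}$ for $0\le f\le F_0$; (Q3) $Q(\lambda f)\ge\lambda^{1+1/k_3}Q(f)$ for $f\ge0$, $0\le\lambda\le1$; (Q4) $Q''(f)>0$ for $f>0$ and $Q'(0)=0$. For measurable $f=f(x,v)\ge0$ on $\mathbb R^3\times\mathbb R^3$: $\rho_f(x)=\int f(x,v)\,dv$, $U_f=-\rho_f*\frac1{|\cdot|}$, $E_{kin}(f)=\frac12\iint|v|^2f\,dv\,dx$, $E_{pot}(f)=-\frac1{8\pi}\int|\nabla U_f|^2dx$, $\mathcal C(f)=\iint Q(f)\,dv\,dx$, $\mathcal P(f)=\mathcal C(f)+E_{kin}(f)$,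 $\mathcal H_C(f)=\mathcal P(f)+E_{pot}(f)$. For $M>0$, $\mathcal F_M=\{f\in L^1(\mathbb R^6): f\ge0,\ \iint f=M,\ \mathcal P(f)<\infty\}$ and $h_M:=\inf_{\mathcal F_M}\mathcal H_C$. *)

theory Defs
  imports "HOL-Analysis.Analysis"
begin

type_synonym phase_fun = "((real^3) \<times> (real^3)) \<Rightarrow> real"

definition rho :: "phase_fun \<Rightarrow> real^3 \<Rightarrow> real" where
  "rho f x = (\<integral> v. f (x, v) \<partial>lborel)"

text \<open>Gradient of U_f = - rho_f * 1/|.|, written via its convolution formula
  grad U_f (x) = int rho_f(y) (x - y)/|x - y|^3 dy.\<close>
definition gradU :: "phase_fun \<Rightarrow> real^3 \<Rightarrow> real^3" where
  "gradU f x = (\<integral> y. (rho f y / norm (x - y) ^ 3) *\<^sub>R (x - y) \<partial>lborel)"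

definition Ekin :: "phase_fun \<Rightarrow> ennreal" where
  "Ekin f = (\<integral>\<^sup>+ z. ennreal (norm (snd z) ^ 2 / 2 * f z) \<partial>lborel)"

definition Epot :: "phase_fun \<Rightarrow> real" where
  "Epot f = - (1 / (8 * pi)) * (\<integral> x. norm (gradU f x) ^ 2 \<partial>lborel)"

definition Cas :: "(real \<Rightarrow> real) \<Rightarrow> phase_fun \<Rightarrow> ennreal" where
  "Cas Q f = (\<integral>\<^sup>+ z. ennreal (Q (f z)) \<partial>lborel)"

definition Pfun :: "(real \<Rightarrow> real) \<Rightarrow> phase_fun \<Rightarrow> ennreal" where
  "Pfun Q f = Cas Q f + Ekin f"

definition HC :: "(real \<Rightarrow> real) \<Rightarrow> phase_fun \<Rightarrow> real" where
  "HC Q f = enn2real (Pfun Q f) + Epot f"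

definition FM :: "(real \<Rightarrow> real) \<Rightarrow> real \<Rightarrow> phase_fun set" where
  "FM Q M = {f. integrable lborel f \<and> (\<forall>z. 0 \<le> f z) \<and>
               (\<integral> z. f z \<partial>lborel) = M \<and> Pfun Q f < \<infinity>}"

definition hM :: "(real \<Rightarrow> real) \<Rightarrow> real \<Rightarrow> real" where
  "hM Q M = (INF f\<in>FM Q M. HC Q f)"

definition shift :: "phase_fun \<Rightarrow> real^3 \<Rightarrow> phase_fun" where
  "shift f a = (\<lambda>(x, v). f (x + a, v))"

definition in_Lp :: "real \<Rightarrow> phase_fun \<Rightarrow> bool" where
  "in_Lp p f \<longleftrightarrow> f \<in> borel_measurable lborel \<and> integrable lborel (\<lambda>z. \<bar>f z\<bar> powr p)"

text \<open>Weak convergence in L^p (1 < p < infinity): testing against the dual space L^q, 1/p + 1/q = 1.\<close>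
definition weak_Lp_conv :: "real \<Rightarrow> (nat \<Rightarrow> phase_fun) \<Rightarrow> phase_fun \<Rightarrow> bool" where
  "weak_Lp_conv p F f \<longleftrightarrow> (\<forall>k. in_Lp p (F k)) \<and> in_Lp p f \<and>
     (\<forall>g. in_Lp (p / (p - 1)) g \<longrightarrow>
        (\<lambda>k. \<integral> z. F k z * g z \<partial>lborel) \<longlonglongrightarrow> (\<integral> z. f z * g z \<partial>lborel))"

end

theory Submission
  imports Defs "HOL-Complex_Analysis.Great_Picard" "HOL-Library.Diagonal_Subsequence"
begin

text \<open>The interpolation estimate \<open>\<integral> \<rho>\<^bsup>4/3\<^esup> \<le> \<epsilon> \<P> + C M\<close> makes the potential energy subordinate to \<open>\<P>\<close>, so \<open>\<P>\<close> is
  bounded along minimizing sequences. Scaling gives \<open>h\<^sub>M < 0\<close> and \<open>h\<^bsub>M'\<^esub> \<ge> (M'/M)\<^bsup>1+\<alpha>\<^esup> h\<^sub>M\<close> for \<open>M' \<le> M\<close>, which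
  excludes vanishing and splitting: after translations the spatial densities are tight. Tightness
  and the \<open>L\<^bsup>4/3\<^esup>\<close> bound make the fields \<open>\<nabla>U\<close> precompact in \<open>L\<^sup>2\<close>.

  Instead of extracting a weak limit of the \<open>f\<^sub>n\<close>, apply the functional to the midpoints
  \<open>(f\<^sub>m + f\<^sub>n)/2\<close>: since the fields converge, the convexity defects
  \<open>\<integral>\<integral> Q(f\<^sub>m)/2 + Q(f\<^sub>n)/2 - Q((f\<^sub>m + f\<^sub>n)/2)\<close> tend to zero, and strict convexity of \<open>Q\<close> turns this into
  convergence in measure. A subsequence converges almost everywhere, no mass is lost, and Fatou's
  lemma identifies the limit as a minimizer.

  Only the pointwise bound \<open>\<bar>x\<bar>\<^bsup>-2\<^esup>\<close> for the kernel of \<open>\<nabla>U\<close> enters the estimates of the potential energy;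
  the identity \<open>\<integral> \<bar>\<nabla>U\<bar>\<^sup>2 = 4\<pi> \<integral>\<integral> \<rho>(x) \<rho>(y) / \<bar>x - y\<bar>\<close> is never used.\<close>

section \<open>Coulomb kernels\<close>

text \<open>The energy is a convex functional minus the square of an L^2 norm, so convexity alone
  decides nothing. Midpoints help because the nonconvex part is exactly quadratic: by the
  parallelogram identity, averaging two functions lowers the mean field energy by a quarter of the
  squared L^2 distance of their fields. Once the fields are Cauchy, a convexity gain that stays away
  from zero would put the midpoint below h_M. Almost everywhere convergence then lets Fatou act on Q
  and the kinetic energy pointwise, and weak convergence in L^p comes last, from boundedness and
  almost everywhere convergence. The kernel bound suffices because in R^3 the convolution of |x|^-2
  with itself is a multiple of |x|^-1. Products of field majorants are therefore dominated by a
  Coulomb form in the densities. That form is cut at a distance r: the near part is O(sqrt r) with a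
  constant depending only on the L^(4/3) bound, the far part is at most a product of masses over r.
  Each smallness claim about fields is a choice of r against these masses.\<close>

lemma pred_mem_ball [measurable (raw)]:
  fixes f g :: "'a \<Rightarrow> 'b::euclidean_space"
  assumes [measurable]: "f \<in> borel_measurable M" "g \<in> borel_measurable M"
  shows "Measurable.pred M (\<lambda>x. f x \<in> ball (g x) r)"
  unfolding mem_ball by measurable

lemma pred_mem_cball [measurable (raw)]:
  fixes f g :: "'a \<Rightarrow> 'b::euclidean_space"
  assumes [measurable]: "f \<in> borel_measurable M" "g \<in> borel_measurable M"
  shows "Measurable.pred M (\<lambda>x. f x \<in> cball (g x) r)"
  unfolding mem_cball by measurable

section \<open>Affine substitutions in Lebesgue integrals\<close>

lemma nn_integral_lborel_affine:
  fixes f :: "'a::euclidean_space \<Rightarrow> ennreal"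
  assumes [measurable]: "f \<in> borel_measurable borel" and c: "c \<noteq> 0"
  shows "(\<integral>\<^sup>+x. f x \<partial>lborel) = ennreal (\<bar>c\<bar> ^ DIM('a)) * (\<integral>\<^sup>+x. f (t + c *\<^sub>R x) \<partial>lborel)"
  by (subst lborel_affine[OF c, of t])
     (simp add: nn_integral_density nn_integral_distr nn_integral_cmult)

lemma integral_lborel_affine:
  fixes f :: "'a::euclidean_space \<Rightarrow> 'b::{banach, second_countable_topology}"
  assumes [measurable]: "f \<in> borel_measurable borel" and c: "c \<noteq> 0"
  shows "(\<integral>x. f x \<partial>lborel) = \<bar>c\<bar> ^ DIM('a) *\<^sub>R (\<integral>x. f (t + c *\<^sub>R x) \<partial>lborel)"
  by (subst lborel_affine[OF c, of t])
     (simp add: integral_density integral_distr)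

lemma nn_integral_lborel_translate:
  fixes f :: "'a::euclidean_space \<Rightarrow> ennreal"
  assumes [measurable]: "f \<in> borel_measurable borel"
  shows "(\<integral>\<^sup>+x. f (x + t) \<partial>lborel) = (\<integral>\<^sup>+x. f x \<partial>lborel)"
  using nn_integral_lborel_affine[OF assms, of 1 t] by (simp add: add.commute)

lemma ennreal_term_le_suminf: "f k \<le> (\<Sum>i. f i)" for f :: "nat \<Rightarrow> ennreal"
  using sum_le_suminf[of f "{k}"] by simp

text \<open>One constant serves both dyadic sums below. They produce 8 and 16 times the unit-ball
  volume; the exact value of either integral at \<open>r = 1\<close> is
  \<open>4 * pi\<close>.\<close>

definition shell_const :: real where "shell_const = 16 * unit_ball_vol 3"

lemma shell_const_pos: "0 < shell_const"
  unfolding shell_const_def by simp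

text \<open>Dyadic shells shrinking to the origin: where \<open>r / 2 ^ Suc k < norm x\<close> the
  integrand is at most \<open>4 ^ Suc k / r^2\<close>, and the ball of radius
  \<open>r / 2 ^ k\<close> has volume of order \<open>r^3 / 8 ^ k\<close>. The terms form a
  geometric series of ratio 1/2.\<close>

lemma nn_integral_inverse_square_ball:
  assumes r: "0 < r"
  shows "(\<integral>\<^sup>+(x::real^3). ennreal (indicator (ball 0 r) x / norm x ^ 2) \<partial>lborel) \<le> ennreal (shell_const * r)"
proof -
  have "(\<integral>\<^sup>+(x::real^3). ennreal (indicator (ball 0 r) x / norm x ^ 2) \<partial>lborel)
     \<le> (\<integral>\<^sup>+(x::real^3). (\<Sum>k. ennreal (4 ^ Suc k / r\<^sup>2) * indicator (cball 0 (r / 2 ^ k)) x) \<partial>lborel)"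
  proof (rule nn_integral_mono)
    fix x :: "real^3"
    show "ennreal (indicator (ball 0 r) x / norm x ^ 2)
       \<le> (\<Sum>k. ennreal (4 ^ Suc k / r\<^sup>2) * indicator (cball 0 (r / 2 ^ k)) x)"
    proof (cases "x \<noteq> 0 \<and> norm x < r")
      case False
      then show ?thesis by (auto simp: indicator_def)
    next
      case True
      \<comment> \<open>\<open>P\<close> fails at 0 and holds at some \<open>n\<close>; the place
        where it switches is the index of the shell containing \<open>x\<close>.\<close>
      define P where "P k \<longleftrightarrow> r / 2 ^ k < norm x" for k :: nat
      obtain n :: nat where "r / norm x < 2 ^ n"
        using real_arch_pow[of 2 "r / norm x"] by auto
      then have "P n" using True r by (auto simp: P_def field_simps)
      moreover have "\<not> P 0" using True by (auto simp: P_def)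
      ultimately obtain k where k: "\<not> P k" "P (Suc k)"
        using nat_induct[of "\<lambda>k. \<not> P k" n] by blast
      have "r / (2 * 2 ^ k) < norm x" using k(2) by (simp add: P_def)
      then have "(r / (2 * 2 ^ k))\<^sup>2 \<le> norm x ^ 2"
        using r by (intro power_mono) auto
      then have "1 / norm x ^ 2 \<le> 1 / (r / (2 * 2 ^ k))\<^sup>2"
        using r True by (intro divide_left_mono) (auto intro!: mult_pos_pos)
      also have "\<dots> = 4 ^ Suc k / r\<^sup>2"
        by (simp add: power2_eq_square power_mult_distrib[symmetric] field_simps)
      finally have "ennreal (indicator (ball 0 r) x / norm x ^ 2)
          \<le> ennreal (4 ^ Suc k / r\<^sup>2) * indicator (cball 0 (r / 2 ^ k)) x"
        using k(1) True by (simp add: P_def indicator_def ennreal_leI)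
      also have "\<dots> \<le> (\<Sum>i. ennreal (4 ^ Suc i / r\<^sup>2) * indicator (cball 0 (r / 2 ^ i)) x)"
        by (rule ennreal_term_le_suminf)
      finally show ?thesis .
    qed
  qed
  also have "\<dots> = (\<Sum>k. ennreal (4 ^ Suc k / r\<^sup>2) * emeasure lborel (cball (0::real^3) (r / 2 ^ k)))"
    by (subst nn_integral_suminf, measurable) (subst nn_integral_cmult_indicator, auto)
  also have "\<dots> = (\<Sum>k. ennreal (4 * unit_ball_vol 3 * r * (1 / 2) ^ k))"
  proof (rule arg_cong[where f = suminf], rule ext)
    fix k :: nat
    have e: "(8::real) ^ k = 4 ^ k * 2 ^ k" by (simp add: power_mult_distrib[symmetric])
    have e': "((2::real) ^ k) ^ 3 = 8 ^ k" by (simp add: power_mult[symmetric] mult.commute[of k] power_mult)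
    have "ennreal (4 ^ Suc k / r\<^sup>2) * emeasure lborel (cball (0::real^3) (r / 2 ^ k))
      = ennreal (4 ^ Suc k / r\<^sup>2 * (unit_ball_vol 3 * (r / 2 ^ k) ^ 3))"
      using r by (simp add: emeasure_cball ennreal_mult[symmetric])
    also have "4 ^ Suc k / r\<^sup>2 * (unit_ball_vol 3 * (r / 2 ^ k) ^ 3) = 4 * unit_ball_vol 3 * r * (1 / 2) ^ k"
      using r by (simp add: power_divide e e' power2_eq_square power3_eq_cube field_simps)
         (simp flip: power_mult_distrib)
    finally show "ennreal (4 ^ Suc k / r\<^sup>2) * emeasure lborel (cball (0::real^3) (r / 2 ^ k))
      = ennreal (4 * unit_ball_vol 3 * r * (1 / 2) ^ k)" .
  qed
  also have "\<dots> = ennreal (\<Sum>k. 4 * unit_ball_vol 3 * r * (1 / 2) ^ k)"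
    using r by (intro suminf_ennreal2) auto
  also have "(\<Sum>k. 4 * unit_ball_vol 3 * r * (1 / 2) ^ k) = 8 * unit_ball_vol 3 * r"
    by (subst suminf_mult) (auto simp: suminf_geometric)
  also have "ennreal (8 * unit_ball_vol 3 * r) \<le> ennreal (shell_const * r)"
    using r by (intro ennreal_leI) (simp add: shell_const_def)
  finally show ?thesis .
qed

text \<open>The same argument with shells growing to infinity: the factor \<open>1 / 16 ^ k\<close>
  of the integrand beats the volume factor \<open>8 ^ k\<close>, again with ratio 1/2.\<close>

lemma nn_integral_inverse_fourth_outside:
  assumes r: "0 < r"
  shows "(\<integral>\<^sup>+(x::real^3). ennreal (indicator (- ball 0 r) x / norm x ^ 4) \<partial>lborel) \<le> ennreal (shell_const / r)"
proof -
  have "(\<integral>\<^sup>+(x::real^3). ennreal (indicator (- ball 0 r) x / norm x ^ 4) \<partial>lborel)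
     \<le> (\<integral>\<^sup>+(x::real^3). (\<Sum>k. ennreal (1 / (r ^ 4 * 16 ^ k)) * indicator (cball 0 (r * 2 ^ Suc k)) x) \<partial>lborel)"
  proof (rule nn_integral_mono)
    fix x :: "real^3"
    show "ennreal (indicator (- ball 0 r) x / norm x ^ 4)
       \<le> (\<Sum>k. ennreal (1 / (r ^ 4 * 16 ^ k)) * indicator (cball 0 (r * 2 ^ Suc k)) x)"
    proof (cases "r \<le> norm x")
      case False
      then show ?thesis by (auto simp: indicator_def)
    next
      case True
      define P where "P k \<longleftrightarrow> norm x < r * 2 ^ k" for k :: nat
      obtain n :: nat where "norm x / r < 2 ^ n"
        using real_arch_pow[of 2 "norm x / r"] by auto
      then have "P n" using True r by (auto simp: P_def field_simps)
      moreover have "\<not> P 0" using True by (auto simp: P_def)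
      ultimately obtain k where k: "\<not> P k" "P (Suc k)"
        using nat_induct[of "\<lambda>k. \<not> P k" n] by blast
      have "r * 2 ^ k \<le> norm x" using k(1) by (simp add: P_def)
      then have "(r * 2 ^ k) ^ 4 \<le> norm x ^ 4"
        using r by (intro power_mono) auto
      then have "1 / norm x ^ 4 \<le> 1 / (r * 2 ^ k) ^ 4"
        using r True by (intro divide_left_mono) (auto intro!: mult_pos_pos)
      also have "\<dots> = 1 / (r ^ 4 * 16 ^ k)"
        by (simp add: power_mult_distrib power_mult[symmetric] mult.commute[of k]) (simp add: power_mult)
      finally have "ennreal (indicator (- ball 0 r) x / norm x ^ 4)
          \<le> ennreal (1 / (r ^ 4 * 16 ^ k)) * indicator (cball 0 (r * 2 ^ Suc k)) x"
        using k(2) True by (simp add: P_def indicator_def ennreal_leI)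
      also have "\<dots> \<le> (\<Sum>i. ennreal (1 / (r ^ 4 * 16 ^ i)) * indicator (cball 0 (r * 2 ^ Suc i)) x)"
        by (rule ennreal_term_le_suminf)
      finally show ?thesis .
    qed
  qed
  also have "\<dots> = (\<Sum>k. ennreal (1 / (r ^ 4 * 16 ^ k)) * emeasure lborel (cball (0::real^3) (r * 2 ^ Suc k)))"
    by (subst nn_integral_suminf, measurable) (subst nn_integral_cmult_indicator, auto)
  also have "\<dots> = (\<Sum>k. ennreal (8 * unit_ball_vol 3 / r * (1 / 2) ^ k))"
  proof (rule arg_cong[where f = suminf], rule ext)
    fix k :: nat
    have e: "(16::real) ^ k = 8 ^ k * 2 ^ k" by (simp add: power_mult_distrib[symmetric])
    have e': "((2::real) ^ k) ^ 3 = 8 ^ k" by (simp add: power_mult[symmetric] mult.commute[of k] power_mult)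
    have "ennreal (1 / (r ^ 4 * 16 ^ k)) * emeasure lborel (cball (0::real^3) (r * 2 ^ Suc k))
      = ennreal (1 / (r ^ 4 * 16 ^ k) * (unit_ball_vol 3 * (r * 2 ^ Suc k) ^ 3))"
      using r by (simp add: emeasure_cball ennreal_mult[symmetric])
    also have "1 / (r ^ 4 * 16 ^ k) * (unit_ball_vol 3 * (r * 2 ^ Suc k) ^ 3) = 8 * unit_ball_vol 3 / r * (1 / 2) ^ k"
      using r by (simp add: power_divide power_mult_distrib e e' power4_eq_xxxx power3_eq_cube field_simps)
         (simp flip: power_mult_distrib)
    finally show "ennreal (1 / (r ^ 4 * 16 ^ k)) * emeasure lborel (cball (0::real^3) (r * 2 ^ Suc k))
      = ennreal (8 * unit_ball_vol 3 / r * (1 / 2) ^ k)" .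
  qed
  also have "\<dots> = ennreal (\<Sum>k. 8 * unit_ball_vol 3 / r * (1 / 2) ^ k)"
    using r by (intro suminf_ennreal2) auto
  also have "(\<Sum>k. 8 * unit_ball_vol 3 / r * (1 / 2) ^ k) = shell_const / r"
    by (subst suminf_mult) (auto simp: suminf_geometric shell_const_def)
  finally show ?thesis by simp
qed

text \<open>Upper half of the composition rule for Riesz kernels. With
  \<open>d = norm (y - z)\<close>, a point closer than \<open>d / 2\<close> to one pole is at least
  \<open>d / 2\<close> away from the other, so one factor is bounded by \<open>4 / d^2\<close>. Away
  from both poles the product is at most the sum of the inverse fourth powers. Each of the four
  pieces integrates to order \<open>1 / d\<close>.\<close>

lemma nn_integral_inverse_squares_product:
  fixes y z :: "real^3"
  assumes "y \<noteq> z"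
  shows "(\<integral>\<^sup>+x. ennreal (1 / norm (x - y) ^ 2) * ennreal (1 / norm (x - z) ^ 2) \<partial>lborel)
    \<le> ennreal (8 * shell_const / norm (y - z))"
proof -
  define d where "d = norm (y - z)"
  have d: "0 < d" using assms by (simp add: d_def)
  define N where "N p x = ennreal (indicator (ball 0 (d/2)) (x - p) / norm (x - p) ^ 2)" for p x :: "real^3"
  define O4 where "O4 p x = ennreal (indicator (- ball 0 (d/2)) (x - p) / norm (x - p) ^ 4)" for p x :: "real^3"
  have [measurable]: "N p \<in> borel_measurable borel" "O4 p \<in> borel_measurable borel" for p
    unfolding N_def O4_def by measurable
  have iN: "(\<integral>\<^sup>+x. N p x \<partial>lborel) \<le> ennreal (shell_const * (d/2))" for p
    using nn_integral_lborel_translate[of "\<lambda>x::real^3. ennreal (indicator (ball 0 (d/2)) x / norm x ^ 2)" "- p"]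
      nn_integral_inverse_square_ball[of "d/2"] d unfolding N_def by simp
  have iO: "(\<integral>\<^sup>+x. O4 p x \<partial>lborel) \<le> ennreal (shell_const / (d/2))" for p
    using nn_integral_lborel_translate[of "\<lambda>x::real^3. ennreal (indicator (- ball 0 (d/2)) x / norm x ^ 4)" "- p"]
      nn_integral_inverse_fourth_outside[of "d/2"] d unfolding O4_def by simp
  have pt: "ennreal (1 / norm (x - y) ^ 2) * ennreal (1 / norm (x - z) ^ 2)
     \<le> ennreal (4 / d\<^sup>2) * N y x + ennreal (4 / d\<^sup>2) * N z x + O4 y x + O4 z x" for x
  proof -
    define a b where "a = norm (x - y)" and "b = norm (x - z)"
    have ab: "0 \<le> a" "0 \<le> b" by (auto simp: a_def b_def)
    have tri: "d \<le> a + b" unfolding d_def a_def b_def by norm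
    have sq: "1 / u\<^sup>2 \<le> 4 / d\<^sup>2" if "d / 2 \<le> u" for u
    proof -
      have "(d/2)\<^sup>2 \<le> u\<^sup>2" using that d by (intro power_mono) auto
      then have "1 / u\<^sup>2 \<le> 1 / (d/2)\<^sup>2" using d that by (intro divide_left_mono) (auto intro!: mult_pos_pos)
      then show ?thesis by (simp add: power_divide)
    qed
    have LHS: "ennreal (1 / norm (x - y) ^ 2) * ennreal (1 / norm (x - z) ^ 2) = ennreal ((1 / a\<^sup>2) * (1 / b\<^sup>2))"
      by (simp add: a_def b_def ennreal_mult[symmetric])
    consider "a < d/2" | "b < d/2" | "d/2 \<le> a" "d/2 \<le> b" by linarith
    then show ?thesis
    proof cases
      case 1
      then have "d/2 \<le> b" using tri by linarith
      then have "(1 / a\<^sup>2) * (1 / b\<^sup>2) \<le> (4 / d\<^sup>2) * (1 / a\<^sup>2)"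
        using sq[of b] by (subst mult.commute, intro mult_right_mono) auto
      then have "ennreal ((1 / a\<^sup>2) * (1 / b\<^sup>2)) \<le> ennreal (4 / d\<^sup>2) * N y x"
        using 1 by (simp add: N_def a_def ennreal_mult[symmetric] ennreal_leI)
      then show ?thesis unfolding LHS by (meson add_increasing2 zero_le order_trans)
    next
      case 2
      then have "d/2 \<le> a" using tri by linarith
      then have "(1 / a\<^sup>2) * (1 / b\<^sup>2) \<le> (4 / d\<^sup>2) * (1 / b\<^sup>2)"
        using sq[of a] by (intro mult_right_mono) auto
      then have "ennreal ((1 / a\<^sup>2) * (1 / b\<^sup>2)) \<le> ennreal (4 / d\<^sup>2) * N z x"
        using 2 by (simp add: N_def b_def ennreal_mult[symmetric] ennreal_leI)
      then have "ennreal ((1 / a\<^sup>2) * (1 / b\<^sup>2)) \<le> ennreal (4 / d\<^sup>2) * N y x + ennreal (4 / d\<^sup>2) * N z x"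
        by (meson add_increasing zero_le order_trans)
      then show ?thesis unfolding LHS by (meson add_increasing2 zero_le order_trans)
    next
      case 3
      define p q where "p = 1 / a\<^sup>2" and "q = 1 / b\<^sup>2"
      have "2 * (p * q) \<le> p\<^sup>2 + q\<^sup>2" using sum_squares_bound[of p q] by simp
      moreover have "0 \<le> p * q" by (simp add: p_def q_def)
      ultimately have "p * q \<le> p\<^sup>2 + q\<^sup>2" by linarith
      moreover have "p\<^sup>2 = 1 / a ^ 4" "q\<^sup>2 = 1 / b ^ 4"
        by (simp_all add: p_def q_def power_divide power_mult[symmetric])
      ultimately have "ennreal ((1 / a\<^sup>2) * (1 / b\<^sup>2)) \<le> ennreal (1 / a ^ 4 + 1 / b ^ 4)"
        unfolding p_def q_def by (intro ennreal_leI) simp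
      also have "\<dots> = O4 y x + O4 z x"
        using 3 by (simp add: O4_def a_def b_def)
      also have "\<dots> \<le> ennreal (4 / d\<^sup>2) * N y x + ennreal (4 / d\<^sup>2) * N z x + O4 y x + O4 z x"
        by (simp add: add.assoc)
      finally show ?thesis unfolding LHS .
    qed
  qed
  have "(\<integral>\<^sup>+x. ennreal (1 / norm (x - y) ^ 2) * ennreal (1 / norm (x - z) ^ 2) \<partial>lborel)
     \<le> (\<integral>\<^sup>+x. ennreal (4 / d\<^sup>2) * N y x + ennreal (4 / d\<^sup>2) * N z x + O4 y x + O4 z x \<partial>lborel)"
    by (intro nn_integral_mono pt)
  also have "\<dots> = ennreal (4 / d\<^sup>2) * (\<integral>\<^sup>+x. N y x \<partial>lborel) + ennreal (4 / d\<^sup>2) * (\<integral>\<^sup>+x. N z x \<partial>lborel)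
      + (\<integral>\<^sup>+x. O4 y x \<partial>lborel) + (\<integral>\<^sup>+x. O4 z x \<partial>lborel)"
    by (simp add: nn_integral_add nn_integral_cmult)
  also have "\<dots> \<le> ennreal (4 / d\<^sup>2) * ennreal (shell_const * (d/2)) + ennreal (4 / d\<^sup>2) * ennreal (shell_const * (d/2))
      + ennreal (shell_const / (d/2)) + ennreal (shell_const / (d/2))"
    by (intro add_mono mult_left_mono iN iO) auto
  also have "\<dots> = ennreal (8 * shell_const / d)"
    using d shell_const_pos
    by (simp add: ennreal_mult[symmetric] ennreal_plus[symmetric] del: ennreal_plus)
       (simp add: power2_eq_square field_simps)
  finally show ?thesis by (simp add: d_def)
qed

section \<open>Riesz potentials and the truncated Coulomb form\<close>

definition riesz :: "(real^3) set \<Rightarrow> (real^3 \<Rightarrow> ennreal) \<Rightarrow> real^3 \<Rightarrow> ennreal" where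
  "riesz F g x = (\<integral>\<^sup>+y. g y * (indicator F (x - y) * ennreal (1 / norm (x - y) ^ 2)) \<partial>lborel)"

text \<open>Coulomb interaction of two densities, restricted to displacements in \<open>E\<close>.
  Values in \<open>ennreal\<close> allow Tonelli and splitting of \<open>E\<close> before anything
  is known to be finite.\<close>

definition bil :: "(real^3) set \<Rightarrow> (real^3 \<Rightarrow> ennreal) \<Rightarrow> (real^3 \<Rightarrow> ennreal) \<Rightarrow> ennreal" where
  "bil E g h = (\<integral>\<^sup>+y. \<integral>\<^sup>+z. g y * h z * (indicator E (y - z) * ennreal (1 / norm (y - z))) \<partial>lborel \<partial>lborel)"

lemma measurable_riesz [measurable]:
  assumes [measurable]: "F \<in> sets borel" "g \<in> borel_measurable borel"
  shows "riesz F g \<in> borel_measurable borel"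
  unfolding riesz_def[abs_def] by measurable

text \<open>Tonelli brings the integral over \<open>x\<close> inside, where the product of the two
  kernels integrates to a multiple of \<open>1 / norm (y - z)\<close>. The sets match because
  \<open>y - z = (x - z) - (x - y)\<close>: if both displacements from \<open>x\<close> lie in
  \<open>F\<close>, their difference lies in \<open>E\<close>.\<close>

lemma nn_integral_riesz_mult_le:
  assumes [measurable]: "F \<in> sets borel" "E \<in> sets borel" "g \<in> borel_measurable borel" "h \<in> borel_measurable borel"
    and FE: "\<And>a b. a \<in> F \<Longrightarrow> b \<in> F \<Longrightarrow> b - a \<in> E"
  shows "(\<integral>\<^sup>+x. riesz F g x * riesz F h x \<partial>lborel) \<le> ennreal (8 * shell_const) * bil E g h"
proof -
  define k where "k w = indicator F w * ennreal (1 / norm w ^ 2)" for w :: "real^3"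
  have [measurable]: "k \<in> borel_measurable borel" unfolding k_def[abs_def] by measurable
  have "(\<integral>\<^sup>+x. riesz F g x * riesz F h x \<partial>lborel)
      = (\<integral>\<^sup>+x. \<integral>\<^sup>+y. \<integral>\<^sup>+z. g y * h z * (k (x - y) * k (x - z)) \<partial>lborel \<partial>lborel \<partial>lborel)"
    unfolding riesz_def k_def[symmetric]
    by (intro nn_integral_cong, subst nn_integral_multc[symmetric], measurable, intro nn_integral_cong,
        subst nn_integral_cmult[symmetric], measurable, intro nn_integral_cong)
       (simp add: mult_ac)
  also have "\<dots> = (\<integral>\<^sup>+y. \<integral>\<^sup>+x. \<integral>\<^sup>+z. g y * h z * (k (x - y) * k (x - z)) \<partial>lborel \<partial>lborel \<partial>lborel)"
    by (rule lborel_pair.Fubini') measurable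
  also have "\<dots> = (\<integral>\<^sup>+y. \<integral>\<^sup>+z. \<integral>\<^sup>+x. g y * h z * (k (x - y) * k (x - z)) \<partial>lborel \<partial>lborel \<partial>lborel)"
    by (intro nn_integral_cong lborel_pair.Fubini') measurable
  also have "\<dots> = (\<integral>\<^sup>+y. \<integral>\<^sup>+z. g y * h z * (\<integral>\<^sup>+x. k (x - y) * k (x - z) \<partial>lborel) \<partial>lborel \<partial>lborel)"
    by (intro nn_integral_cong) (simp add: nn_integral_cmult)
  also have "\<dots> \<le> (\<integral>\<^sup>+y. \<integral>\<^sup>+z. ennreal (8 * shell_const) * (g y * h z * (indicator E (y - z) * ennreal (1 / norm (y - z)))) \<partial>lborel \<partial>lborel)"
  \<comment> \<open>The diagonal \<open>z = y\<close> must be left out: there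
    \<open>1 / norm 0 = 0\<close>, so the right-hand side vanishes while the left need not.\<close>
  proof (rule nn_integral_mono, rule nn_integral_mono_AE)
    fix y :: "real^3"
    show "AE z in lborel. g y * h z * (\<integral>\<^sup>+x. k (x - y) * k (x - z) \<partial>lborel)
       \<le> ennreal (8 * shell_const) * (g y * h z * (indicator E (y - z) * ennreal (1 / norm (y - z))))"
      using AE_lborel_singleton[of y]
    proof eventually_elim
      fix z assume "z \<noteq> y"
      have "(\<integral>\<^sup>+x. k (x - y) * k (x - z) \<partial>lborel)
        \<le> (\<integral>\<^sup>+x. indicator E (y - z) * (ennreal (1 / norm (x - y) ^ 2) * ennreal (1 / norm (x - z) ^ 2)) \<partial>lborel)"
      proof (rule nn_integral_mono)
        fix x
        show "k (x - y) * k (x - z) \<le> indicator E (y - z) * (ennreal (1 / norm (x - y) ^ 2) * ennreal (1 / norm (x - z) ^ 2))"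
          using FE[of "x - y" "x - z"] FE[of "x - z" "x - y"] by (auto simp: k_def indicator_def)
      qed
      also have "\<dots> = indicator E (y - z) * (\<integral>\<^sup>+x. ennreal (1 / norm (x - y) ^ 2) * ennreal (1 / norm (x - z) ^ 2) \<partial>lborel)"
        by (rule nn_integral_cmult) measurable
      also have "\<dots> \<le> indicator E (y - z) * ennreal (8 * shell_const / norm (y - z))"
        using \<open>z \<noteq> y\<close> by (intro mult_left_mono nn_integral_inverse_squares_product) auto
      also have "\<dots> = ennreal (8 * shell_const) * (indicator E (y - z) * ennreal (1 / norm (y - z)))"
        using shell_const_pos by (simp add: indicator_def ennreal_mult[symmetric])
      finally show "g y * h z * (\<integral>\<^sup>+x. k (x - y) * k (x - z) \<partial>lborel)
         \<le> ennreal (8 * shell_const) * (g y * h z * (indicator E (y - z) * ennreal (1 / norm (y - z))))"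
        by (subst mult.left_commute) (intro mult_left_mono, auto)
    qed
  qed
  also have "\<dots> = ennreal (8 * shell_const) * bil E g h"
    unfolding bil_def by (simp add: nn_integral_cmult)
  finally show ?thesis .
qed

lemma bil_mono:
  assumes "\<And>y. g y \<le> g' y" "\<And>y. h y \<le> h' y" "E \<subseteq> E'"
  shows "bil E g h \<le> bil E' g' h'"
  unfolding bil_def using assms(3)
  by (intro nn_integral_mono mult_mono assms(1,2)) (auto simp: indicator_def)

lemma bil_split_near_far:
  assumes [measurable]: "E \<in> sets borel" "g \<in> borel_measurable borel" "h \<in> borel_measurable borel"
  shows "bil UNIV g h = bil E g h + bil (- E) g h"
  unfolding bil_def
  by (subst nn_integral_add[symmetric], measurable, intro nn_integral_cong,
      subst nn_integral_add[symmetric], measurable, intro nn_integral_cong)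
     (auto simp: indicator_def)

text \<open>The separation may come from \<open>E\<close> or from the supports of \<open>g\<close>
  and \<open>h\<close>. The first case is the far part of the kernel, the second the interaction of
  two distant pieces of mass.\<close>

lemma bil_far_le:
  assumes [measurable]: "g \<in> borel_measurable borel" "h \<in> borel_measurable borel" and r: "0 < r"
    and far: "\<And>y z. g y \<noteq> 0 \<Longrightarrow> h z \<noteq> 0 \<Longrightarrow> y - z \<in> E \<Longrightarrow> r \<le> norm (y - z)"
  shows "bil E g h \<le> ennreal (1 / r) * ((\<integral>\<^sup>+y. g y \<partial>lborel) * (\<integral>\<^sup>+y. h y \<partial>lborel))"
proof -
  have "bil E g h \<le> (\<integral>\<^sup>+y. \<integral>\<^sup>+z. ennreal (1 / r) * (g y * h z) \<partial>lborel \<partial>lborel)"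
    unfolding bil_def
  proof (intro nn_integral_mono)
    fix y z
    show "g y * h z * (indicator E (y - z) * ennreal (1 / norm (y - z))) \<le> ennreal (1 / r) * (g y * h z)"
    proof (cases "g y = 0 \<or> h z = 0 \<or> y - z \<notin> E")
      case False
      then have "r \<le> norm (y - z)" using far by blast
      then have "1 / norm (y - z) \<le> 1 / r" using r by (intro divide_left_mono) (auto intro!: mult_pos_pos)
      then show ?thesis using False
        by (subst (2) mult.commute) (intro mult_left_mono, auto simp: ennreal_leI)
    qed auto
  qed
  also have "\<dots> = ennreal (1 / r) * ((\<integral>\<^sup>+y. g y \<partial>lborel) * (\<integral>\<^sup>+y. h y \<partial>lborel))"
    by (simp add: nn_integral_cmult nn_integral_multc)
  finally show ?thesis .
qed

text \<open>Young's inequality with exponents \<open>(4/3, 2, 4/3)\<close>, obtained by integrating the arithmetic-geometric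
  mean inequality \<open>pqk \<le> s/2 (pq)\<^bsup>4/3\<^esup> + 1/(4s) (p\<^bsup>4/3\<^esup> + q\<^bsup>4/3\<^esup>) k\<^sup>2\<close>.\<close>

lemma bil_ball_le_param:
  fixes p :: "real^3 \<Rightarrow> real"
  assumes [measurable]: "p \<in> borel_measurable borel" and p0: "\<And>x. 0 \<le> p x" and r: "0 < r" and s: "0 < s"
    and A: "(\<integral>\<^sup>+x. ennreal (p x powr (4/3)) \<partial>lborel) \<le> ennreal A" and A0: "0 \<le> A"
  shows "bil (ball 0 r) (\<lambda>x. ennreal (p x)) (\<lambda>x. ennreal (p x)) \<le> ennreal (s * A\<^sup>2 + shell_const * r * A / s)"
proof -
  define k where "k w = indicator (ball 0 r) w / norm w" for w :: "real^3"
  define P where "P x = ennreal (p x powr (4/3))" for x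
  define K where "K w = ennreal ((k w)\<^sup>2)" for w
  have [measurable]: "k \<in> borel_measurable borel" "P \<in> borel_measurable borel" "K \<in> borel_measurable borel"
    unfolding k_def[abs_def] P_def[abs_def] K_def[abs_def] by measurable
  have k0: "0 \<le> k w" for w by (simp add: k_def)
  have amgm: "a * b * c \<le> s / 2 * (a powr (4/3) * b powr (4/3)) + 1 / (4 * s) * (a powr (4/3) * c\<^sup>2 + b powr (4/3) * c\<^sup>2)"
    if "0 \<le> a" "0 \<le> b" "0 \<le> c" for a b c :: real
  proof -
    \<comment> \<open>Cube roots turn all exponents into integers. One arithmetic-geometric mean
      with weight \<open>s\<close> separates \<open>X\<close> from \<open>Y\<close>, a second one
      separates \<open>u\<close> from \<open>v\<close> inside \<open>Y^2\<close>.\<close>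
    define u v where "u = a powr (1/3)" and "v = b powr (1/3)"
    have uv: "0 \<le> u" "0 \<le> v" by (auto simp: u_def v_def)
    have a: "a = u ^ 3" "a powr (4/3) = u ^ 4"
      using that(1) by (auto simp: u_def powr_powr simp flip: powr_realpow')
    have b: "b = v ^ 3" "b powr (4/3) = v ^ 4"
      using that(2) by (auto simp: v_def powr_powr simp flip: powr_realpow')
    define X Y where "X = u\<^sup>2 * v\<^sup>2" and "Y = u * v * c"
    have "0 \<le> (s * X - Y)\<^sup>2" by simp
    then have "2 * s * (X * Y) \<le> s\<^sup>2 * X\<^sup>2 + Y\<^sup>2" by (simp add: power2_diff power_mult_distrib mult_ac)
    then have 1: "X * Y \<le> s / 2 * X\<^sup>2 + 1 / (2 * s) * Y\<^sup>2"
      using s by (simp add: field_simps power2_eq_square)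
    have "2 * (u\<^sup>2 * v\<^sup>2) \<le> u ^ 4 + v ^ 4"
      using sum_squares_bound[of "u\<^sup>2" "v\<^sup>2"] by (simp add: power_mult[symmetric])
    then have "2 * (u\<^sup>2 * v\<^sup>2) * c\<^sup>2 \<le> (u ^ 4 + v ^ 4) * c\<^sup>2" by (intro mult_right_mono) auto
    then have "Y\<^sup>2 \<le> 1/2 * (u ^ 4 * c\<^sup>2 + v ^ 4 * c\<^sup>2)" by (simp add: Y_def power_mult_distrib algebra_simps)
    then have "1 / (2 * s) * Y\<^sup>2 \<le> 1 / (2 * s) * (1/2 * (u ^ 4 * c\<^sup>2 + v ^ 4 * c\<^sup>2))"
      using s by (intro mult_left_mono) auto
    with 1 have "X * Y \<le> s / 2 * X\<^sup>2 + 1 / (4 * s) * (u ^ 4 * c\<^sup>2 + v ^ 4 * c\<^sup>2)"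
      by simp
    moreover have "X * Y = a * b * c" "X\<^sup>2 = u ^ 4 * v ^ 4"
      unfolding X_def Y_def a b by (simp_all add: power_mult_distrib power_mult[symmetric] power2_eq_square power3_eq_cube power4_eq_xxxx mult_ac)
    ultimately show ?thesis unfolding a(2) b(2) by simp
  qed
  have iK: "(\<integral>\<^sup>+z. K (y - z) \<partial>lborel) \<le> ennreal (shell_const * r)" for y
  proof -
    have "(\<integral>\<^sup>+z. K (y - z) \<partial>lborel) = (\<integral>\<^sup>+z. K z \<partial>lborel)"
      using nn_integral_lborel_affine[of K "-1" y] by simp
    also have "\<dots> = (\<integral>\<^sup>+(x::real^3). ennreal (indicator (ball 0 r) x / norm x ^ 2) \<partial>lborel)"
      by (intro nn_integral_cong) (auto simp: K_def k_def indicator_def power_divide)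
    finally show ?thesis using nn_integral_inverse_square_ball[OF r] by simp
  qed
  have iK': "(\<integral>\<^sup>+y. K (y - z) \<partial>lborel) \<le> ennreal (shell_const * r)" for z
    using iK[of z] nn_integral_lborel_affine[of "\<lambda>y. K (y - z)" "-1" "2 *\<^sub>R z"]
    by (simp add: scaleR_2 algebra_simps)
  have "bil (ball 0 r) (\<lambda>x. ennreal (p x)) (\<lambda>x. ennreal (p x))
     \<le> (\<integral>\<^sup>+y. \<integral>\<^sup>+z. ennreal (s / 2) * (P y * P z) + ennreal (1 / (4 * s)) * (P y * K (y - z) + P z * K (y - z)) \<partial>lborel \<partial>lborel)"
    unfolding bil_def
  proof (intro nn_integral_mono)
    fix y z :: "real^3"
    have "ennreal (p y) * ennreal (p z) * (indicator (ball 0 r) (y - z) * ennreal (1 / norm (y - z))) = ennreal (p y * p z * k (y - z))"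
      using p0[of y] p0[of z] by (auto simp: k_def indicator_def ennreal_mult[symmetric])
    also have "\<dots> \<le> ennreal (s / 2 * (p y powr (4/3) * p z powr (4/3)) + 1 / (4 * s) * (p y powr (4/3) * (k (y - z))\<^sup>2 + p z powr (4/3) * (k (y - z))\<^sup>2))"
      by (intro ennreal_leI amgm p0 k0)
    also have "\<dots> = ennreal (s / 2) * (P y * P z) + ennreal (1 / (4 * s)) * (P y * K (y - z) + P z * K (y - z))"
      using s by (simp add: P_def K_def ennreal_mult[symmetric] ennreal_plus[symmetric] del: ennreal_plus)
    finally show "ennreal (p y) * ennreal (p z) * (indicator (ball 0 r) (y - z) * ennreal (1 / norm (y - z)))
       \<le> ennreal (s / 2) * (P y * P z) + ennreal (1 / (4 * s)) * (P y * K (y - z) + P z * K (y - z))" .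
  qed
  also have "\<dots> = ennreal (s / 2) * ((\<integral>\<^sup>+y. P y \<partial>lborel) * (\<integral>\<^sup>+y. P y \<partial>lborel))
     + ennreal (1 / (4 * s)) * ((\<integral>\<^sup>+y. P y * (\<integral>\<^sup>+z. K (y - z) \<partial>lborel) \<partial>lborel)
        + (\<integral>\<^sup>+y. \<integral>\<^sup>+z. P z * K (y - z) \<partial>lborel \<partial>lborel))"
    by (simp add: nn_integral_add nn_integral_cmult nn_integral_multc)
  also have "(\<integral>\<^sup>+y. \<integral>\<^sup>+z. P z * K (y - z) \<partial>lborel \<partial>lborel) = (\<integral>\<^sup>+z. \<integral>\<^sup>+y. P z * K (y - z) \<partial>lborel \<partial>lborel)"
    by (rule lborel_pair.Fubini') measurable
  also have "\<dots> = (\<integral>\<^sup>+z. P z * (\<integral>\<^sup>+y. K (y - z) \<partial>lborel) \<partial>lborel)"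
    by (simp add: nn_integral_cmult)
  also have "ennreal (s / 2) * ((\<integral>\<^sup>+y. P y \<partial>lborel) * (\<integral>\<^sup>+y. P y \<partial>lborel))
     + ennreal (1 / (4 * s)) * ((\<integral>\<^sup>+y. P y * (\<integral>\<^sup>+z. K (y - z) \<partial>lborel) \<partial>lborel) + (\<integral>\<^sup>+z. P z * (\<integral>\<^sup>+y. K (y - z) \<partial>lborel) \<partial>lborel))
    \<le> ennreal (s / 2) * ((\<integral>\<^sup>+y. P y \<partial>lborel) * (\<integral>\<^sup>+y. P y \<partial>lborel))
     + ennreal (1 / (4 * s)) * ((\<integral>\<^sup>+y. P y * ennreal (shell_const * r) \<partial>lborel) + (\<integral>\<^sup>+z. P z * ennreal (shell_const * r) \<partial>lborel))"
    by (intro add_mono mult_left_mono nn_integral_mono iK iK') auto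
  also have "\<dots> = ennreal (s / 2) * ((\<integral>\<^sup>+y. P y \<partial>lborel) * (\<integral>\<^sup>+y. P y \<partial>lborel))
     + ennreal (1 / (4 * s)) * ((\<integral>\<^sup>+y. P y \<partial>lborel) * ennreal (shell_const * r) + (\<integral>\<^sup>+y. P y \<partial>lborel) * ennreal (shell_const * r))"
    by (simp add: nn_integral_multc)
  also have "\<dots> \<le> ennreal (s / 2) * (ennreal A * ennreal A)
     + ennreal (1 / (4 * s)) * (ennreal A * ennreal (shell_const * r) + ennreal A * ennreal (shell_const * r))"
    using A unfolding P_def[symmetric] by (intro add_mono mult_mono) auto
  also have "\<dots> = ennreal (s / 2 * A\<^sup>2 + 1 / (4 * s) * (2 * A * (shell_const * r)))"
    using A0 r s shell_const_pos
    by (simp add: ennreal_mult[symmetric] ennreal_plus[symmetric] power2_eq_square del: ennreal_plus)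
  also have "\<dots> \<le> ennreal (s * A\<^sup>2 + shell_const * r * A / s)"
    using A0 r s shell_const_pos by (intro ennreal_leI) (simp add: field_simps)
  finally show ?thesis .
qed

text \<open>The weight \<open>s = sqrt r\<close> balances the two terms, so the near interaction is
  O(\<open>sqrt r\<close>) for fixed \<open>A\<close>.\<close>

lemma bil_ball_le:
  fixes p :: "real^3 \<Rightarrow> real"
  assumes "p \<in> borel_measurable borel" "\<And>x. 0 \<le> p x" and r: "0 < r"
    and "(\<integral>\<^sup>+x. ennreal (p x powr (4/3)) \<partial>lborel) \<le> ennreal A" "0 \<le> A"
  shows "bil (ball 0 r) (\<lambda>x. ennreal (p x)) (\<lambda>x. ennreal (p x)) \<le> ennreal (sqrt r * (A\<^sup>2 + shell_const * A))"
proof -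
  have "shell_const * r * A / sqrt r = sqrt r * (shell_const * A)"
    using r by (simp add: real_div_sqrt mult.commute mult.left_commute flip: times_divide_eq_right)
  then show ?thesis
    using bil_ball_le_param[OF assms(1,2) r _ assms(4,5), of "sqrt r"] r by (simp add: distrib_left)
qed

section \<open>Fields of densities\<close>

definition fld :: "(real^3 \<Rightarrow> real) \<Rightarrow> real^3 \<Rightarrow> real^3" where
  "fld p x = (\<integral>y. (p y / norm (x - y) ^ 3) *\<^sub>R (x - y) \<partial>lborel)"

lemma gradU_eq_fld: "gradU f = fld (rho f)"
  by (simp add: gradU_def fld_def fun_eq_iff)

lemma measurable_fld [measurable]:
  assumes [measurable]: "p \<in> borel_measurable borel"
  shows "fld p \<in> borel_measurable borel"
  unfolding fld_def[abs_def] by measurable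

lemma norm_coulomb_kernel: "norm ((a / norm w ^ 3) *\<^sub>R w) = \<bar>a\<bar> / norm w ^ 2"
  by (cases "w = 0") (simp_all add: power2_eq_square power3_eq_cube)

lemma riesz_abs_eq:
  "riesz UNIV (\<lambda>y. ennreal \<bar>p y\<bar>) x = (\<integral>\<^sup>+y. ennreal (norm ((p y / norm (x - y) ^ 3) *\<^sub>R (x - y))) \<partial>lborel)"
  unfolding riesz_def norm_coulomb_kernel
  by (intro nn_integral_cong) (simp add: ennreal_mult[symmetric])

lemma integrable_coulomb_kernel:
  assumes [measurable]: "p \<in> borel_measurable borel" and "riesz UNIV (\<lambda>y. ennreal \<bar>p y\<bar>) x < \<infinity>"
  shows "integrable lborel (\<lambda>y. (p y / norm (x - y) ^ 3) *\<^sub>R (x - y))"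
  using assms(2) unfolding riesz_abs_eq by (intro integrableI_bounded) auto

text \<open>This holds at every point: where the kernel is not integrable the Bochner integral
  defaults to 0.\<close>

lemma norm_fld_le:
  assumes [measurable]: "p \<in> borel_measurable borel"
  shows "ennreal (norm (fld p x)) \<le> riesz UNIV (\<lambda>y. ennreal \<bar>p y\<bar>) x"
proof (cases "integrable lborel (\<lambda>y. (p y / norm (x - y) ^ 3) *\<^sub>R (x - y))")
  case True
  then show ?thesis unfolding riesz_abs_eq fld_def by (rule integral_norm_bound_ennreal)
next
  case False
  then show ?thesis by (simp add: fld_def not_integrable_integral_eq)
qed

lemma fld_lincomb:
  assumes [measurable]: "p \<in> borel_measurable borel" "q \<in> borel_measurable borel"
    and "riesz UNIV (\<lambda>y. ennreal \<bar>p y\<bar>) x < \<infinity>" "riesz UNIV (\<lambda>y. ennreal \<bar>q y\<bar>) x < \<infinity>"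
  shows "fld (\<lambda>y. a * p y + b * q y) x = a *\<^sub>R fld p x + b *\<^sub>R fld q x"
proof -
  have "fld (\<lambda>y. a * p y + b * q y) x = (\<integral>y. a *\<^sub>R ((p y / norm (x - y) ^ 3) *\<^sub>R (x - y)) + b *\<^sub>R ((q y / norm (x - y) ^ 3) *\<^sub>R (x - y)) \<partial>lborel)"
    unfolding fld_def
    by (intro Bochner_Integration.integral_cong) (simp_all add: scaleR_add_left[symmetric] add_divide_distrib)
  also have "\<dots> = a *\<^sub>R fld p x + b *\<^sub>R fld q x"
    unfolding fld_def using integrable_coulomb_kernel[OF assms(1,3)] integrable_coulomb_kernel[OF assms(2,4)]
    by (subst Bochner_Integration.integral_add) (simp_all del: scaleR_scaleR)
  finally show ?thesis .
qed

text \<open>The exponent \<open>4/3\<close> is the one that the kinetic energy and \<open>\<integral> f\<^bsup>5/3\<^esup>\<close> control together; it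
  exceeds the critical exponent \<open>6/5\<close> of the Coulomb energy.\<close>

definition dens :: "real \<Rightarrow> real \<Rightarrow> (real^3 \<Rightarrow> real) \<Rightarrow> bool" where
  "dens M A p \<longleftrightarrow> p \<in> borel_measurable borel \<and> (\<forall>x. 0 \<le> p x) \<and> 0 \<le> M \<and> 0 \<le> A \<and>
     (\<integral>\<^sup>+x. ennreal (p x) \<partial>lborel) \<le> ennreal M \<and>
     (\<integral>\<^sup>+x. ennreal (p x powr (4/3)) \<partial>lborel) \<le> ennreal A"

lemma densD:
  assumes "dens M A p"
  shows "p \<in> borel_measurable borel" "\<And>x. 0 \<le> p x" "0 \<le> M" "0 \<le> A"
    "(\<integral>\<^sup>+x. ennreal (p x) \<partial>lborel) \<le> ennreal M"
    "(\<integral>\<^sup>+x. ennreal (p x powr (4/3)) \<partial>lborel) \<le> ennreal A"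
  using assms unfolding dens_def by auto

lemma dens_le:
  assumes "dens M A p" and [measurable]: "q \<in> borel_measurable borel" and "\<And>x. 0 \<le> q x" "\<And>x. q x \<le> p x"
  shows "dens M A q"
proof -
  have "(\<integral>\<^sup>+x. ennreal (q x) \<partial>lborel) \<le> (\<integral>\<^sup>+x. ennreal (p x) \<partial>lborel)"
    by (intro nn_integral_mono ennreal_leI assms)
  moreover have "(\<integral>\<^sup>+x. ennreal (q x powr (4/3)) \<partial>lborel) \<le> (\<integral>\<^sup>+x. ennreal (p x powr (4/3)) \<partial>lborel)"
    by (intro nn_integral_mono ennreal_leI powr_mono2 assms) auto
  ultimately show ?thesis using assms unfolding dens_def by (meson order_trans)
qed

lemma dens_mono: "dens M A p \<Longrightarrow> M \<le> M' \<Longrightarrow> A \<le> A' \<Longrightarrow> dens M' A' p"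
  unfolding dens_def by (meson order_trans ennreal_leI)

text \<open>In the near part \<open>g\<close> may be replaced by its majorant \<open>p\<close>; the
  far part sees \<open>g\<close> only through its mass \<open>m\<close>. For fixed \<open>r\<close>,
  a small \<open>m\<close> therefore makes the far part small although \<open>A\<close> is
  not.\<close>

lemma bil_near_far_le:
  assumes p: "dens M A p" and [measurable]: "g \<in> borel_measurable borel" and g: "\<And>x. g x \<le> ennreal (p x)"
    and m: "(\<integral>\<^sup>+x. g x \<partial>lborel) \<le> ennreal m" "0 \<le> m" and r: "0 < r"
  shows "bil UNIV g (\<lambda>x. ennreal (p x)) \<le> ennreal (sqrt r * (A\<^sup>2 + shell_const * A) + m * M / r)"
proof -
  note [measurable] = densD(1)[OF p]
  have "bil UNIV g (\<lambda>x. ennreal (p x)) = bil (ball 0 r) g (\<lambda>x. ennreal (p x)) + bil (- ball 0 r) g (\<lambda>x. ennreal (p x))"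
    by (rule bil_split_near_far) measurable
  also have "bil (ball 0 r) g (\<lambda>x. ennreal (p x)) \<le> bil (ball 0 r) (\<lambda>x. ennreal (p x)) (\<lambda>x. ennreal (p x))"
    by (intro bil_mono g) auto
  also have "\<dots> \<le> ennreal (sqrt r * (A\<^sup>2 + shell_const * A))"
    by (rule bil_ball_le) (use densD[OF p] r in auto)
  also have "bil (- ball 0 r) g (\<lambda>x. ennreal (p x)) \<le> ennreal (1 / r) * ((\<integral>\<^sup>+y. g y \<partial>lborel) * (\<integral>\<^sup>+y. ennreal (p y) \<partial>lborel))"
    by (rule bil_far_le) (use r in \<open>auto\<close>)
  also have "\<dots> \<le> ennreal (1 / r) * (ennreal m * ennreal M)"
    by (intro mult_left_mono mult_mono m densD(5)[OF p]) auto
  also have "\<dots> = ennreal (m * M / r)"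
    using r m densD(3)[OF p] by (simp add: ennreal_mult[symmetric])
  finally show ?thesis
    using r m densD[OF p] shell_const_pos by (simp add: add_mono)
qed

text \<open>Bound for an integral of a product of Riesz potentials: \<open>m\<close> and
  \<open>M\<close> are the masses of the two factors, \<open>A\<close> bounds the integral of the
  4/3 power, \<open>r\<close> is the splitting radius. With both masses set to 0 only the near
  contribution is left.\<close>

definition coul_const :: "real \<Rightarrow> real \<Rightarrow> real \<Rightarrow> real \<Rightarrow> real" where
  "coul_const A M m r = 8 * shell_const * (sqrt r * (A\<^sup>2 + shell_const * A) + m * M / r)"

lemma riesz_cross_le:
  assumes p: "dens M A p" and [measurable]: "g \<in> borel_measurable borel" and g: "\<And>x. g x \<le> ennreal (p x)"
    and m: "(\<integral>\<^sup>+x. g x \<partial>lborel) \<le> ennreal m" "0 \<le> m" and r: "0 < r"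
  shows "(\<integral>\<^sup>+x. riesz UNIV g x * riesz UNIV (\<lambda>x. ennreal (p x)) x \<partial>lborel) \<le> ennreal (coul_const A M m r)"
proof -
  note [measurable] = densD(1)[OF p]
  have "(\<integral>\<^sup>+x. riesz UNIV g x * riesz UNIV (\<lambda>x. ennreal (p x)) x \<partial>lborel)
      \<le> ennreal (8 * shell_const) * bil UNIV g (\<lambda>x. ennreal (p x))"
    by (rule nn_integral_riesz_mult_le) auto
  also have "\<dots> \<le> ennreal (8 * shell_const) * ennreal (sqrt r * (A\<^sup>2 + shell_const * A) + m * M / r)"
    by (intro mult_left_mono bil_near_far_le[OF p _ g m r]) auto
  also have "\<dots> = ennreal (coul_const A M m r)"
    unfolding coul_const_def using r m densD[OF p] shell_const_pos
    by (subst ennreal_mult) auto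
  finally show ?thesis .
qed

lemma riesz_square_le:
  assumes p: "dens M A p" and r: "0 < r"
  shows "(\<integral>\<^sup>+x. riesz UNIV (\<lambda>x. ennreal (p x)) x ^ 2 \<partial>lborel) \<le> ennreal (coul_const A M M r)"
  using riesz_cross_le[OF p _ _ densD(5,3)[OF p] r] densD(1)[OF p] by (simp add: power2_eq_square)

text \<open>Two sources within \<open>r\<close> of the same point are within \<open>2 * r\<close> of
  each other, so the form has no far part. This is the error made by regularising the kernel at
  scale \<open>r\<close>.\<close>

lemma riesz_local_square_le:
  assumes p: "dens M A p" and r: "0 < r"
  shows "(\<integral>\<^sup>+x. riesz (ball 0 r) (\<lambda>x. ennreal (p x)) x ^ 2 \<partial>lborel) \<le> ennreal (coul_const A 0 0 (2 * r))"
proof -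
  note [measurable] = densD(1)[OF p]
  have "(\<integral>\<^sup>+x. riesz (ball 0 r) (\<lambda>x. ennreal (p x)) x ^ 2 \<partial>lborel)
      \<le> ennreal (8 * shell_const) * bil (ball 0 (2 * r)) (\<lambda>x. ennreal (p x)) (\<lambda>x. ennreal (p x))"
    unfolding power2_eq_square
  proof (rule nn_integral_riesz_mult_le)
    fix a b :: "real^3" assume "a \<in> ball 0 r" "b \<in> ball 0 r"
    then show "b - a \<in> ball 0 (2 * r)" using norm_triangle_ineq4[of b a] by simp
  qed auto
  also have "\<dots> \<le> ennreal (8 * shell_const) * ennreal (sqrt (2 * r) * (A\<^sup>2 + shell_const * A))"
    by (intro mult_left_mono bil_ball_le) (use densD[OF p] r in auto)
  also have "\<dots> = ennreal (coul_const A 0 0 (2 * r))"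
    unfolding coul_const_def using r densD[OF p] shell_const_pos
    by (subst ennreal_mult) auto
  finally show ?thesis .
qed

text \<open>A square integrable potential is finite off a null set, and there the integral defining
  the field converges absolutely. Linearity of \<open>fld\<close> is accordingly an almost
  everywhere statement.\<close>

lemma AE_riesz_finite:
  assumes p: "dens M A p"
  shows "AE x in lborel. riesz UNIV (\<lambda>x. ennreal \<bar>p x\<bar>) x < \<infinity>"
proof -
  note [measurable] = densD(1)[OF p]
  have "AE x in lborel. riesz UNIV (\<lambda>x. ennreal (p x)) x ^ 2 \<noteq> \<infinity>"
    using riesz_square_le[OF p, of 1] by (intro nn_integral_PInf_AE) (auto simp: top_unique)
  then show ?thesis
    by eventually_elim (use densD(2)[OF p] in \<open>auto simp: power2_eq_square ennreal_mult_less_top less_top[symmetric]\<close>)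
qed

lemma fld_square_le:
  assumes p: "dens M A p" and r: "0 < r"
  shows "(\<integral>\<^sup>+x. ennreal (norm (fld p x) ^ 2) \<partial>lborel) \<le> ennreal (coul_const A M M r)"
proof -
  have "(\<integral>\<^sup>+x. ennreal (norm (fld p x) ^ 2) \<partial>lborel) \<le> (\<integral>\<^sup>+x. riesz UNIV (\<lambda>x. ennreal (p x)) x ^ 2 \<partial>lborel)"
    using norm_fld_le[OF densD(1)[OF p]] densD(2)[OF p]
    by (intro nn_integral_mono) (simp add: ennreal_power[symmetric] power_mono)
  also note riesz_square_le[OF p r]
  finally show ?thesis .
qed

lemma integrable_fld_square:
  assumes p: "dens M A p"
  shows "integrable lborel (\<lambda>x. norm (fld p x) ^ 2)"
proof (rule integrableI_bounded)
  show "(\<lambda>x. norm (fld p x) ^ 2) \<in> borel_measurable lborel" using densD(1)[OF p] by measurable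
  show "(\<integral>\<^sup>+x. ennreal (norm (norm (fld p x) ^ 2)) \<partial>lborel) < \<infinity>"
    using le_less_trans[OF fld_square_le[OF p, of 1] ennreal_less_top] by simp
qed

lemma AE_fld_lincomb:
  assumes p: "dens M A p" and q: "dens M' A' q"
  shows "AE x in lborel. fld (\<lambda>y. a * p y + b * q y) x = a *\<^sub>R fld p x + b *\<^sub>R fld q x"
  using AE_riesz_finite[OF p] AE_riesz_finite[OF q]
  by eventually_elim (rule fld_lincomb[OF densD(1)[OF p] densD(1)[OF q]])

lemma dens_abs_diff:
  assumes p: "dens M A p" and q: "dens M' A' q" and m: "(\<integral>\<^sup>+x. ennreal \<bar>p x - q x\<bar> \<partial>lborel) \<le> ennreal m" "0 \<le> m"
  shows "dens m (A + A') (\<lambda>x. \<bar>p x - q x\<bar>)"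
proof -
  note [measurable] = densD(1)[OF p] densD(1)[OF q]
  have "(\<integral>\<^sup>+x. ennreal (\<bar>p x - q x\<bar> powr (4/3)) \<partial>lborel)
    \<le> (\<integral>\<^sup>+x. ennreal (p x powr (4/3)) + ennreal (q x powr (4/3)) \<partial>lborel)"
  proof (rule nn_integral_mono)
    fix x
    have "\<bar>p x - q x\<bar> powr (4/3) \<le> (max (p x) (q x)) powr (4/3)"
      using densD(2)[OF p, of x] densD(2)[OF q, of x] by (intro powr_mono2) auto
    also have "\<dots> \<le> p x powr (4/3) + q x powr (4/3)" by (simp add: max_def)
    finally show "ennreal (\<bar>p x - q x\<bar> powr (4/3)) \<le> ennreal (p x powr (4/3)) + ennreal (q x powr (4/3))"
      by (simp add: ennreal_plus[symmetric] ennreal_leI del: ennreal_plus)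
  qed
  also have "\<dots> = (\<integral>\<^sup>+x. ennreal (p x powr (4/3)) \<partial>lborel) + (\<integral>\<^sup>+x. ennreal (q x powr (4/3)) \<partial>lborel)"
    by (rule nn_integral_add) auto
  also have "\<dots> \<le> ennreal A + ennreal A'" by (intro add_mono densD(6)[OF p] densD(6)[OF q])
  finally show ?thesis using m densD(4)[OF p] densD(4)[OF q] unfolding dens_def by auto
qed

text \<open>L^1 closeness of two densities with controlled 4/3 powers forces L^2 closeness of their
  fields: the estimate for a single density is applied to \<open>\<bar>p x - q x\<bar>\<close>,
  whose mass is at most \<open>m\<close>.\<close>

lemma fld_diff_square_le:
  assumes p: "dens M A p" and q: "dens M' A' q" and m: "(\<integral>\<^sup>+x. ennreal \<bar>p x - q x\<bar> \<partial>lborel) \<le> ennreal m" "0 \<le> m"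
    and r: "0 < r"
  shows "(\<integral>\<^sup>+x. ennreal (norm (fld p x - fld q x) ^ 2) \<partial>lborel) \<le> ennreal (coul_const (A + A') m m r)"
proof -
  note [measurable] = densD(1)[OF p] densD(1)[OF q]
  have "(\<integral>\<^sup>+x. ennreal (norm (fld p x - fld q x) ^ 2) \<partial>lborel)
     \<le> (\<integral>\<^sup>+x. riesz UNIV (\<lambda>x. ennreal \<bar>p x - q x\<bar>) x ^ 2 \<partial>lborel)"
  proof (rule nn_integral_mono_AE)
    show "AE x in lborel. ennreal (norm (fld p x - fld q x) ^ 2) \<le> riesz UNIV (\<lambda>x. ennreal \<bar>p x - q x\<bar>) x ^ 2"
      using AE_fld_lincomb[OF p q, of 1 "-1"]
    proof eventually_elim
      case (elim x)
      then have "fld p x - fld q x = fld (\<lambda>y. p y - q y) x" by simp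
      then show ?case using norm_fld_le[of "\<lambda>y. p y - q y" x]
        by (simp add: ennreal_power[symmetric] power_mono)
    qed
  qed
  also have "\<dots> \<le> ennreal (coul_const (A + A') m m r)"
    using riesz_square_le[OF dens_abs_diff[OF p q m] r] .
  finally show ?thesis .
qed

text \<open>Almost additivity of the field energy under a three-way splitting. The outer pieces
  \<open>p1\<close> and \<open>p3\<close> interact weakly because they are \<open>D\<close> apart;
  the transition piece \<open>p2\<close> interacts weakly with everything because its mass
  \<open>m\<close> is small.\<close>

lemma fld_split_le:
  assumes p: "dens M A p"
    and p1: "dens M A p1" and p2: "dens M A p2" and p3: "dens M A p3"
    and sum: "\<And>x. p x = p1 x + p2 x + p3 x"
    and m: "(\<integral>\<^sup>+x. ennreal (p2 x) \<partial>lborel) \<le> ennreal m" "0 \<le> m" and r: "0 < r"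
    and sep: "\<And>x y. p1 x \<noteq> 0 \<Longrightarrow> p3 y \<noteq> 0 \<Longrightarrow> D \<le> norm (x - y)" and D: "0 < D"
  shows "(\<integral>\<^sup>+x. ennreal (norm (fld p x) ^ 2) \<partial>lborel)
    \<le> (\<integral>\<^sup>+x. ennreal (norm (fld p1 x) ^ 2) \<partial>lborel) + (\<integral>\<^sup>+x. ennreal (norm (fld p3 x) ^ 2) \<partial>lborel)
      + ennreal (16 * shell_const * M\<^sup>2 / D + 2 * coul_const A M m r)"
proof -
  note [measurable] = densD(1)[OF p] densD(1)[OF p1] densD(1)[OF p2] densD(1)[OF p3]
  note nn = densD(2)[OF p1] densD(2)[OF p2] densD(2)[OF p3]
  define R where "R q = riesz UNIV (\<lambda>x. ennreal (q x))" for q :: "real^3 \<Rightarrow> real"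
  have [measurable]: "R p \<in> borel_measurable borel" "R p1 \<in> borel_measurable borel"
    "R p2 \<in> borel_measurable borel" "R p3 \<in> borel_measurable borel"
    unfolding R_def by measurable
  have "(\<integral>\<^sup>+x. ennreal (norm (fld p x) ^ 2) \<partial>lborel)
    \<le> (\<integral>\<^sup>+x. ennreal (norm (fld p1 x) ^ 2) + ennreal (norm (fld p3 x) ^ 2) + 2 * (R p1 x * R p3 x) + 2 * (R p2 x * R p x) \<partial>lborel)"
  proof (rule nn_integral_mono_AE)
    show "AE x in lborel. ennreal (norm (fld p x) ^ 2)
      \<le> ennreal (norm (fld p1 x) ^ 2) + ennreal (norm (fld p3 x) ^ 2) + 2 * (R p1 x * R p3 x) + 2 * (R p2 x * R p x)"
      using AE_riesz_finite[OF p1] AE_riesz_finite[OF p2] AE_riesz_finite[OF p3] AE_riesz_finite[OF p]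
    proof eventually_elim
      case (elim x)
      have pe: "p = (\<lambda>y. 1 * p1 y + 1 * (1 * p2 y + 1 * p3 y))" using sum by (auto simp: fun_eq_iff)
      have r23: "R (\<lambda>y. p2 y + p3 y) x = R p2 x + R p3 x"
        unfolding R_def riesz_def using nn
        by (subst nn_integral_add[symmetric]) (auto intro!: nn_integral_cong simp: distrib_right)
      have "R p x = R p1 x + R (\<lambda>y. p2 y + p3 y) x"
        unfolding R_def riesz_def using nn
        by (subst nn_integral_add[symmetric]) (auto intro!: nn_integral_cong simp: distrib_right sum add_ac)
      then have Rp: "R p x = R p1 x + (R p2 x + R p3 x)" using r23 by simp
      have fin: "R p1 x < \<infinity>" "R p2 x < \<infinity>" "R p3 x < \<infinity>"
        using elim nn by (auto simp: R_def)
      have "fld p x = 1 *\<^sub>R fld p1 x + 1 *\<^sub>R fld (\<lambda>y. 1 * p2 y + 1 * p3 y) x"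
        by (subst pe, rule fld_lincomb) (use fin r23 nn elim in \<open>auto simp: R_def\<close>)
      also have "fld (\<lambda>y. 1 * p2 y + 1 * p3 y) x = 1 *\<^sub>R fld p2 x + 1 *\<^sub>R fld p3 x"
        by (rule fld_lincomb) (use fin nn elim in \<open>auto simp: R_def\<close>)
      finally have f: "fld p x = fld p1 x + (fld p2 x + fld p3 x)" by simp
      obtain a b c where abc: "R p1 x = ennreal a" "R p2 x = ennreal b" "R p3 x = ennreal c" "0 \<le> a" "0 \<le> b" "0 \<le> c"
        using fin by (metis ennreal_cases infinity_ennreal_def less_irrefl)
      have n: "norm (fld p1 x) \<le> a" "norm (fld p2 x) \<le> b" "norm (fld p3 x) \<le> c"
        using norm_fld_le[of p1 x] norm_fld_le[of p2 x] norm_fld_le[of p3 x] abc nn by (auto simp: R_def[symmetric])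
      define u v w where "u = fld p1 x" and "v = fld p2 x" and "w = fld p3 x"
      have "norm (u + (v + w)) ^ 2 = norm u ^ 2 + norm w ^ 2 + 2 * (u \<bullet> w) + (2 * (v \<bullet> u) + 2 * (v \<bullet> w) + norm v ^ 2)"
        by (simp add: power2_norm_eq_inner inner_add_left inner_add_right inner_commute algebra_simps)
      also have "\<dots> \<le> norm u ^ 2 + norm w ^ 2 + 2 * (norm u * norm w) + (2 * (norm v * norm u) + 2 * (norm v * norm w) + norm v ^ 2)"
        using norm_cauchy_schwarz[of u w] norm_cauchy_schwarz[of v u] norm_cauchy_schwarz[of v w] by linarith
      also have "\<dots> \<le> norm u ^ 2 + norm w ^ 2 + 2 * (a * c) + (2 * (b * a) + 2 * (b * c) + b ^ 2)"
        using n abc unfolding u_def[symmetric] v_def[symmetric] w_def[symmetric]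
        by (intro add_mono mult_left_mono mult_mono power_mono) auto
      \<comment> \<open>All terms containing the transition piece are collected into
        \<open>b\<close> times the full potential \<open>a + (b + c)\<close>, at the price of an
        extra \<open>b^2\<close>, so that one cross estimate covers them.\<close>
      also have "\<dots> \<le> norm u ^ 2 + norm w ^ 2 + 2 * (a * c) + 2 * (b * (a + (b + c)))"
        using abc by (simp add: power2_eq_square algebra_simps)
      finally have "ennreal (norm (fld p x) ^ 2) \<le> ennreal (norm u ^ 2 + norm w ^ 2 + 2 * (a * c) + 2 * (b * (a + (b + c))))"
        unfolding f u_def v_def w_def by (rule ennreal_leI)
      also have "\<dots> = ennreal (norm u ^ 2) + ennreal (norm w ^ 2) + 2 * (R p1 x * R p3 x) + 2 * (R p2 x * R p x)"
        unfolding Rp abc(1-3) using abc(4-6)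
        by (simp add: ennreal_mult[symmetric] ennreal_plus[symmetric] ennreal_numeral[symmetric] del: ennreal_plus ennreal_numeral)
      finally show ?case unfolding u_def w_def .
    qed
  qed
  also have "\<dots> = (\<integral>\<^sup>+x. ennreal (norm (fld p1 x) ^ 2) \<partial>lborel) + (\<integral>\<^sup>+x. ennreal (norm (fld p3 x) ^ 2) \<partial>lborel)
     + 2 * (\<integral>\<^sup>+x. R p1 x * R p3 x \<partial>lborel) + 2 * (\<integral>\<^sup>+x. R p2 x * R p x \<partial>lborel)"
    by (simp add: nn_integral_add nn_integral_cmult)
  also have "\<dots> \<le> (\<integral>\<^sup>+x. ennreal (norm (fld p1 x) ^ 2) \<partial>lborel) + (\<integral>\<^sup>+x. ennreal (norm (fld p3 x) ^ 2) \<partial>lborel)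
     + 2 * ennreal (8 * shell_const * M\<^sup>2 / D) + 2 * ennreal (coul_const A M m r)"
  proof (intro add_mono mult_left_mono order_refl)
    have "(\<integral>\<^sup>+x. R p1 x * R p3 x \<partial>lborel) \<le> ennreal (8 * shell_const) * bil UNIV (\<lambda>x. ennreal (p1 x)) (\<lambda>x. ennreal (p3 x))"
      unfolding R_def by (rule nn_integral_riesz_mult_le) auto
    also have "\<dots> \<le> ennreal (8 * shell_const) * (ennreal (1 / D) * ((\<integral>\<^sup>+y. ennreal (p1 y) \<partial>lborel) * (\<integral>\<^sup>+y. ennreal (p3 y) \<partial>lborel)))"
    proof (intro mult_left_mono bil_far_le D)
      show "D \<le> norm (y - z)" if "ennreal (p1 y) \<noteq> 0" "ennreal (p3 z) \<noteq> 0" for y z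
        using that by (intro sep) auto
    qed auto
    also have "\<dots> \<le> ennreal (8 * shell_const) * (ennreal (1 / D) * (ennreal M * ennreal M))"
      by (intro mult_left_mono mult_mono densD(5)[OF p1] densD(5)[OF p3]) auto
    also have "\<dots> = ennreal (8 * shell_const * M\<^sup>2 / D)"
      using densD(3)[OF p] D shell_const_pos by (simp add: ennreal_mult[symmetric] power2_eq_square)
    finally show "(\<integral>\<^sup>+x. R p1 x * R p3 x \<partial>lborel) \<le> ennreal (8 * shell_const * M\<^sup>2 / D)" .
    show "(\<integral>\<^sup>+x. R p2 x * R p x \<partial>lborel) \<le> ennreal (coul_const A M m r)"
      unfolding R_def by (rule riesz_cross_le[OF p _ _ m r]) (use sum nn in \<open>auto intro!: ennreal_leI\<close>)
  qed auto
  also have "\<dots> = (\<integral>\<^sup>+x. ennreal (norm (fld p1 x) ^ 2) \<partial>lborel) + (\<integral>\<^sup>+x. ennreal (norm (fld p3 x) ^ 2) \<partial>lborel)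
      + ennreal (16 * shell_const * M\<^sup>2 / D + 2 * coul_const A M m r)"
    using densD(3,4)[OF p] D shell_const_pos r m unfolding coul_const_def
    by (simp add: ennreal_mult[symmetric] ennreal_plus[symmetric] ennreal_numeral[symmetric] add.assoc del: ennreal_plus ennreal_numeral)
  finally show ?thesis .
qed

text \<open>Splitting radius and weight are both \<open>1/A\<close>, which makes every term linear
  in \<open>A\<close>. Linearity is what allows a small multiple of the convex energy hidden in
  \<open>A\<close> to be absorbed later.\<close>

lemma fld_square_linear_le:
  assumes p: "dens M A p" and A: "0 < A"
  shows "(\<integral>\<^sup>+x. ennreal (norm (fld p x) ^ 2) \<partial>lborel) \<le> ennreal (8 * shell_const * (1 + shell_const + M\<^sup>2) * A)"
proof -
  note [measurable] = densD(1)[OF p]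
  let ?p = "\<lambda>x. ennreal (p x)"
  have "(\<integral>\<^sup>+x. ennreal (norm (fld p x) ^ 2) \<partial>lborel) \<le> (\<integral>\<^sup>+x. riesz UNIV ?p x * riesz UNIV ?p x \<partial>lborel)"
    using norm_fld_le[OF densD(1)[OF p]] densD(2)[OF p]
    by (intro nn_integral_mono) (simp add: power2_eq_square ennreal_mult mult_mono)
  also have "\<dots> \<le> ennreal (8 * shell_const) * bil UNIV ?p ?p"
    by (rule nn_integral_riesz_mult_le) auto
  also have "bil UNIV ?p ?p = bil (ball 0 (1/A)) ?p ?p + bil (- ball 0 (1/A)) ?p ?p"
    by (rule bil_split_near_far) measurable
  also have "bil (ball 0 (1/A)) ?p ?p \<le> ennreal (1/A * A\<^sup>2 + shell_const * (1/A) * A / (1/A))"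
    by (rule bil_ball_le_param) (use densD[OF p] A in auto)
  also have "bil (- ball 0 (1/A)) ?p ?p \<le> ennreal (1 / (1/A)) * ((\<integral>\<^sup>+y. ?p y \<partial>lborel) * (\<integral>\<^sup>+y. ?p y \<partial>lborel))"
    by (rule bil_far_le) (use A in auto)
  also have "\<dots> \<le> ennreal (1 / (1/A)) * (ennreal M * ennreal M)"
    by (intro mult_left_mono mult_mono densD(5)[OF p]) auto
  also have "ennreal (8 * shell_const) * (ennreal (1/A * A\<^sup>2 + shell_const * (1/A) * A / (1/A)) + ennreal (1 / (1/A)) * (ennreal M * ennreal M))
     = ennreal (8 * shell_const * ((1/A * A\<^sup>2 + shell_const * (1/A) * A / (1/A)) + (1 / (1/A)) * (M * M)))"
    using A densD(3)[OF p] shell_const_pos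
    by (simp add: ennreal_mult[symmetric] ennreal_plus[symmetric] del: ennreal_plus)
  also have "8 * shell_const * ((1/A * A\<^sup>2 + shell_const * (1/A) * A / (1/A)) + (1 / (1/A)) * (M * M)) = 8 * shell_const * (1 + shell_const + M\<^sup>2) * A"
    using A by (simp add: power2_eq_square algebra_simps)
  finally show ?thesis by (simp add: add_mono mult_left_mono)
qed

section \<open>Casimir functions and interpolation\<close>

locale casimir =
  fixes Q Q' Q'' :: "real \<Rightarrow> real" and C1 C2 F0 k1 k2 k3 :: real
  assumes Q_C1: "\<forall>s\<ge>0. (Q has_real_derivative Q' s) (at s within {0..})"
      and Q_C2: "\<forall>s>0. (Q' has_real_derivative Q'' s) (at s)"
      and Q_nonneg: "\<forall>s\<ge>0. 0 \<le> Q s"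
      and const_pos: "C1 > 0" "C2 > 0" "F0 > 0"
      and k_bounds: "0 < k1" "k1 < 3/2" "0 < k2" "k2 < 3/2" "0 < k3" "k3 < 3/2"
      and Q1: "\<forall>s\<ge>F0. Q s \<ge> C1 * s powr (1 + 1 / k1)"
      and Q2: "\<forall>s. 0 \<le> s \<and> s \<le> F0 \<longrightarrow> Q s \<le> C2 * s powr (1 + 1 / k2)"
      and Q3: "\<forall>s\<ge>0. \<forall>t. 0 \<le> t \<and> t \<le> 1 \<longrightarrow> Q (t * s) \<ge> t powr (1 + 1 / k3) * Q s"
      and Q4: "\<forall>s>0. Q'' s > 0"
begin

lemma Q_zero: "Q 0 = 0"
  using Q2[rule_format, of 0] Q_nonneg[rule_format, of 0] const_pos by simp

lemma Q_continuous: "continuous_on {0..} Q"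
  using Q_C1 by (intro DERIV_continuous_on[where D = Q']) auto

text \<open>\<open>Q\<close> is controlled on the half-line only; precomposition with
  \<open>max 0\<close> gives a function continuous on all of R that agrees with \<open>Q\<close> on
  the values of \<open>f\<close>.\<close>

lemma measurable_Q_comp [measurable (raw)]:
  assumes [measurable]: "f \<in> borel_measurable N" and f: "\<And>x. 0 \<le> f x"
  shows "(\<lambda>x. Q (f x)) \<in> borel_measurable N"
proof -
  have "continuous_on UNIV (\<lambda>s. Q (max 0 s))"
    by (rule continuous_on_compose2[OF Q_continuous]) (auto intro!: continuous_intros)
  then have [measurable]: "(\<lambda>s. Q (max 0 s)) \<in> borel_measurable borel"
    by (rule borel_measurable_continuous_onI)
  have "(\<lambda>x. Q (max 0 (f x))) \<in> borel_measurable N" by measurable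
  then show ?thesis using f by (simp add: max_absorb2)
qed

lemma Q_midpoint_strict:
  assumes "0 \<le> a" "0 \<le> b" "a \<noteq> b"
  shows "Q ((a + b) / 2) < Q a / 2 + Q b / 2"
proof -
  have less: "Q ((a + b) / 2) < Q a / 2 + Q b / 2" if ab: "0 \<le> a" "a < b" for a b
  proof -
    define c where "c = (a + b) / 2"
    have c: "a < c" "c < b" "c - a = b - c" using ab by (auto simp: c_def field_simps)
    have der: "(Q has_real_derivative Q' s) (at s)" if "0 < s" for s
    proof -
      have "(at s within {0..}) = at s" using that by (intro at_within_interior) (auto simp: interior_real_atLeast)
      then show ?thesis using Q_C1 that by (metis less_imp_le)
    qed
    have cont: "continuous_on {s..t} Q" if "0 \<le> s" for s t
      using that by (intro continuous_on_subset[OF Q_continuous]) auto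
    have mvt: "\<exists>l x. s < x \<and> x < t \<and> DERIV Q x :> l \<and> Q t - Q s = (t - s) * l" if "0 \<le> s" "s < t" for s t
    proof (rule MVT)
      show "Q differentiable (at x)" if "s < x" "x < t" for x
        using der[of x] that \<open>0 \<le> s\<close> by (auto simp: real_differentiable_def)
    qed (use that cont[of s t] in auto)
    obtain l x where x: "a < x" "x < c" "DERIV Q x :> l" "Q c - Q a = (c - a) * l"
      using mvt[of a c] c ab by blast
    obtain l' y where y: "c < y" "y < b" "DERIV Q y :> l'" "Q b - Q c = (b - c) * l'"
      using mvt[of c b] c ab by auto
    have "l = Q' x" "l' = Q' y"
      using DERIV_unique[OF x(3) der] DERIV_unique[OF y(3) der] ab x y c by auto
    moreover have "Q' x < Q' y"
    proof -
      have "\<exists>l. DERIV Q' s :> l \<and> 0 < l" if "x \<le> s" for s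
      proof -
        have "0 < s" using that x ab by linarith
        then show ?thesis using Q_C2 Q4 by blast
      qed
      moreover have "x < y" using x y by linarith
      ultimately show ?thesis by (rule DERIV_pos_imp_increasing[where f = Q' and a = x and b = y, rotated])
    qed
    ultimately have "(c - a) * l < (c - a) * l'" using c by (simp add: mult_strict_left_mono)
    then have "(c - a) * l < (b - c) * l'" unfolding c(3) .
    then have "Q c - Q a < Q b - Q c" using x y by simp
    then show ?thesis by (simp add: c_def)
  qed
  show ?thesis
  proof (cases "a < b")
    case True
    then show ?thesis using less assms by simp
  next
    case False
    then have "b < a" using assms by simp
    then show ?thesis using less[of b a] assms by (simp add: add.commute)
  qed
qed

lemma Q_midpoint_le:
  assumes "0 \<le> a" "0 \<le> b"
  shows "Q ((a + b) / 2) \<le> Q a / 2 + Q b / 2"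
  using Q_midpoint_strict[OF assms] by (cases "a = b") auto

text \<open>\<open>k1 < 3/2\<close> means that the growth exponent \<open>1 + 1 / k1\<close> in (Q1)
  exceeds 5/3, so the 5/3 power is negligible against \<open>Q\<close> at large values; at small
  values it is bounded by a multiple of \<open>s\<close>.\<close>

lemma powr_five_thirds_le:
  assumes "0 < e"
  shows "\<exists>C\<ge>0. \<forall>s\<ge>0. s powr (5/3) \<le> e * Q s + C * s"
proof -
  define d where "d = 1 / k1 - 2 / 3"
  have d: "0 < d" using k_bounds by (simp add: d_def field_simps)
  \<comment> \<open>Beyond this threshold \<open>s powr (- d) \<le> e * C1\<close>, with
    \<open>d\<close> the gap between the two exponents.\<close>
  define s0 where "s0 = max F0 ((e * C1) powr (- 1 / d))"
  have s0: "0 < s0" "F0 \<le> s0" using const_pos by (auto simp: s0_def)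
  show ?thesis
  proof (intro exI conjI allI impI)
    show "0 \<le> s0 powr (2/3)" by simp
    fix s :: real assume s: "0 \<le> s"
    show "s powr (5/3) \<le> e * Q s + s0 powr (2/3) * s"
    proof (cases "s \<le> s0")
      case True
      have "s powr (5/3) = s powr (2/3) * s"
      proof (cases "s = 0")
        case False
        have "s powr (5/3) = s powr (2/3 + 1)" by simp
        also have "\<dots> = s powr (2/3) * s" using s False by (subst powr_add) simp
        finally show ?thesis .
      qed simp
      also have "\<dots> \<le> s0 powr (2/3) * s" using True s by (intro mult_right_mono powr_mono2) auto
      moreover have "0 \<le> e * Q s" using assms Q_nonneg s by auto
      ultimately show ?thesis by linarith
    next
      case False
      then have s': "0 < s" "F0 \<le> s" "(e * C1) powr (- 1 / d) \<le> s" using s0 by (auto simp: s0_def)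
      have "s powr (- d) \<le> ((e * C1) powr (- 1 / d)) powr (- d)"
        using s' d assms const_pos by (intro powr_mono2') auto
      also have "\<dots> = e * C1" using d assms const_pos by (simp add: powr_powr)
      finally have *: "s powr (- d) \<le> e * C1" .
      have "s powr (5/3) = s powr ((1 + 1 / k1) + - d)" by (simp add: d_def)
      also have "\<dots> = s powr (1 + 1 / k1) * s powr (- d)" by (rule powr_add)
      also have "\<dots> \<le> s powr (1 + 1 / k1) * (e * C1)" using * by (intro mult_left_mono) auto
      also have "\<dots> = e * (C1 * s powr (1 + 1 / k1))" by simp
      also have "\<dots> \<le> e * Q s" using Q1 s' assms by (intro mult_left_mono) auto
      finally show ?thesis using s by (simp add: add_increasing2)
    qed
  qed
qed

end

text \<open>Splitting velocity space at \<open>\<bar>v\<bar> = \<alpha> \<rho>\<^bsup>1/6\<^esup>\<close> and the values of \<open>g\<close> at \<open>\<beta> \<rho>\<^bsup>1/2\<^esup>\<close> makes the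
  remaining region contribute \<open>\<rho>/2\<close> when \<open>\<alpha>\<^sup>3\<beta>\<close> is chosen accordingly.\<close>

lemma velocity_average_interpolation:
  assumes t: "0 < t"
  shows "\<exists>C\<ge>0. \<forall>g::real^3 \<Rightarrow> real. g \<in> borel_measurable borel \<longrightarrow> (\<forall>v. 0 \<le> g v) \<longrightarrow>
    ennreal (enn2real (\<integral>\<^sup>+v. ennreal (g v) \<partial>lborel) powr (4/3))
     \<le> ennreal t * (\<integral>\<^sup>+v. ennreal (norm v ^ 2 / 2 * g v) \<partial>lborel) + ennreal C * (\<integral>\<^sup>+v. ennreal (g v powr (5/3)) \<partial>lborel)"
proof -
  \<comment> \<open>\<open>al\<close> gives the kinetic term the factor
    \<open>2 / R^2 = t / (2 * u^2)\<close>. After half of \<open>n = u ^ 6\<close> has been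
    absorbed, multiplication by \<open>2 * u^2\<close> turns it into exactly
    \<open>t\<close>.\<close>
  define al where "al = 2 / sqrt t"
  have al: "0 < al" using t by (simp add: al_def)
  define be where "be = 1 / (2 * unit_ball_vol 3 * al ^ 3)"
  have be: "0 < be" using al by (simp add: be_def)
  define C where "C = 2 * be powr (- (2/3))"
  show ?thesis
  proof (intro exI[of _ C] conjI allI impI)
    show "0 \<le> C" by (simp add: C_def)
    fix g :: "real^3 \<Rightarrow> real"
    assume [measurable]: "g \<in> borel_measurable borel" and g0: "\<forall>v. 0 \<le> g v"
    define ea where "ea = (\<integral>\<^sup>+v. ennreal (g v powr (5/3)) \<partial>lborel)"
    define ee where "ee = (\<integral>\<^sup>+v. ennreal (norm v ^ 2 / 2 * g v) \<partial>lborel)"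
    define n where "n = enn2real (\<integral>\<^sup>+v. ennreal (g v) \<partial>lborel)"
    show "ennreal (enn2real (\<integral>\<^sup>+v. ennreal (g v) \<partial>lborel) powr (4/3)) \<le> ennreal t * (\<integral>\<^sup>+v. ennreal (norm v ^ 2 / 2 * g v) \<partial>lborel) + ennreal C * (\<integral>\<^sup>+v. ennreal (g v powr (5/3)) \<partial>lborel)"
      unfolding ea_def[symmetric] ee_def[symmetric] n_def[symmetric]
    \<comment> \<open>If a moment is infinite, so is the right-hand side, since \<open>t\<close> and
      \<open>C\<close> are positive. The case \<open>n = 0\<close> also contains an infinite
      integral of \<open>g\<close>, because \<open>enn2real\<close> sends \<open>top\<close> to
      0.\<close>
    proof (cases "ea = \<infinity> \<or> ee = \<infinity> \<or> n = 0")
      case True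
      then show "ennreal (n powr (4/3)) \<le> ennreal t * ee + ennreal C * ea"
        using t be by (auto simp: ennreal_mult_top C_def)
    next
      case False
      then obtain a e where ae: "ea = ennreal a" "ee = ennreal e" "0 \<le> a" "0 \<le> e"
        by (metis ennreal_cases infinity_ennreal_def)
      have n: "0 < n" using False by (simp add: n_def less_le)
      then have In: "(\<integral>\<^sup>+v. ennreal (g v) \<partial>lborel) = ennreal n"
        unfolding n_def by (metis enn2real_top ennreal_enn2real_if less_irrefl)
      define u where "u = n powr (1/6)"
      have u: "0 < u" using n by (simp add: u_def)
      have nu: "n = u ^ 6" "n powr (4/3) = u ^ 8"
        using n by (auto simp: u_def powr_powr simp flip: powr_realpow')
      define R s where "R = al * u" and "s = be * u ^ 3"
      have Rs: "0 < R" "0 < s" using al be u by (auto simp: R_def s_def)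
      have "ennreal n \<le> (\<integral>\<^sup>+v. ennreal s * indicator (cball 0 R) v + ennreal (s powr (- (2/3))) * ennreal (g v powr (5/3))
           + ennreal (2 / R\<^sup>2) * ennreal (norm v ^ 2 / 2 * g v) \<partial>lborel)"
        unfolding In[symmetric]
      proof (rule nn_integral_mono)
        fix v :: "real^3"
        have gv: "0 \<le> g v" using g0 by simp
        have "g v \<le> s * indicator (cball 0 R) v + s powr (- (2/3)) * g v powr (5/3) + (2 / R\<^sup>2) * (norm v ^ 2 / 2 * g v)"
        proof -
          have p1: "0 \<le> s * indicator (cball 0 R) v" using Rs by simp
          have p2: "0 \<le> s powr (- (2/3)) * g v powr (5/3)" by simp
          have p3: "0 \<le> (2 / R\<^sup>2) * (norm v ^ 2 / 2 * g v)" using gv by simp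
          consider "R < norm v" | "norm v \<le> R" "g v \<le> s" | "s < g v" by linarith
          then show ?thesis
          proof cases
            case 1
            then have "R\<^sup>2 \<le> norm v ^ 2" using Rs by (intro power_mono) auto
            then have "1 \<le> norm v ^ 2 / R\<^sup>2" using Rs by simp
            then have "1 * g v \<le> norm v ^ 2 / R\<^sup>2 * g v" using gv by (intro mult_right_mono)
            then have "g v \<le> (2 / R\<^sup>2) * (norm v ^ 2 / 2 * g v)" by simp
            then show ?thesis using p1 p2 by linarith
          next
            case 2
            then have "g v \<le> s * indicator (cball 0 R) v" by simp
            then show ?thesis using p2 p3 by linarith
          next
            case c: 3
            have "g v = g v powr (- (2/3)) * g v powr (5/3)" using c Rs by (simp flip: powr_add)
            also have "\<dots> \<le> s powr (- (2/3)) * g v powr (5/3)" using c Rs by (intro mult_right_mono powr_mono2') auto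
            finally show ?thesis using p1 p3 by linarith
          qed
        qed
        then have "ennreal (g v) \<le> ennreal (s * indicator (cball 0 R) v + s powr (- (2/3)) * g v powr (5/3) + (2 / R\<^sup>2) * (norm v ^ 2 / 2 * g v))"
          by (rule ennreal_leI)
        also have "\<dots> = ennreal s * indicator (cball 0 R) v + ennreal (s powr (- (2/3))) * ennreal (g v powr (5/3)) + ennreal (2 / R\<^sup>2) * ennreal (norm v ^ 2 / 2 * g v)"
          using Rs gv by (auto simp: indicator_def ennreal_mult[symmetric] ennreal_plus[symmetric] simp del: ennreal_plus)
        finally show "ennreal (g v) \<le> \<dots>" .
      qed
      also have "\<dots> = ennreal s * emeasure lborel (cball (0::real^3) R) + ennreal (s powr (- (2/3))) * ea + ennreal (2 / R\<^sup>2) * ee"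
        unfolding ea_def ee_def by (simp add: nn_integral_add nn_integral_cmult nn_integral_cmult_indicator)
      also have "\<dots> = ennreal (s * (unit_ball_vol 3 * R ^ 3) + s powr (- (2/3)) * a + 2 / R\<^sup>2 * e)"
        unfolding ae(1,2) using Rs ae
        by (simp add: emeasure_cball ennreal_mult[symmetric] ennreal_plus[symmetric] del: ennreal_plus)
      finally have "n \<le> s * (unit_ball_vol 3 * R ^ 3) + s powr (- (2/3)) * a + 2 / R\<^sup>2 * e"
        using Rs ae by (subst (asm) ennreal_le_iff) auto
      moreover have "s * (unit_ball_vol 3 * R ^ 3) = u ^ 6 / 2"
      proof -
        have half: "1 / (2 * w * b ^ 3) * (w * b ^ 3) = 1 / 2" if "0 < w" "0 < b" for w b :: real
          using that by (simp add: field_simps)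
        have "s * (unit_ball_vol 3 * R ^ 3) = (be * (unit_ball_vol 3 * al ^ 3)) * (u ^ 3 * u ^ 3)"
          by (simp add: s_def R_def power_mult_distrib)
        also have "be * (unit_ball_vol 3 * al ^ 3) = 1 / 2"
          unfolding be_def by (rule half[OF _ al]) simp
        also have "u ^ 3 * u ^ 3 = u ^ 6" by (simp flip: power_add)
        finally show ?thesis by simp
      qed
      moreover have "s powr (- (2/3)) = be powr (- (2/3)) / u\<^sup>2"
      proof -
        have "(u ^ 3) powr (- (2/3)) = (u powr 3) powr (- (2/3))" using u by (simp only: powr_numeral)
        also have "\<dots> = u powr (- 2)" unfolding powr_powr by simp
        also have "\<dots> = 1 / u powr 2" by (rule powr_minus_divide)
        also have "\<dots> = 1 / u\<^sup>2" using u by (simp only: powr_numeral)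
        finally have "(u ^ 3) powr (- (2/3)) = 1 / u\<^sup>2" .
        then have "(be * u ^ 3) powr (- (2/3)) = be powr (- (2/3)) * (1 / u\<^sup>2)"
          using be u by (subst powr_mult) auto
        then show ?thesis unfolding s_def by (simp only: times_divide_eq_right mult_1_right)
      qed
      moreover have "2 / R\<^sup>2 = t / (2 * u\<^sup>2)"
      proof -
        have "R\<^sup>2 = 4 / t * u\<^sup>2" using t by (simp add: R_def al_def power_mult_distrib power_divide)
        then show ?thesis unfolding \<open>R\<^sup>2 = _\<close> using t u by (simp add: field_simps)
      qed
      ultimately have "u ^ 6 \<le> u ^ 6 / 2 + be powr (- (2/3)) / u\<^sup>2 * a + t / (2 * u\<^sup>2) * e" using nu by simp
      moreover have "be powr (- (2/3)) / u\<^sup>2 * a + t / (2 * u\<^sup>2) * e = (be powr (- (2/3)) * a + t / 2 * e) / u\<^sup>2"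
        by (simp add: add_divide_distrib)
      ultimately have "u ^ 6 / 2 \<le> (be powr (- (2/3)) * a + t / 2 * e) / u\<^sup>2" by linarith
      then have "u ^ 6 / 2 * u\<^sup>2 \<le> be powr (- (2/3)) * a + t / 2 * e" using u by (simp add: pos_le_divide_eq)
      moreover have "u ^ 6 / 2 * u\<^sup>2 = u ^ 8 / 2" by (simp flip: power_add)
      ultimately have "n powr (4/3) \<le> t * e + C * a" unfolding nu(2) C_def by (simp add: algebra_simps)
      then have "ennreal (n powr (4/3)) \<le> ennreal (t * e + C * a)" by (rule ennreal_leI)
      also have "\<dots> = ennreal t * ee + ennreal C * ea"
        unfolding ae(1,2) using ae(3,4) t by (simp add: C_def ennreal_mult[symmetric] ennreal_plus[symmetric] del: ennreal_plus)
      finally show "ennreal (n powr (4/3)) \<le> ennreal t * ee + ennreal C * ea" .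
    qed
  qed
qed

section \<open>Phase-space functions and their spatial densities\<close>

lemma nn_integral_phase:
  fixes g :: "(real^3) \<times> (real^3) \<Rightarrow> ennreal"
  assumes "g \<in> borel_measurable borel"
  shows "(\<integral>\<^sup>+z. g z \<partial>lborel) = (\<integral>\<^sup>+x. \<integral>\<^sup>+v. g (x, v) \<partial>lborel \<partial>lborel)"
  using lborel.nn_integral_fst[of g lborel] assms by (simp add: lborel_prod)

text \<open>Integrability is left out so that limits, rescalings and translates can be handled
  before their mass and energy have been computed.\<close>

definition phase :: "phase_fun \<Rightarrow> bool" where
  "phase f \<longleftrightarrow> f \<in> borel_measurable borel \<and> (\<forall>z. 0 \<le> f z)"

lemma phaseD: "phase f \<Longrightarrow> f \<in> borel_measurable borel" "phase f \<Longrightarrow> 0 \<le> f z"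
  by (simp_all add: phase_def del: split_paired_All)

lemma measurable_fst_borel: "fst \<in> borel_measurable (borel :: ('a::euclidean_space \<times> 'b::euclidean_space) measure)"
  by (intro borel_measurable_continuous_onI continuous_intros)

lemma measurable_snd_borel: "snd \<in> borel_measurable (borel :: ('a::euclidean_space \<times> 'b::euclidean_space) measure)"
  by (intro borel_measurable_continuous_onI continuous_intros)

lemma measurable_kinetic:
  assumes "f \<in> borel_measurable borel"
  shows "(\<lambda>z::(real^3) \<times> (real^3). norm (snd z) ^ 2 / 2 * f z :: real) \<in> borel_measurable borel"
proof (rule borel_measurable_times[OF _ assms])
  show "(\<lambda>z::(real^3) \<times> (real^3). norm (snd z) ^ 2 / 2) \<in> borel_measurable borel"
    by (intro borel_measurable_continuous_onI continuous_intros) simp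
qed

lemma measurable_slice:
  assumes [measurable]: "(f::(real^3) \<times> (real^3) \<Rightarrow> 'a::topological_space) \<in> borel_measurable borel"
  shows "(\<lambda>v. f (x, v)) \<in> borel_measurable borel"
  by measurable

lemma measurable_rho:
  assumes [measurable]: "f \<in> borel_measurable borel"
  shows "rho f \<in> borel_measurable borel"
  unfolding rho_def[abs_def] by measurable

text \<open>Valid at every \<open>x\<close>: where the slice is not integrable, both sides default
  to 0.\<close>

lemma rho_eq: "phase f \<Longrightarrow> rho f x = enn2real (\<integral>\<^sup>+v. ennreal (f (x, v)) \<partial>lborel)"
  unfolding rho_def using phaseD measurable_slice[of f x] by (intro integral_eq_nn_integral) auto

lemma rho_nonneg: "phase f \<Longrightarrow> 0 \<le> rho f x"
  by (simp add: rho_eq)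

lemma AE_ennreal_rho:
  assumes f: "phase f" and fin: "(\<integral>\<^sup>+z. ennreal (f z) \<partial>lborel) < \<infinity>"
  shows "AE x in lborel. ennreal (rho f x) = (\<integral>\<^sup>+v. ennreal (f (x, v)) \<partial>lborel)"
proof -
  note [measurable] = phaseD(1)[OF f]
  have "(\<integral>\<^sup>+x. \<integral>\<^sup>+v. ennreal (f (x, v)) \<partial>lborel \<partial>lborel) \<noteq> \<infinity>"
    using fin by (subst nn_integral_phase[symmetric]) auto
  then have "AE x in lborel. (\<integral>\<^sup>+v. ennreal (f (x, v)) \<partial>lborel) \<noteq> \<infinity>"
    by (intro nn_integral_PInf_AE) auto
  then show ?thesis by eventually_elim (simp add: rho_eq[OF f] less_top)
qed

lemma nn_integral_rho:
  assumes f: "phase f" and fin: "(\<integral>\<^sup>+z. ennreal (f z) \<partial>lborel) < \<infinity>"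
  shows "(\<integral>\<^sup>+x. ennreal (rho f x) \<partial>lborel) = (\<integral>\<^sup>+z. ennreal (f z) \<partial>lborel)"
proof -
  note [measurable] = phaseD(1)[OF f]
  have "(\<integral>\<^sup>+z. ennreal (f z) \<partial>lborel) = (\<integral>\<^sup>+x. \<integral>\<^sup>+v. ennreal (f (x, v)) \<partial>lborel \<partial>lborel)"
    by (rule nn_integral_phase) measurable
  also have "\<dots> = (\<integral>\<^sup>+x. ennreal (rho f x) \<partial>lborel)"
    using AE_ennreal_rho[OF f fin] by (intro nn_integral_cong_AE) auto
  finally show ?thesis ..
qed

lemma FM_D:
  assumes "f \<in> FM Q M"
  shows "phase f" "(\<integral>\<^sup>+z. ennreal (f z) \<partial>lborel) = ennreal M" "0 \<le> M"
    "Pfun Q f = ennreal (enn2real (Pfun Q f))" "integrable lborel f" "(\<integral>z. f z \<partial>lborel) = M" "Pfun Q f < \<infinity>"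
proof -
  have i: "integrable lborel f" and n: "\<And>z. 0 \<le> f z" and m: "(\<integral>z. f z \<partial>lborel) = M" and P: "Pfun Q f < \<infinity>"
    using assms by (auto simp: FM_def)
  show "phase f" using i n borel_measurable_integrable[OF i] by (auto simp: phase_def)
  show "(\<integral>\<^sup>+z. ennreal (f z) \<partial>lborel) = ennreal M" using i n m by (subst nn_integral_eq_integral) auto
  show "0 \<le> M" using n m by (metis Bochner_Integration.integral_nonneg)
  show "Pfun Q f = ennreal (enn2real (Pfun Q f))" using P by (simp add: less_top)
  show "integrable lborel f" "(\<integral>z. f z \<partial>lborel) = M" "Pfun Q f < \<infinity>" by fact+
qed

lemma FM_I:
  assumes f: "phase f" and "(\<integral>\<^sup>+z. ennreal (f z) \<partial>lborel) = ennreal M" "0 \<le> M" "Pfun Q f < \<infinity>"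
  shows "f \<in> FM Q M"
proof -
  have [measurable]: "f \<in> borel_measurable lborel" using phaseD(1)[OF f] by simp
  have "integrable lborel f"
    using assms(2) phaseD(2)[OF f] by (intro integrableI_bounded) auto
  moreover have "(\<integral>z. f z \<partial>lborel) = M"
    using assms(2,3) phaseD(2)[OF f] by (subst integral_eq_nn_integral) auto
  ultimately show ?thesis using assms by (auto simp: FM_def phase_def)
qed

definition field_energy :: "(real^3 \<Rightarrow> real) \<Rightarrow> real" where
  "field_energy p = (\<integral>x. norm (fld p x) ^ 2 \<partial>lborel)"

lemma field_energy_nonneg: "0 \<le> field_energy p"
  by (simp add: field_energy_def)

lemma ennreal_field_energy:
  assumes "dens M A p"
  shows "ennreal (field_energy p) = (\<integral>\<^sup>+x. ennreal (norm (fld p x) ^ 2) \<partial>lborel)"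
  unfolding field_energy_def using integrable_fld_square[OF assms]
  by (subst nn_integral_eq_integral) auto

lemma HC_eq: "HC Q f = enn2real (Pfun Q f) - field_energy (rho f) / (8 * pi)"
  by (simp add: HC_def Epot_def field_energy_def gradU_eq_fld)

section \<open>Coercivity of the energy\<close>

context casimir
begin

text \<open>The velocity interpolation is integrated over \<open>x\<close>, and the resulting 5/3
  moment of \<open>f\<close> is then traded for \<open>Q\<close> plus mass. Both exchanges have an
  arbitrarily small coefficient on the energy side.\<close>

lemma rho_powr_le:
  assumes e: "0 < e"
  shows "\<exists>C\<ge>0. \<forall>f. phase f \<longrightarrow> (\<integral>\<^sup>+x. ennreal (rho f x powr (4/3)) \<partial>lborel)
     \<le> ennreal e * Pfun Q f + ennreal C * (\<integral>\<^sup>+z. ennreal (f z) \<partial>lborel)"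
proof -
  obtain C where C: "0 \<le> C" "\<And>g::real^3 \<Rightarrow> real. g \<in> borel_measurable borel \<Longrightarrow> (\<forall>v. 0 \<le> g v) \<Longrightarrow>
    ennreal (enn2real (\<integral>\<^sup>+v. ennreal (g v) \<partial>lborel) powr (4/3))
     \<le> ennreal e * (\<integral>\<^sup>+v. ennreal (norm v ^ 2 / 2 * g v) \<partial>lborel) + ennreal C * (\<integral>\<^sup>+v. ennreal (g v powr (5/3)) \<partial>lborel)"
    using velocity_average_interpolation[OF e] by blast
  \<comment> \<open>The Casimir term will be multiplied by \<open>C\<close>, and
    \<open>C * (e / (C + 1)) \<le> e\<close>; adding 1 covers \<open>C = 0\<close>.\<close>
  have "0 < e / (C + 1)" using e C(1) by simp
  from powr_five_thirds_le[OF this] obtain B where B: "0 \<le> B" "\<And>s. 0 \<le> s \<Longrightarrow> s powr (5/3) \<le> e / (C + 1) * Q s + B * s"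
    by blast
  show ?thesis
  proof (intro exI[of _ "C * B"] conjI allI impI)
    show "0 \<le> C * B" using C(1) B(1) by simp
    fix f assume f: "phase f"
    note [measurable] = phaseD(1)[OF f]
    have [measurable]: "(\<lambda>z. Q (f z)) \<in> borel_measurable borel" using phaseD[OF f] by (intro measurable_Q_comp) auto
    define m where "m = (\<integral>\<^sup>+z. ennreal (f z) \<partial>lborel)"
    define a where "a = (\<integral>\<^sup>+z. ennreal (f z powr (5/3)) \<partial>lborel)"
    have "a \<le> (\<integral>\<^sup>+z. ennreal (e / (C + 1)) * ennreal (Q (f z)) + ennreal B * ennreal (f z) \<partial>lborel)"
      unfolding a_def
    proof (rule nn_integral_mono)
      fix z
      have "ennreal (f z powr (5/3)) \<le> ennreal (e / (C + 1) * Q (f z) + B * f z)"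
        using B(2) phaseD(2)[OF f] by (intro ennreal_leI) auto
      also have "\<dots> = ennreal (e / (C + 1) * Q (f z)) + ennreal (B * f z)"
        using e C(1) B(1) phaseD(2)[OF f, of z] Q_nonneg by (intro ennreal_plus) auto
      also have "\<dots> = ennreal (e / (C + 1)) * ennreal (Q (f z)) + ennreal B * ennreal (f z)"
        using e C(1) B(1) by (simp only: ennreal_mult' divide_nonneg_nonneg add_nonneg_nonneg less_imp_le zero_le_one)
      finally show "ennreal (f z powr (5/3)) \<le> ennreal (e / (C + 1)) * ennreal (Q (f z)) + ennreal B * ennreal (f z)" .
    qed
    also have "\<dots> = ennreal (e / (C + 1)) * Cas Q f + ennreal B * m"
      unfolding Cas_def m_def by (subst nn_integral_add) (auto simp: nn_integral_cmult)
    finally have a: "a \<le> ennreal (e / (C + 1)) * Cas Q f + ennreal B * m" .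
    have "(\<integral>\<^sup>+x. ennreal (rho f x powr (4/3)) \<partial>lborel)
      \<le> (\<integral>\<^sup>+x. ennreal e * (\<integral>\<^sup>+v. ennreal (norm v ^ 2 / 2 * f (x, v)) \<partial>lborel) + ennreal C * (\<integral>\<^sup>+v. ennreal (f (x, v) powr (5/3)) \<partial>lborel) \<partial>lborel)"
      unfolding rho_eq[OF f] using phaseD(2)[OF f] by (intro nn_integral_mono C(2) measurable_slice) auto
    also have "\<dots> = ennreal e * (\<integral>\<^sup>+x. \<integral>\<^sup>+v. ennreal (norm v ^ 2 / 2 * f (x, v)) \<partial>lborel \<partial>lborel)
        + ennreal C * (\<integral>\<^sup>+x. \<integral>\<^sup>+v. ennreal (f (x, v) powr (5/3)) \<partial>lborel \<partial>lborel)"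
      by (subst nn_integral_add) (auto simp: nn_integral_cmult)
    also have "(\<integral>\<^sup>+x. \<integral>\<^sup>+v. ennreal (norm v ^ 2 / 2 * f (x, v)) \<partial>lborel \<partial>lborel) = Ekin f"
      unfolding Ekin_def using measurable_kinetic[OF phaseD(1)[OF f]] by (subst nn_integral_phase) simp_all
    also have "(\<integral>\<^sup>+x. \<integral>\<^sup>+v. ennreal (f (x, v) powr (5/3)) \<partial>lborel \<partial>lborel) = a"
      unfolding a_def by (subst nn_integral_phase) simp_all
    finally have 1: "(\<integral>\<^sup>+x. ennreal (rho f x powr (4/3)) \<partial>lborel) \<le> ennreal e * Ekin f + ennreal C * a" .
    have "ennreal C * a \<le> ennreal C * (ennreal (e / (C + 1)) * Cas Q f + ennreal B * m)"
      by (intro mult_left_mono a) simp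
    also have "\<dots> = ennreal (C * (e / (C + 1))) * Cas Q f + ennreal (C * B) * m"
      using C(1) by (simp only: distrib_left ennreal_mult' mult.assoc)
    also have "\<dots> \<le> ennreal e * Cas Q f + ennreal (C * B) * m"
    proof (intro add_mono mult_right_mono ennreal_leI order_refl)
      have "C / (C + 1) * e \<le> 1 * e" using C(1) e by (intro mult_right_mono) auto
      then show "C * (e / (C + 1)) \<le> e" by simp
    qed (auto simp: B(1))
    finally have "ennreal e * Ekin f + ennreal C * a \<le> ennreal e * Ekin f + (ennreal e * Cas Q f + ennreal (C * B) * m)"
      by (rule add_left_mono)
    also have "\<dots> = ennreal e * Pfun Q f + ennreal (C * B) * m"
      by (simp only: Pfun_def distrib_left add_ac)
    finally show "(\<integral>\<^sup>+x. ennreal (rho f x powr (4/3)) \<partial>lborel)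
     \<le> ennreal e * Pfun Q f + ennreal (C * B) * (\<integral>\<^sup>+z. ennreal (f z) \<partial>lborel)"
      unfolding m_def[symmetric] using 1 by (rule order_trans[rotated])
  qed
qed

text \<open>\<open>C\<close> depends on \<open>e\<close> alone. A small \<open>e\<close> serves the
  absorption in \<open>Pfun_coercive\<close>; later \<open>e = 1\<close> is enough to have some
  bound.\<close>

lemma FM_dens:
  assumes e: "0 < e"
  shows "\<exists>C\<ge>0. \<forall>M. \<forall>f\<in>FM Q M. dens M (e * enn2real (Pfun Q f) + C * M) (rho f)"
proof -
  obtain C where C: "0 \<le> C" "\<And>f. phase f \<Longrightarrow> (\<integral>\<^sup>+x. ennreal (rho f x powr (4/3)) \<partial>lborel)
     \<le> ennreal e * Pfun Q f + ennreal C * (\<integral>\<^sup>+z. ennreal (f z) \<partial>lborel)"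
    using rho_powr_le[OF e] by blast
  show ?thesis
  proof (intro exI[of _ C] conjI allI ballI C(1))
    fix M f assume "f \<in> FM Q M"
    note f = FM_D[OF this]
    have "(\<integral>\<^sup>+x. ennreal (rho f x powr (4/3)) \<partial>lborel) \<le> ennreal e * ennreal (enn2real (Pfun Q f)) + ennreal C * ennreal M"
      using C(2)[OF f(1)] f(4) unfolding f(2) by simp
    also have "\<dots> = ennreal (e * enn2real (Pfun Q f) + C * M)"
      using e C(1) f(3) by (simp add: ennreal_mult[symmetric] ennreal_plus[symmetric] del: ennreal_plus)
    finally show "dens M (e * enn2real (Pfun Q f) + C * M) (rho f)"
      unfolding dens_def using e C(1) f(3) measurable_rho[OF phaseD(1)[OF f(1)]] rho_nonneg[OF f(1)] nn_integral_rho[OF f(1)] f(2)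
      by auto
  qed
qed

text \<open>The potential energy is at most \<open>K * A\<close>, and \<open>A\<close> contains the
  convex energy with coefficient \<open>1 / (2 * K)\<close>. At most half of the convex energy is
  lost, which explains the factor 2.\<close>

lemma Pfun_coercive:
  assumes M: "0 < M"
  shows "\<exists>C. \<forall>f\<in>FM Q M. enn2real (Pfun Q f) \<le> 2 * HC Q f + C"
proof -
  define K where "K = shell_const * (1 + shell_const + M\<^sup>2) / pi"
  have K: "0 < K" unfolding K_def using shell_const_pos by (intro divide_pos_pos mult_pos_pos add_pos_nonneg) auto
  have "0 < 1 / (2 * K)" using K by simp
  from FM_dens[OF this] obtain C where C: "0 \<le> C"
    "\<And>f. f \<in> FM Q M \<Longrightarrow> dens M (1 / (2 * K) * enn2real (Pfun Q f) + C * M) (rho f)" by blast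
  show ?thesis
  proof (intro exI ballI)
    fix f assume f: "f \<in> FM Q M"
    \<comment> \<open>The added 1 makes \<open>A\<close> positive, as the choice of radius
      \<open>1/A\<close> requires.\<close>
    define A where "A = 1 / (2 * K) * enn2real (Pfun Q f) + C * M + 1"
    have A: "0 < A" unfolding A_def using K C M by (intro add_nonneg_pos) auto
    have d: "dens M A (rho f)" using dens_mono[OF C(2)[OF f], of M A] by (simp add: A_def)
    have "ennreal (field_energy (rho f)) \<le> ennreal (8 * shell_const * (1 + shell_const + M\<^sup>2) * A)"
      unfolding ennreal_field_energy[OF d] by (rule fld_square_linear_le[OF d A])
    then have "field_energy (rho f) \<le> 8 * shell_const * (1 + shell_const + M\<^sup>2) * A"
      using A shell_const_pos by (subst (asm) ennreal_le_iff) auto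
    then have "field_energy (rho f) / (8 * pi) \<le> 8 * shell_const * (1 + shell_const + M\<^sup>2) * A / (8 * pi)"
      by (intro divide_right_mono) auto
    also have "\<dots> = K * A" by (simp add: K_def)
    also have "\<dots> = enn2real (Pfun Q f) / 2 + K * (C * M + 1)" using K by (simp add: A_def field_simps)
    finally show "enn2real (Pfun Q f) \<le> 2 * HC Q f + 2 * K * (C * M + 1)"
      unfolding HC_eq by simp
  qed
qed

text \<open>The infimum of reals in \<open>hM\<close> is a genuine lower bound only for a set that
  is bounded below.\<close>

lemma HC_bdd_below:
  assumes "0 < M"
  shows "bdd_below (HC Q ` FM Q M)"
proof -
  obtain C where C: "\<forall>f\<in>FM Q M. enn2real (Pfun Q f) \<le> 2 * HC Q f + C"
    using Pfun_coercive[OF assms] by blast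
  have "- C / 2 \<le> HC Q f" if "f \<in> FM Q M" for f
    using bspec[OF C that] enn2real_nonneg[of "Pfun Q f"] by linarith
  then show ?thesis by (intro bdd_belowI[where m = "- C / 2"]) auto
qed

lemma hM_le: "0 < M \<Longrightarrow> f \<in> FM Q M \<Longrightarrow> hM Q M \<le> HC Q f"
  unfolding hM_def by (intro cINF_lower HC_bdd_below)

end

section \<open>Scaling\<close>

lemma nn_integral_scale3:
  fixes g :: "real^3 \<Rightarrow> ennreal"
  assumes [measurable]: "g \<in> borel_measurable borel" and c: "0 < c"
  shows "(\<integral>\<^sup>+x. g (c *\<^sub>R x) \<partial>lborel) = ennreal (1 / c ^ 3) * (\<integral>\<^sup>+x. g x \<partial>lborel)"
proof -
  have "(\<integral>\<^sup>+x. g x \<partial>lborel) = ennreal (c ^ 3) * (\<integral>\<^sup>+x. g (c *\<^sub>R x) \<partial>lborel)"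
    using nn_integral_lborel_affine[of g c 0] c by simp
  then have "ennreal (1 / c ^ 3) * (\<integral>\<^sup>+x. g x \<partial>lborel) = ennreal (1 / c ^ 3 * c ^ 3) * (\<integral>\<^sup>+x. g (c *\<^sub>R x) \<partial>lborel)"
    using c by (simp only: ennreal_mult' mult.assoc zero_le_divide_1_iff zero_le_power less_imp_le)
  then show ?thesis using c by simp
qed

lemma integral_scale3:
  fixes g :: "real^3 \<Rightarrow> 'b::{banach, second_countable_topology}"
  assumes [measurable]: "g \<in> borel_measurable borel" and c: "0 < c"
  shows "(\<integral>x. g (c *\<^sub>R x) \<partial>lborel) = (1 / c ^ 3) *\<^sub>R (\<integral>x. g x \<partial>lborel)"
  using integral_lborel_affine[of g c 0] c by simp

lemma nn_integral_phase_scale: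
  fixes g :: "(real^3) \<times> (real^3) \<Rightarrow> ennreal"
  assumes [measurable]: "g \<in> borel_measurable borel" and b: "0 < b" and c: "0 < c"
  shows "(\<integral>\<^sup>+z. g (b *\<^sub>R fst z, c *\<^sub>R snd z) \<partial>lborel) = ennreal (1 / (b ^ 3 * c ^ 3)) * (\<integral>\<^sup>+z. g z \<partial>lborel)"
proof -
  have m: "(\<lambda>z. g (b *\<^sub>R fst z, c *\<^sub>R snd z)) \<in> borel_measurable borel"
  proof (rule measurable_compose[OF _ assms(1)])
    show "(\<lambda>z::(real^3) \<times> (real^3). (b *\<^sub>R fst z, c *\<^sub>R snd z)) \<in> borel_measurable borel"
      by (intro borel_measurable_continuous_onI continuous_intros)
  qed
  have "(\<integral>\<^sup>+z. g (b *\<^sub>R fst z, c *\<^sub>R snd z) \<partial>lborel) = (\<integral>\<^sup>+x. \<integral>\<^sup>+v. g (b *\<^sub>R x, c *\<^sub>R v) \<partial>lborel \<partial>lborel)"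
    by (subst nn_integral_phase[OF m]) simp
  also have "\<dots> = (\<integral>\<^sup>+x. ennreal (1 / c ^ 3) * (\<integral>\<^sup>+v. g (b *\<^sub>R x, v) \<partial>lborel) \<partial>lborel)"
    using c by (intro nn_integral_cong nn_integral_scale3 measurable_slice) auto
  also have "\<dots> = ennreal (1 / c ^ 3) * (\<integral>\<^sup>+x. (\<integral>\<^sup>+v. g (b *\<^sub>R x, v) \<partial>lborel) \<partial>lborel)"
    by (rule nn_integral_cmult) measurable
  also have "(\<integral>\<^sup>+x. (\<integral>\<^sup>+v. g (b *\<^sub>R x, v) \<partial>lborel) \<partial>lborel) = ennreal (1 / b ^ 3) * (\<integral>\<^sup>+x. (\<integral>\<^sup>+v. g (x, v) \<partial>lborel) \<partial>lborel)"
    using b by (intro nn_integral_scale3[where g = "\<lambda>x. \<integral>\<^sup>+v. g (x, v) \<partial>lborel"]) auto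
  also have "(\<integral>\<^sup>+x. (\<integral>\<^sup>+v. g (x, v) \<partial>lborel) \<partial>lborel) = (\<integral>\<^sup>+z. g z \<partial>lborel)"
    by (rule nn_integral_phase[symmetric]) measurable
  also have "ennreal (1 / c ^ 3) * (ennreal (1 / b ^ 3) * (\<integral>\<^sup>+z. g z \<partial>lborel)) = ennreal (1 / (b ^ 3 * c ^ 3)) * (\<integral>\<^sup>+z. g z \<partial>lborel)"
  proof -
    have "1 / (b ^ 3 * c ^ 3) = 1 / c ^ 3 * (1 / b ^ 3)" by simp
    then show ?thesis using b c by (simp only: ennreal_mult' mult.assoc zero_le_divide_1_iff zero_le_power less_imp_le)
  qed
  finally show ?thesis .
qed

definition rescale :: "real \<Rightarrow> real \<Rightarrow> real \<Rightarrow> phase_fun \<Rightarrow> phase_fun" where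
  "rescale a b c f z = a * f (b *\<^sub>R fst z, c *\<^sub>R snd z)"

context
  fixes a b c :: real and f :: phase_fun
  assumes abc: "0 < a" "0 < b" "0 < c" and f: "phase f"
begin

private lemma fm [measurable]: "f \<in> borel_measurable borel" by (rule phaseD(1)[OF f])

lemma phase_rescale: "phase (rescale a b c f)"
proof -
  have "(\<lambda>z. f (b *\<^sub>R fst z, c *\<^sub>R snd z)) \<in> borel_measurable borel"
  proof (rule measurable_compose[OF _ fm])
    show "(\<lambda>z::(real^3) \<times> (real^3). (b *\<^sub>R fst z, c *\<^sub>R snd z)) \<in> borel_measurable borel"
      by (intro borel_measurable_continuous_onI continuous_intros)
  qed
  then show ?thesis unfolding phase_def rescale_def[abs_def] using abc phaseD(2)[OF f] by auto
qed

lemma nn_integral_rescale: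
  "(\<integral>\<^sup>+z. ennreal (rescale a b c f z) \<partial>lborel) = ennreal (a / (b ^ 3 * c ^ 3)) * (\<integral>\<^sup>+z. ennreal (f z) \<partial>lborel)"
proof -
  have "(\<integral>\<^sup>+z. ennreal (rescale a b c f z) \<partial>lborel) = (\<integral>\<^sup>+z. (\<lambda>z. ennreal (a * f z)) (b *\<^sub>R fst z, c *\<^sub>R snd z) \<partial>lborel)"
    by (simp add: rescale_def)
  also have "\<dots> = ennreal (1 / (b ^ 3 * c ^ 3)) * (\<integral>\<^sup>+z. ennreal (a * f z) \<partial>lborel)"
    by (rule nn_integral_phase_scale[OF _ abc(2,3)]) measurable
  also have "(\<integral>\<^sup>+z. ennreal (a * f z) \<partial>lborel) = ennreal a * (\<integral>\<^sup>+z. ennreal (f z) \<partial>lborel)"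
    using abc by (simp add: ennreal_mult' nn_integral_cmult)
  also have "ennreal (1 / (b ^ 3 * c ^ 3)) * (ennreal a * (\<integral>\<^sup>+z. ennreal (f z) \<partial>lborel)) = ennreal (a / (b ^ 3 * c ^ 3)) * (\<integral>\<^sup>+z. ennreal (f z) \<partial>lborel)"
    using abc by (simp add: mult.assoc[symmetric] ennreal_mult[symmetric])
  finally show ?thesis .
qed

lemma Ekin_rescale: "Ekin (rescale a b c f) = ennreal (a / (b ^ 3 * c ^ 3) / c\<^sup>2) * Ekin f"
proof -
  have "Ekin (rescale a b c f) = (\<integral>\<^sup>+z. (\<lambda>z. ennreal (a / c\<^sup>2 * (norm (snd z) ^ 2 / 2 * f z))) (b *\<^sub>R fst z, c *\<^sub>R snd z) \<partial>lborel)"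
    unfolding Ekin_def rescale_def
    by (intro nn_integral_cong arg_cong[where f = ennreal]) (use abc in \<open>simp add: power_mult_distrib field_simps\<close>)
  also have "\<dots> = ennreal (1 / (b ^ 3 * c ^ 3)) * (\<integral>\<^sup>+z. ennreal (a / c\<^sup>2 * (norm (snd z) ^ 2 / 2 * f z)) \<partial>lborel)"
    by (rule nn_integral_phase_scale[OF _ abc(2,3)])
       (intro measurable_compose[OF _ measurable_ennreal] borel_measurable_times borel_measurable_const measurable_kinetic fm)
  also have "(\<integral>\<^sup>+z. ennreal (a / c\<^sup>2 * (norm (snd z) ^ 2 / 2 * f z)) \<partial>lborel) = ennreal (a / c\<^sup>2) * Ekin f"
  proof -
    have m: "(\<lambda>z. ennreal (norm (snd z) ^ 2 / 2 * f z)) \<in> borel_measurable lborel"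
      using measurable_compose[OF measurable_kinetic[OF fm] measurable_ennreal] by simp
    show ?thesis unfolding Ekin_def nn_integral_cmult[OF m, symmetric]
      using abc by (intro nn_integral_cong ennreal_mult') simp
  qed
  also have "ennreal (1 / (b ^ 3 * c ^ 3)) * (ennreal (a / c\<^sup>2) * Ekin f) = ennreal (a / (b ^ 3 * c ^ 3) / c\<^sup>2) * Ekin f"
    using abc by (simp add: mult.assoc[symmetric] ennreal_mult[symmetric])
  finally show ?thesis .
qed

lemma rho_rescale: "rho (rescale a b c f) = (\<lambda>x. a / c ^ 3 * rho f (b *\<^sub>R x))"
proof
  fix x
  have "rho (rescale a b c f) x = a * (\<integral>v. f (b *\<^sub>R x, c *\<^sub>R v) \<partial>lborel)"
    by (simp add: rho_def rescale_def)
  also have "(\<integral>v. f (b *\<^sub>R x, c *\<^sub>R v) \<partial>lborel) = (1 / c ^ 3) *\<^sub>R (\<integral>v. f (b *\<^sub>R x, v) \<partial>lborel)"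
    by (rule integral_scale3[OF measurable_slice[OF fm] abc(3)])
  finally show "rho (rescale a b c f) x = a / c ^ 3 * rho f (b *\<^sub>R x)" by (simp add: rho_def)
qed

end

text \<open>The kernel is homogeneous of degree -2 and the substitution contributes
  \<open>1 / b ^ 3\<close>, leaving \<open>1 / b\<close>. Both operations are unconditional, so the
  identity holds at every point.\<close>

lemma fld_rescale:
  assumes [measurable]: "p \<in> borel_measurable borel" and b: "0 < b"
  shows "fld (\<lambda>y. k * p (b *\<^sub>R y)) x = (k / b) *\<^sub>R fld p (b *\<^sub>R x)"
proof -
  have "fld (\<lambda>y. k * p (b *\<^sub>R y)) x = (\<integral>y. (k * b\<^sup>2) *\<^sub>R ((\<lambda>y. (p y / norm (b *\<^sub>R x - y) ^ 3) *\<^sub>R (b *\<^sub>R x - y)) (b *\<^sub>R y)) \<partial>lborel)"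
    unfolding fld_def
  proof (intro Bochner_Integration.integral_cong refl)
    fix y
    have "b *\<^sub>R x - b *\<^sub>R y = b *\<^sub>R (x - y)" by (simp add: algebra_simps)
    then have "(k * b\<^sup>2) *\<^sub>R ((\<lambda>y. (p y / norm (b *\<^sub>R x - y) ^ 3) *\<^sub>R (b *\<^sub>R x - y)) (b *\<^sub>R y))
       = (k * b\<^sup>2 * (p (b *\<^sub>R y) / (b * norm (x - y)) ^ 3) * b) *\<^sub>R (x - y)"
      using b by simp
    also have "k * b\<^sup>2 * (p (b *\<^sub>R y) / (b * norm (x - y)) ^ 3) * b = k * p (b *\<^sub>R y) / norm (x - y) ^ 3"
      using b by (simp add: power_mult_distrib power2_eq_square power3_eq_cube)
    finally show "(k * p (b *\<^sub>R y) / norm (x - y) ^ 3) *\<^sub>R (x - y) =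
      (k * b\<^sup>2) *\<^sub>R ((\<lambda>y. (p y / norm (b *\<^sub>R x - y) ^ 3) *\<^sub>R (b *\<^sub>R x - y)) (b *\<^sub>R y))" by simp
  qed
  also have "\<dots> = (k * b\<^sup>2) *\<^sub>R (\<integral>y. (\<lambda>y. (p y / norm (b *\<^sub>R x - y) ^ 3) *\<^sub>R (b *\<^sub>R x - y)) (b *\<^sub>R y) \<partial>lborel)"
    by (rule integral_scaleR_right)
  also have "(\<integral>y. (\<lambda>y. (p y / norm (b *\<^sub>R x - y) ^ 3) *\<^sub>R (b *\<^sub>R x - y)) (b *\<^sub>R y) \<partial>lborel) = (1 / b ^ 3) *\<^sub>R fld p (b *\<^sub>R x)"
    unfolding fld_def by (rule integral_scale3[OF _ b]) measurable
  also have "(k * b\<^sup>2) *\<^sub>R ((1 / b ^ 3) *\<^sub>R fld p (b *\<^sub>R x)) = (k / b) *\<^sub>R fld p (b *\<^sub>R x)"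
    using b by (simp add: power2_eq_square power3_eq_cube)
  finally show ?thesis .
qed

lemma field_energy_rescale:
  assumes [measurable]: "p \<in> borel_measurable borel" and b: "0 < b"
  shows "field_energy (\<lambda>y. k * p (b *\<^sub>R y)) = (k / b)\<^sup>2 / b ^ 3 * field_energy p"
proof -
  have "field_energy (\<lambda>y. k * p (b *\<^sub>R y)) = (\<integral>x. (k / b)\<^sup>2 * ((\<lambda>x. norm (fld p x) ^ 2) (b *\<^sub>R x)) \<partial>lborel)"
    unfolding field_energy_def fld_rescale[OF assms] by (simp add: power_mult_distrib power_divide)
  also have "\<dots> = (k / b)\<^sup>2 * (\<integral>x. (\<lambda>x. norm (fld p x) ^ 2) (b *\<^sub>R x) \<partial>lborel)"
    by (rule integral_mult_right_zero)
  also have "(\<integral>x. (\<lambda>x. norm (fld p x) ^ 2) (b *\<^sub>R x) \<partial>lborel) = (1 / b ^ 3) *\<^sub>R field_energy p"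
    unfolding field_energy_def by (rule integral_scale3[OF _ b]) measurable
  finally show ?thesis by simp
qed

text \<open>The factor is arranged as the square of the mass ratio times the inverse length
  \<open>b\<close>, the form in which it is compared with the other energies.\<close>

lemma field_energy_rescale_phase:
  assumes abc: "0 < a" "0 < b" "0 < c" and f: "phase f"
  shows "field_energy (rho (rescale a b c f)) = (a / (b ^ 3 * c ^ 3))\<^sup>2 * b * field_energy (rho f)"
proof -
  have "(a / c ^ 3 / b)\<^sup>2 / b ^ 3 = (a / (b ^ 3 * c ^ 3))\<^sup>2 * b"
    using abc by (simp add: power2_eq_square power3_eq_cube field_simps)
  then show ?thesis
    unfolding rho_rescale[OF abc f] field_energy_rescale[OF measurable_rho[OF phaseD(1)[OF f]] abc(2)] by simp
qed

context casimir
begin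

text \<open>(Q3) read backwards: applied at \<open>a * s\<close> with ratio \<open>1 / a\<close>, it
  bounds the effect of amplification.\<close>

lemma Q_scale_le:
  assumes "1 \<le> a" "0 \<le> s"
  shows "Q (a * s) \<le> a powr (1 + 1 / k3) * Q s"
proof -
  have "(1 / a) powr (1 + 1 / k3) * Q (a * s) \<le> Q (1 / a * (a * s))"
    using assms Q3[rule_format, of "a * s" "1 / a"] by simp
  also have "1 / a * (a * s) = s" using assms by simp
  also have "(1 / a) powr (1 + 1 / k3) = 1 / a powr (1 + 1 / k3)"
    using assms by (simp add: powr_divide)
  finally show ?thesis using assms by (simp add: field_simps)
qed

lemma Cas_rescale_le:
  assumes a: "1 \<le> a" and b: "0 < b" and c: "0 < c" and f: "phase f"
  shows "Cas Q (rescale a b c f) \<le> ennreal (a powr (1 + 1 / k3) / (b ^ 3 * c ^ 3)) * Cas Q f"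
proof -
  note [measurable] = phaseD(1)[OF f]
  have [measurable]: "(\<lambda>z. Q (f z)) \<in> borel_measurable borel" using phaseD[OF f] by (intro measurable_Q_comp) auto
  have "Cas Q (rescale a b c f) \<le> (\<integral>\<^sup>+z. (\<lambda>z. ennreal (a powr (1 + 1 / k3)) * ennreal (Q (f z))) (b *\<^sub>R fst z, c *\<^sub>R snd z) \<partial>lborel)"
    unfolding Cas_def rescale_def
    using Q_scale_le[OF a phaseD(2)[OF f]] by (intro nn_integral_mono) (simp add: ennreal_mult'[symmetric] ennreal_leI)
  also have "\<dots> = ennreal (1 / (b ^ 3 * c ^ 3)) * (\<integral>\<^sup>+z. ennreal (a powr (1 + 1 / k3)) * ennreal (Q (f z)) \<partial>lborel)"
    by (rule nn_integral_phase_scale[OF _ b c]) measurable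
  also have "\<dots> = ennreal (1 / (b ^ 3 * c ^ 3)) * (ennreal (a powr (1 + 1 / k3)) * Cas Q f)"
    by (simp add: nn_integral_cmult Cas_def)
  also have "\<dots> = ennreal (a powr (1 + 1 / k3) / (b ^ 3 * c ^ 3)) * Cas Q f"
    using b c by (simp add: mult.assoc[symmetric] ennreal_mult[symmetric])
  finally show ?thesis .
qed

text \<open>Excess of the mass exponent over linear scaling, positive since \<open>k3 < 3/2\<close>.
  A positive excess makes splitting the mass strictly unfavourable.\<close>

definition scal_exp :: real where "scal_exp = 4 / (3 - 2 * k3)"

lemma scal_exp_pos: "0 < scal_exp"
  using k_bounds by (simp add: scal_exp_def)

text \<open>The rescaling exponents are chosen so that kinetic energy, potential energy and the bound (Q3)
  for the Casimir functional all pick up the same factor.\<close>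

lemma hM_le_scaled:
  assumes M': "0 < M'" "M' \<le> M" and f: "f \<in> FM Q M'"
  shows "hM Q M \<le> (M / M') powr (1 + scal_exp) * HC Q f"
proof -
  note F = FM_D[OF f]
  define m where "m = M / M'"
  have m: "1 \<le> m" "0 < m" using M' by (auto simp: m_def)
  define d where "d = 3 - 2 * k3"
  have d: "0 < d" using k_bounds by (simp add: d_def)
  \<comment> \<open>With mass factor \<open>m\<close>, kinetic, potential and Casimir energy scale
    by \<open>m / c^2\<close>, \<open>m^2 * b\<close> and at most
    \<open>m * a powr (1 / k3)\<close>. Requiring \<open>1 / c^2 = m * b = a powr (1 / k3)\<close>
    together with \<open>a = m * b ^ 3 * c ^ 3\<close> determines these exponents.\<close>
  define a b c where "a = m powr (4 * k3 / d)" and "b = m powr (4 / d - 1)" and "c = m powr (- 2 / d)"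
  have abc: "0 < a" "0 < b" "0 < c" and a1: "1 \<le> a"
    using m d k_bounds by (auto simp: a_def b_def c_def intro!: ge_one_powr_ge_zero)
  have pw: "(m powr e) ^ n = m powr (e * real n)" for e n
    using m by (simp add: powr_powr powr_realpow[symmetric])
  define X where "X = m powr (1 + scal_exp)"
  have X: "0 \<le> X" by (simp add: X_def)
  have e1: "4 * k3 / d = 6 / d - 2" using d by (simp add: d_def field_simps)
  have bc: "b ^ 3 * c ^ 3 = m powr (6 / d - 3)"
  proof -
    have "b ^ 3 * c ^ 3 = m powr ((4 / d - 1) * real 3 + (- 2 / d) * real 3)"
      unfolding b_def c_def pw by (rule powr_add[symmetric])
    also have "(4 / d - 1) * real 3 + (- 2 / d) * real 3 = 6 / d - 3" by (simp add: algebra_simps add_divide_distrib[symmetric] diff_divide_distrib[symmetric])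
    finally show ?thesis .
  qed
  have mass: "a / (b ^ 3 * c ^ 3) = m"
  proof -
    have "a / (b ^ 3 * c ^ 3) = m powr (4 * k3 / d - (6 / d - 3))" unfolding bc a_def by (rule powr_diff[symmetric])
    also have "4 * k3 / d - (6 / d - 3) = 1" unfolding e1 by simp
    finally show ?thesis using m by simp
  qed
  have kin: "a / (b ^ 3 * c ^ 3) / c\<^sup>2 = X"
  proof -
    have "a / (b ^ 3 * c ^ 3) / c\<^sup>2 = m powr 1 / m powr (- 2 / d * real 2)" unfolding mass unfolding c_def pw using m by simp
    also have "\<dots> = m powr (1 - (- 2 / d * real 2))" by (rule powr_diff[symmetric])
    also have "1 - (- 2 / d * real 2) = 1 + scal_exp" by (simp add: scal_exp_def d_def)
    finally show ?thesis unfolding X_def .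
  qed
  have cas: "a powr (1 + 1 / k3) / (b ^ 3 * c ^ 3) = X"
  proof -
    have "a powr (1 + 1 / k3) / (b ^ 3 * c ^ 3) = m powr (4 * k3 / d * (1 + 1 / k3) - (6 / d - 3))"
      unfolding bc unfolding a_def powr_powr by (rule powr_diff[symmetric])
    also have "4 * k3 / d * (1 + 1 / k3) = 4 * k3 / d + 4 / d"
      using k_bounds d by (simp add: field_simps)
    also have "4 * k3 / d + 4 / d - (6 / d - 3) = 1 + scal_exp" unfolding e1 by (simp add: scal_exp_def d_def)
    finally show ?thesis unfolding X_def .
  qed
  have pot: "(a / (b ^ 3 * c ^ 3))\<^sup>2 * b = X"
  proof -
    have "(a / (b ^ 3 * c ^ 3))\<^sup>2 * b = m powr 2 * m powr (4 / d - 1)" unfolding mass unfolding b_def using m by simp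
    also have "\<dots> = m powr (2 + (4 / d - 1))" by (rule powr_add[symmetric])
    also have "2 + (4 / d - 1) = 1 + scal_exp" by (simp add: scal_exp_def d_def)
    finally show ?thesis unfolding X_def .
  qed
  let ?g = "rescale a b c f"
  have P: "Pfun Q ?g \<le> ennreal X * Pfun Q f"
    unfolding Pfun_def distrib_left
    using Cas_rescale_le[OF a1 abc(2,3) F(1)] Ekin_rescale[OF abc F(1)] unfolding cas kin by (intro add_mono) auto
  also have "\<dots> = ennreal (X * enn2real (Pfun Q f))"
    using X F(4) by (simp add: ennreal_mult)
  finally have P': "Pfun Q ?g \<le> ennreal (X * enn2real (Pfun Q f))" .
  have gF: "?g \<in> FM Q M"
  proof (rule FM_I[OF phase_rescale[OF abc F(1)]])
    show "(\<integral>\<^sup>+z. ennreal (?g z) \<partial>lborel) = ennreal M"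
      unfolding nn_integral_rescale[OF abc F(1)] mass F(2) using M' by (simp add: m_def ennreal_mult[symmetric])
    show "0 \<le> M" using M' by simp
    show "Pfun Q ?g < \<infinity>" using le_less_trans[OF P' ennreal_less_top] by simp
  qed
  have "hM Q M \<le> HC Q ?g" using M' gF by (intro hM_le) auto
  also have "\<dots> \<le> X * HC Q f"
  proof -
    have "enn2real (Pfun Q ?g) \<le> X * enn2real (Pfun Q f)"
      using enn2real_mono[OF P'] X by simp
    then show ?thesis
      unfolding HC_eq field_energy_rescale_phase[OF abc F(1)] pot by (simp add: algebra_simps)
  qed
  finally show ?thesis by (simp add: X_def m_def)
qed

end

section \<open>Negativity of the infimum\<close>

lemma powr_small:
  fixes q e :: real
  assumes "0 < q" "0 < e"
  shows "\<exists>t0>0. \<forall>t. 0 < t \<and> t \<le> t0 \<longrightarrow> t powr q \<le> e"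
proof (intro exI conjI allI impI)
  show "0 < e powr (1 / q)" using assms by simp
  fix t assume t: "0 < t \<and> t \<le> e powr (1 / q)"
  then have "t powr q \<le> (e powr (1 / q)) powr q" using assms by (intro powr_mono2) auto
  also have "\<dots> = e" using assms by (simp add: powr_powr)
  finally show "t powr q \<le> e" .
qed

lemma not_AE_notin_ball:
  assumes "0 < r"
  shows "\<not> (AE y in lborel. y \<notin> ball (w::'a::euclidean_space) r)"
proof
  assume "AE y in lborel. y \<notin> ball w r"
  then have "ball w r \<in> null_sets lborel" by (subst AE_iff_null_sets) auto
  then have "emeasure lborel (ball w r) = 0" by auto
  moreover have "0 < unit_ball_vol (real DIM('a)) * r ^ DIM('a)" using assms by simp
  ultimately show False using assms by (simp add: emeasure_ball ennreal_eq_0_iff)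
qed

text \<open>The component of the field along \<open>x\<close> is a positive integral, since
  \<open>x \<bullet> (x - y) > 0\<close> for \<open>norm y < 1 < norm x\<close>. The distance 2
  keeps the kernel bounded on the source ball, hence integrable.\<close>

lemma fld_ball_nonzero:
  fixes k :: real and x :: "real^3"
  assumes k: "0 < k" and x: "2 \<le> norm x"
  shows "fld (\<lambda>y. k * indicator (ball 0 1) y) x \<noteq> 0"
proof
  let ?J = "\<lambda>y::real^3. (k * indicator (ball 0 1) y / norm (x - y) ^ 3) *\<^sub>R (x - y)"
  assume z: "fld (\<lambda>y. k * indicator (ball 0 1) y) x = 0"
  have dist: "1 \<le> norm (x - y)" if "y \<in> ball 0 1" for y
    using that x norm_triangle_ineq2[of x y] by simp
  have J: "integrable lborel ?J"
  proof (rule Bochner_Integration.integrable_bound)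
    show "integrable lborel (\<lambda>y::real^3. k * indicator (ball 0 1) y)"
      using emeasure_lborel_ball_finite[of "0::real^3" 1] by (intro integrable_mult_right integrable_real_indicator) auto
    show "?J \<in> borel_measurable lborel" by measurable
    show "AE y in lborel. norm (?J y) \<le> norm (k * indicator (ball 0 1) y)"
    proof (rule AE_I2)
      fix y :: "real^3"
      show "norm (?J y) \<le> norm (k * indicator (ball 0 1) y)"
      proof (cases "y \<in> ball 0 1")
        case True
        have "1 \<le> norm (x - y) ^ 2" using dist[OF True] by (intro one_le_power)
        then have "k / norm (x - y) ^ 2 \<le> k / 1" using k by (intro divide_left_mono) auto
        then show ?thesis unfolding norm_coulomb_kernel using True k by simp
      qed simp
    qed
  qed
  have pos: "0 < x \<bullet> ?J y" if y: "y \<in> ball 0 1" for y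
  proof -
    have "x \<bullet> y \<le> norm x * norm y" by (rule norm_cauchy_schwarz)
    also have "\<dots> < norm x * norm x" using y x by (intro mult_strict_left_mono) auto
    finally have "0 < x \<bullet> (x - y)" by (simp add: inner_diff_right power2_norm_eq_inner[symmetric] power2_eq_square)
    moreover have "0 < norm (x - y) ^ 3" using dist[OF y] by (intro zero_less_power) auto
    ultimately have "0 < k * (x \<bullet> (x - y)) / norm (x - y) ^ 3" using k by (intro divide_pos_pos mult_pos_pos)
    then show ?thesis using y by simp
  qed
  have nn: "0 \<le> x \<bullet> ?J y" for y using pos[of y] by (cases "y \<in> ball 0 1") auto
  have i: "integrable lborel (\<lambda>y. x \<bullet> ?J y)" using J by (rule integrable_inner_right)
  have "(\<integral>y. x \<bullet> ?J y \<partial>lborel) = x \<bullet> fld (\<lambda>y. k * indicator (ball 0 1) y) x"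
    unfolding fld_def using J by (rule integral_inner_right)
  also have "\<dots> = 0" using z by simp
  finally have "AE y in lborel. x \<bullet> ?J y = 0"
    using integral_nonneg_eq_0_iff_AE[OF i] nn by auto
  then have "AE y in lborel. y \<notin> ball (0::real^3) 1"
    by eventually_elim (use pos in force)
  then show False using not_AE_notin_ball[of 1 "0::real^3"] by simp
qed

lemma dens_ball:
  assumes k: "0 < k"
  shows "\<exists>M A. dens M A (\<lambda>y. k * indicator (ball 0 1) y)"
proof -
  define V where "V = measure lborel (ball (0::real^3) 1)"
  have V: "emeasure lborel (ball (0::real^3) 1) = ennreal V"
    unfolding V_def using emeasure_lborel_ball_finite[of "0::real^3" 1] by (intro emeasure_eq_ennreal_measure) auto
  have "(\<integral>\<^sup>+(x::real^3). ennreal (k * indicator (ball 0 1) x) \<partial>lborel) = ennreal k * ennreal V"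
    using k unfolding V[symmetric] by (subst nn_integral_cmult_indicator[symmetric]) (auto intro!: nn_integral_cong simp: indicator_def)
  moreover have "(\<integral>\<^sup>+(x::real^3). ennreal ((k * indicator (ball 0 1) x) powr (4/3)) \<partial>lborel) = ennreal (k powr (4/3)) * ennreal V"
    unfolding V[symmetric] by (subst nn_integral_cmult_indicator[symmetric]) (auto intro!: nn_integral_cong simp: indicator_def)
  ultimately show ?thesis
    using k by (intro exI[of _ "k * V"] exI[of _ "k powr (4/3) * V"]) (auto simp: dens_def V_def ennreal_mult)
qed

text \<open>The unit ball around \<open>3 *\<^sub>R axis 1 1\<close> lies where
  \<open>norm x\<close> is at least 2, so the field is nonzero on a set of positive measure.\<close>

lemma field_energy_ball_pos:
  assumes k: "0 < k"
  shows "0 < field_energy (\<lambda>y. k * indicator (ball 0 1) y)"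
proof -
  let ?p = "\<lambda>y::real^3. k * indicator (ball 0 1) y"
  obtain M A where d: "dens M A ?p" using dens_ball[OF k] by blast
  have "field_energy ?p \<noteq> 0"
  proof
    assume "field_energy ?p = 0"
    then have "AE x in lborel. norm (fld ?p x) ^ 2 = 0"
      unfolding field_energy_def using integral_nonneg_eq_0_iff_AE[OF integrable_fld_square[OF d]] by auto
    then have "AE x in lborel. x \<notin> ball (3 *\<^sub>R axis 1 1 :: real^3) 1"
    proof eventually_elim
      case (elim x)
      show ?case
      proof
        assume "x \<in> ball (3 *\<^sub>R axis 1 1) 1"
        then have "2 \<le> norm x"
          using norm_triangle_ineq2[of "3 *\<^sub>R axis 1 1 :: real^3" x] by (simp add: dist_norm norm_axis_1)
        then show False using fld_ball_nonzero[OF k, of x] elim by simp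
      qed
    qed
    then show False using not_AE_notin_ball[of 1 "3 *\<^sub>R axis 1 1 :: real^3"] by simp
  qed
  then show ?thesis using field_energy_nonneg[of ?p] by simp
qed

context casimir
begin

text \<open>A uniform ball spread out over a large region with small velocities has negative energy; the
  scaling \<open>c = t\<^bsup>-\<beta>\<^esup>\<close> with \<open>1/2 < \<beta> < 1 - k2/3\<close> makes the potential energy dominate.\<close>

lemma hM_neg:
  assumes M: "0 < M"
  shows "hM Q M < 0"
proof -
  define B where "B = ball (0::real^3) 1"
  have [measurable]: "B \<in> sets borel" by (simp add: B_def)
  define V where "V = measure lborel B"
  have VB: "emeasure lborel B = ennreal V"
    unfolding V_def B_def using emeasure_lborel_ball_finite[of "0::real^3" 1] by (intro emeasure_eq_ennreal_measure) auto
  have V: "0 < V"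
  proof -
    have "V \<noteq> 0"
    proof
      assume "V = 0"
      then have "B \<in> null_sets lborel" using VB by (intro null_setsI) auto
      then have "AE y in lborel. y \<notin> B" by (rule AE_not_in)
      then show False using not_AE_notin_ball[of 1 "0::real^3"] by (simp add: B_def)
    qed
    then show ?thesis by (simp add: V_def less_le)
  qed
  define kap where "kap = M / V\<^sup>2"
  have kap: "0 < kap" using M V by (simp add: kap_def)
  define f where "f z = kap * indicator B (fst z) * indicator B (snd z)" for z :: "(real^3) \<times> (real^3)"
  have mB: "(\<lambda>z::(real^3)\<times>(real^3). indicator B (fst z) * indicator B (snd z) :: real) \<in> borel_measurable borel"
    by (intro borel_measurable_times measurable_compose[OF measurable_fst_borel] measurable_compose[OF measurable_snd_borel]) auto
  have f: "phase f"
    unfolding phase_def f_def[abs_def] using kap mB by (auto simp: mult.assoc indicator_def)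
  have I: "(\<integral>\<^sup>+z. ennreal (k * (indicator B (fst z) * indicator B (snd z))) \<partial>lborel) = ennreal (k * V\<^sup>2)" if "0 \<le> k" for k
  proof -
    have "(\<integral>\<^sup>+z. ennreal (k * (indicator B (fst z) * indicator B (snd z))) \<partial>lborel)
      = (\<integral>\<^sup>+x. \<integral>\<^sup>+v. ennreal (k * (indicator B x * indicator B v)) \<partial>lborel \<partial>lborel)"
      using mB by (subst nn_integral_phase) auto
    also have "\<dots> = (\<integral>\<^sup>+x. \<integral>\<^sup>+v. ennreal k * indicator B x * indicator B v \<partial>lborel \<partial>lborel)"
      using that by (intro nn_integral_cong) (auto simp: indicator_def)
    also have "\<dots> = (\<integral>\<^sup>+x. ennreal k * ennreal V * indicator B x \<partial>lborel)"
      by (intro nn_integral_cong) (subst nn_integral_cmult_indicator, simp_all add: VB mult_ac)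
    also have "\<dots> = ennreal (k * V\<^sup>2)"
      using that V by (subst nn_integral_cmult_indicator) (auto simp: VB ennreal_mult[symmetric] power2_eq_square mult.assoc)
    finally show ?thesis .
  qed
  have mass: "(\<integral>\<^sup>+z. ennreal (f z) \<partial>lborel) = ennreal M"
    using I[of kap] kap V by (simp add: f_def kap_def mult.assoc)
  have Ekin: "Ekin f \<le> ennreal M"
    unfolding Ekin_def mass[symmetric]
  proof (intro nn_integral_mono ennreal_leI)
    fix z
    show "norm (snd z) ^ 2 / 2 * f z \<le> f z"
    proof (cases "snd z \<in> B")
      case True
      then have "norm (snd z) ^ 2 \<le> 1" by (simp add: B_def power_le_one)
      then have "norm (snd z) ^ 2 / 2 * f z \<le> 1 * f z" using phaseD(2)[OF f] by (intro mult_right_mono) auto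
      then show ?thesis by simp
    qed (simp add: f_def)
  qed
  have rho: "rho f = (\<lambda>x. (kap * V) * indicator (ball 0 1) x)"
  proof
    fix x
    have "rho f x = (\<integral>v. kap * indicator B x * indicator B v \<partial>lborel)" by (simp add: rho_def f_def)
    also have "\<dots> = kap * indicator B x * V" unfolding V_def by simp
    finally show "rho f x = (kap * V) * indicator (ball 0 1) x" by (simp add: B_def)
  qed
  define W where "W = field_energy (rho f) / (8 * pi)"
  have W: "0 < W" unfolding W_def rho using field_energy_ball_pos[of "kap * V"] kap V by simp
  define be where "be = (3/2 - k2/3) / 2"
  have be: "1/2 < be" "be < 1 - k2/3" "be < 1" using k_bounds by (auto simp: be_def)
  define K where "K = C2 * kap powr (1 + 1 / k2) * V\<^sup>2"
  have K: "0 < K" using const_pos kap V by (simp add: K_def)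
  \<comment> \<open>Under the scaling the Casimir energy is of order \<open>t powr p\<close>, the
    kinetic energy \<open>t powr (2 * be)\<close>, the potential energy \<open>t\<close>. The two
    bounds on \<open>be\<close> say that the first two exponents exceed 1.\<close>
  define p where "p = (3 - 3 * be) / k2"
  have p: "1 < p" using be k_bounds by (simp add: p_def field_simps)
  \<comment> \<open>\<open>t1\<close> and \<open>t2\<close> limit Casimir and kinetic energy to
    \<open>t * W / 4\<close> each, against a potential energy of \<open>- t * W\<close>.
    \<open>t3\<close> keeps the amplitude \<open>a * kap\<close> below \<open>F0\<close>, the range
    of (Q2).\<close>
  obtain t1 where t1: "0 < t1" "\<And>t. 0 < t \<Longrightarrow> t \<le> t1 \<Longrightarrow> t powr (p - 1) \<le> W / (4 * K)"
    using powr_small[of "p - 1" "W / (4 * K)"] p W K by auto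
  obtain t2 where t2: "0 < t2" "\<And>t. 0 < t \<Longrightarrow> t \<le> t2 \<Longrightarrow> t powr (2 * be - 1) \<le> W / (4 * M)"
    using powr_small[of "2 * be - 1" "W / (4 * M)"] be W M by auto
  obtain t3 where t3: "0 < t3" "\<And>t. 0 < t \<Longrightarrow> t \<le> t3 \<Longrightarrow> t powr (3 - 3 * be) \<le> F0 / kap"
    using powr_small[of "3 - 3 * be" "F0 / kap"] be const_pos kap by auto
  define t where "t = min t1 (min t2 t3)"
  have t: "0 < t" "t \<le> t1" "t \<le> t2" "t \<le> t3" using t1 t2 t3 by (auto simp: t_def)
  \<comment> \<open>\<open>a = t ^ 3 * c ^ 3\<close>, which preserves the mass.\<close>
  define a c where "a = t powr (3 - 3 * be)" and "c = t powr (- be)"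
  have abc: "0 < a" "0 < t" "0 < c" using t by (auto simp: a_def c_def)
  have pw: "(t powr e) ^ n = t powr (e * real n)" for e n
    using t by (simp add: powr_powr powr_realpow[symmetric])
  have tc: "t ^ 3 * c ^ 3 = a"
  proof -
    have "t ^ 3 * c ^ 3 = (t powr 1) ^ 3 * c ^ 3" using t by simp
    also have "\<dots> = t powr (1 * real 3 + - be * real 3)" unfolding c_def pw by (rule powr_add[symmetric])
    also have "1 * real 3 + - be * real 3 = 3 - 3 * be" by simp
    finally show ?thesis by (simp add: a_def)
  qed
  have c2: "1 / c\<^sup>2 = t powr (2 * be)"
  proof -
    have "c\<^sup>2 = t powr (- (2 * be))" unfolding c_def pw by (simp add: mult.commute)
    then show ?thesis by (simp add: powr_minus_divide)
  qed
  let ?g = "rescale a t c f"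
  have g: "phase ?g" by (rule phase_rescale[OF abc f])
  have ind: "?g z = (a * kap) * (indicator B (t *\<^sub>R fst z) * indicator B (c *\<^sub>R snd z))" for z
    by (simp add: rescale_def f_def mult_ac)
  have ak: "0 \<le> a * kap" "a * kap \<le> F0"
    using t3(2)[OF t(1,4)] kap abc by (auto simp: a_def field_simps)
  define q where "q = C2 * (a * kap) powr (1 + 1 / k2)"
  have q: "0 \<le> q" "Q (a * kap) \<le> q" using const_pos Q2 ak by (auto simp: q_def)
  have "Cas Q ?g \<le> (\<integral>\<^sup>+z. (\<lambda>z. ennreal (q * (indicator B (fst z) * indicator B (snd z)))) (t *\<^sub>R fst z, c *\<^sub>R snd z) \<partial>lborel)"
    unfolding Cas_def ind using q by (intro nn_integral_mono ennreal_leI) (auto simp: indicator_def Q_zero)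
  also have "\<dots> = ennreal (1 / (t ^ 3 * c ^ 3)) * (\<integral>\<^sup>+z. ennreal (q * (indicator B (fst z) * indicator B (snd z))) \<partial>lborel)"
    using mB by (intro nn_integral_phase_scale[OF _ abc(2,3)]) auto
  also have "\<dots> = ennreal (q * V\<^sup>2 / a)" unfolding tc I[OF q(1)] using abc q by (simp add: ennreal_mult[symmetric])
  also have "q * V\<^sup>2 / a = K * t powr p"
  proof -
    have "q * V\<^sup>2 / a = K * (a powr (1 + 1 / k2) / a powr 1)"
      using abc kap by (simp add: q_def K_def powr_mult)
    also have "a powr (1 + 1 / k2) / a powr 1 = a powr (1 / k2)" unfolding powr_diff[symmetric] by simp
    also have "\<dots> = t powr p" by (simp add: a_def powr_powr p_def)
    finally show ?thesis .
  qed
  finally have Cas: "Cas Q ?g \<le> ennreal (K * t powr p)" .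
  have a1: "a / (t ^ 3 * c ^ 3) = 1" unfolding tc using abc by simp
  have "Ekin ?g = ennreal (t powr (2 * be)) * Ekin f"
    unfolding Ekin_rescale[OF abc f] a1 c2 ..
  also have "\<dots> \<le> ennreal (t powr (2 * be)) * ennreal M" by (intro mult_left_mono Ekin) simp
  also have "\<dots> = ennreal (M * t powr (2 * be))" using M by (simp add: ennreal_mult[symmetric] mult.commute)
  finally have "Pfun Q ?g \<le> ennreal (K * t powr p) + ennreal (M * t powr (2 * be))"
    unfolding Pfun_def using Cas by (intro add_mono)
  also have "\<dots> = ennreal (K * t powr p + M * t powr (2 * be))" using K M by simp
  finally have P: "Pfun Q ?g \<le> ennreal (K * t powr p + M * t powr (2 * be))" .
  have "?g \<in> FM Q M"
  proof (rule FM_I[OF g])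
    show "(\<integral>\<^sup>+z. ennreal (?g z) \<partial>lborel) = ennreal M"
      unfolding nn_integral_rescale[OF abc f] a1 mass by simp
    show "Pfun Q ?g < \<infinity>" using le_less_trans[OF P ennreal_less_top] by simp
  qed (use M in simp)
  then have "hM Q M \<le> HC Q ?g" by (rule hM_le[OF M])
  also have "HC Q ?g = enn2real (Pfun Q ?g) - t * W"
    unfolding HC_eq field_energy_rescale_phase[OF abc f] a1 by (simp add: W_def)
  also have "\<dots> \<le> (K * t powr p + M * t powr (2 * be)) - t * W"
    using enn2real_mono[OF P] K M by (simp del: ennreal_plus)
  also have "\<dots> < 0"
  proof -
    have s: "t powr r = t * t powr (r - 1)" for r
      using t powr_add[of t 1 "r - 1"] by simp
    have "K * t powr p \<le> t * (W / 4)"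
    proof -
      have "K * t powr p = t * (K * t powr (p - 1))" by (subst s) simp
      also have "\<dots> \<le> t * (K * (W / (4 * K)))" using t1(2)[OF t(1,2)] t K by (intro mult_left_mono) auto
      finally show ?thesis using K by simp
    qed
    moreover have "M * t powr (2 * be) \<le> t * (W / 4)"
    proof -
      have "M * t powr (2 * be) = t * (M * t powr (2 * be - 1))" by (subst s) simp
      also have "\<dots> \<le> t * (M * (W / (4 * M)))" using t2(2)[OF t(1,3)] t M by (intro mult_left_mono) auto
      finally show ?thesis using M by simp
    qed
    moreover have "0 < t * W" using t W by simp
    ultimately show ?thesis by simp
  qed
  finally show ?thesis .
qed

end

section \<open>Concentration\<close>

text \<open>If no ball of radius \<open>R\<close> carries mass \<open>d0\<close>, three ranges of
  distance each contribute little to the Coulomb form: below \<open>r\<close> by the 4/3 bound,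
  between \<open>r\<close> and \<open>R\<close> at most \<open>d0 * M / r\<close>, beyond
  \<open>R\<close> at most \<open>M^2 / R\<close>. Their sum cannot reach \<open>dl\<close>.\<close>

lemma dens_nonvanishing:
  assumes dl: "0 < dl" and M: "0 < M" and A: "0 \<le> A"
  shows "\<exists>R>0. \<exists>d0>0. \<forall>p. dens M A p \<longrightarrow> dl \<le> field_energy p \<longrightarrow>
    (\<exists>y. ennreal d0 \<le> (\<integral>\<^sup>+x. ennreal (p x) * indicator (ball y R) x \<partial>lborel))"
proof -
  define c where "c = 8 * shell_const"
  have c: "0 < c" using shell_const_pos by (simp add: c_def)
  \<comment> \<open>The constants give the three ranges \<open>dl / 4\<close>, \<open>dl / 8\<close>
    and \<open>dl / 4\<close>, together less than \<open>dl\<close>. The 1 in \<open>G\<close> only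
    secures positivity of the denominator.\<close>
  define G where "G = c * (A\<^sup>2 + shell_const * A) + 1"
  have G: "0 < G" unfolding G_def using c A shell_const_pos by (intro add_nonneg_pos mult_nonneg_nonneg add_nonneg_nonneg) auto
  define r where "r = (dl / (4 * G))\<^sup>2"
  have r: "0 < r" "sqrt r = dl / (4 * G)" using dl G by (auto simp: r_def)
  define R where "R = 4 * c * M\<^sup>2 / dl"
  have R: "0 < R" using c M dl by (simp add: R_def)
  define d0 where "d0 = dl * r / (8 * c * M)"
  have d0: "0 < d0" using c M dl r by (simp add: d0_def)
  show ?thesis
  proof (rule exI[of _ R], intro conjI R, rule exI[of _ d0], intro conjI allI impI d0, rule ccontr)
    fix p assume p: "dens M A p" and fe: "dl \<le> field_energy p"
    note [measurable] = densD(1)[OF p]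
    assume "\<not> (\<exists>y. ennreal d0 \<le> (\<integral>\<^sup>+x. ennreal (p x) * indicator (ball y R) x \<partial>lborel))"
    then have small: "(\<integral>\<^sup>+x. ennreal (p x) * indicator (ball y R) x \<partial>lborel) \<le> ennreal d0" for y
      by (simp add: not_le less_imp_le)
    let ?p = "\<lambda>x. ennreal (p x)"
    have far: "bil (- ball 0 r) ?p ?p \<le> ennreal (d0 * M / r + M\<^sup>2 / R)"
    proof -
      have "bil (- ball 0 r) ?p ?p \<le> (\<integral>\<^sup>+y. \<integral>\<^sup>+z. ennreal (1 / r) * ?p y * (?p z * indicator (ball y R) z) + ennreal (1 / R) * ?p y * ?p z \<partial>lborel \<partial>lborel)"
        unfolding bil_def
      proof (intro nn_integral_mono)
        fix y z :: "real^3"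
        have k: "indicator (- ball 0 r) (y - z) * ennreal (1 / norm (y - z)) \<le> ennreal (1 / r) * indicator (ball y R) z + ennreal (1 / R)"
        proof (cases "norm (y - z) < r")
          case True
          then show ?thesis by (simp add: indicator_def)
        next
          case False
          show ?thesis
          proof (cases "norm (y - z) < R")
            case True
            have "1 / norm (y - z) \<le> 1 / r" using False r by (intro divide_left_mono) (auto intro!: mult_pos_pos)
            then have "ennreal (1 / norm (y - z)) \<le> ennreal (1 / r)" by (rule ennreal_leI)
            then show ?thesis using True False by (simp add: indicator_def dist_norm add_increasing2)
          next
            case F: False
            have "1 / norm (y - z) \<le> 1 / R" using F R by (intro divide_left_mono) (auto intro!: mult_pos_pos)
            then have "ennreal (1 / norm (y - z)) \<le> ennreal (1 / R)" by (rule ennreal_leI)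
            then show ?thesis using F False by (simp add: indicator_def dist_norm)
          qed
        qed
        have "?p y * ?p z * (indicator (- ball 0 r) (y - z) * ennreal (1 / norm (y - z)))
          \<le> ?p y * ?p z * (ennreal (1 / r) * indicator (ball y R) z + ennreal (1 / R))"
          by (rule mult_left_mono[OF k]) simp
        then show "?p y * ?p z * (indicator (- ball 0 r) (y - z) * ennreal (1 / norm (y - z)))
          \<le> ennreal (1 / r) * ?p y * (?p z * indicator (ball y R) z) + ennreal (1 / R) * ?p y * ?p z"
          by (simp only: distrib_left mult_ac)
      qed
      also have "\<dots> = (\<integral>\<^sup>+y. ennreal (1 / r) * ?p y * (\<integral>\<^sup>+z. ?p z * indicator (ball y R) z \<partial>lborel) + ennreal (1 / R) * ?p y * (\<integral>\<^sup>+z. ?p z \<partial>lborel) \<partial>lborel)"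
        by (intro nn_integral_cong, subst nn_integral_add) (auto simp: nn_integral_cmult)
      also have "\<dots> \<le> (\<integral>\<^sup>+y. ennreal (1 / r) * ?p y * ennreal d0 + ennreal (1 / R) * ?p y * ennreal M \<partial>lborel)"
        by (intro nn_integral_mono add_mono mult_left_mono small densD(5)[OF p]) auto
      also have "\<dots> = (\<integral>\<^sup>+y. (ennreal (1 / r) * ennreal d0 + ennreal (1 / R) * ennreal M) * ?p y \<partial>lborel)"
        by (intro nn_integral_cong) (simp only: distrib_right, simp only: mult_ac)
      also have "\<dots> = (ennreal (1 / r) * ennreal d0 + ennreal (1 / R) * ennreal M) * (\<integral>\<^sup>+y. ?p y \<partial>lborel)"
        by (rule nn_integral_cmult) measurable
      also have "\<dots> \<le> (ennreal (1 / r) * ennreal d0 + ennreal (1 / R) * ennreal M) * ennreal M"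
        by (intro mult_left_mono densD(5)[OF p]) auto
      also have "\<dots> = ennreal ((1 / r * d0 + 1 / R * M) * M)"
        using r(1) d0 R M by (simp add: ennreal_mult[symmetric] ennreal_plus[symmetric] del: ennreal_plus)
      also have "(1 / r * d0 + 1 / R * M) * M = d0 * M / r + M\<^sup>2 / R" by (simp add: algebra_simps power2_eq_square)
      finally show ?thesis .
    qed
    have near: "bil (ball 0 r) ?p ?p \<le> ennreal (sqrt r * (A\<^sup>2 + shell_const * A))"
      by (rule bil_ball_le) (use densD[OF p] r in auto)
    have "ennreal (field_energy p) \<le> (\<integral>\<^sup>+x. riesz UNIV ?p x * riesz UNIV ?p x \<partial>lborel)"
      unfolding ennreal_field_energy[OF p] using norm_fld_le[OF densD(1)[OF p]] densD(2)[OF p]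
      by (intro nn_integral_mono) (simp add: power2_eq_square ennreal_mult mult_mono)
    also have "\<dots> \<le> ennreal c * bil UNIV ?p ?p"
      unfolding c_def by (rule nn_integral_riesz_mult_le) auto
    also have "bil UNIV ?p ?p = bil (ball 0 r) ?p ?p + bil (- ball 0 r) ?p ?p"
      by (rule bil_split_near_far) measurable
    finally have "ennreal (field_energy p) \<le> ennreal c * (bil (ball 0 r) ?p ?p + bil (- ball 0 r) ?p ?p)" .
    also have "\<dots> \<le> ennreal c * (ennreal (sqrt r * (A\<^sup>2 + shell_const * A)) + ennreal (d0 * M / r + M\<^sup>2 / R))"
      by (intro mult_left_mono add_mono near far) simp
    also have "\<dots> = ennreal (c * (sqrt r * (A\<^sup>2 + shell_const * A) + (d0 * M / r + M\<^sup>2 / R)))"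
      using c r(1) A shell_const_pos d0 M R
      by (simp add: ennreal_mult[symmetric] ennreal_plus[symmetric] del: ennreal_plus)
    finally have "field_energy p \<le> c * (sqrt r * (A\<^sup>2 + shell_const * A) + (d0 * M / r + M\<^sup>2 / R))"
      using c r(1) A shell_const_pos d0 M R by (subst (asm) ennreal_le_iff) auto
    also have "\<dots> = sqrt r * (G - 1) + c * (d0 * M / r) + c * (M\<^sup>2 / R)"
      by (simp add: G_def algebra_simps)
    finally have "field_energy p \<le> sqrt r * (G - 1) + c * (d0 * M / r) + c * (M\<^sup>2 / R)" .
    moreover have "sqrt r * (G - 1) \<le> sqrt r * G" using r(1) by (intro mult_left_mono) auto
    moreover have "sqrt r * G = dl / 4" unfolding r(2) using G by simp
    moreover have "c * (d0 * M / r) = dl / 8" using c r(1) M by (simp add: d0_def)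
    moreover have "c * (M\<^sup>2 / R) = dl / 4" using c M dl by (simp add: R_def)
    moreover have False if "X \<le> a1 + a2 + a3" "a1 \<le> b1" "b1 = dl / 4" "a2 = dl / 8" "a3 = dl / 4" "dl \<le> X" for X a1 a2 a3 b1
      using that dl by linarith
    ultimately show False using fe by blast
  qed
qed

section \<open>Spatial cut-offs and splitting of the energy\<close>

definition cut :: "(real^3) set \<Rightarrow> phase_fun \<Rightarrow> phase_fun" where
  "cut S f z = indicator S (fst z) * f z"

definition smass :: "phase_fun \<Rightarrow> (real^3) set \<Rightarrow> real" where
  "smass f S = enn2real (\<integral>\<^sup>+x. ennreal (rho f x) * indicator S x \<partial>lborel)"

lemma phase_cut:
  assumes "phase f" and "S \<in> sets borel"
  shows "phase (cut S f)"
proof -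
  have "(\<lambda>z. indicator S (fst z) :: real) \<in> borel_measurable (borel :: ((real^3) \<times> (real^3)) measure)"
    using assms(2) by (intro measurable_compose[OF measurable_fst_borel]) auto
  then show ?thesis unfolding phase_def cut_def[abs_def] using phaseD[OF assms(1)] by auto
qed

lemma rho_cut: "rho (cut S f) = (\<lambda>x. indicator S x * rho f x)"
  by (simp add: rho_def cut_def fun_eq_iff)

lemma smass_eq:
  assumes f: "f \<in> FM Q M"
  shows "ennreal (smass f S) = (\<integral>\<^sup>+x. ennreal (rho f x) * indicator S x \<partial>lborel)"
proof -
  have "(\<integral>\<^sup>+x. ennreal (rho f x) * indicator S x \<partial>lborel) \<le> (\<integral>\<^sup>+x. ennreal (rho f x) \<partial>lborel)"
    by (intro nn_integral_mono) (auto simp: indicator_def)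
  also have "\<dots> = ennreal M" using FM_D(1,2)[OF f] nn_integral_rho[of f] by simp
  finally have "(\<integral>\<^sup>+x. ennreal (rho f x) * indicator S x \<partial>lborel) < top" by (rule le_less_trans) simp
  then show ?thesis by (simp add: smass_def)
qed

lemma smass_nonneg: "0 \<le> smass f S"
  by (simp add: smass_def)

lemma smass_UNIV:
  assumes f: "f \<in> FM Q M"
  shows "smass f UNIV = M"
proof -
  have "ennreal (smass f UNIV) = ennreal M"
    unfolding smass_eq[OF f] using FM_D(1,2)[OF f] nn_integral_rho[of f] by simp
  then show ?thesis using FM_D(3)[OF f] smass_nonneg[of f UNIV] by simp
qed

lemma smass_Un:
  assumes f: "f \<in> FM Q M" and [measurable]: "S \<in> sets borel" "T \<in> sets borel" and "S \<inter> T = {}"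
  shows "smass f (S \<union> T) = smass f S + smass f T"
proof -
  note [measurable] = measurable_rho[OF phaseD(1)[OF FM_D(1)[OF f]]]
  have "ennreal (smass f (S \<union> T)) = (\<integral>\<^sup>+x. ennreal (rho f x) * indicator S x + ennreal (rho f x) * indicator T x \<partial>lborel)"
    unfolding smass_eq[OF f] using assms(4) by (intro nn_integral_cong) (auto simp: indicator_def)
  also have "\<dots> = ennreal (smass f S) + ennreal (smass f T)"
    unfolding smass_eq[OF f] by (rule nn_integral_add) measurable
  also have "\<dots> = ennreal (smass f S + smass f T)" by (simp add: smass_nonneg)
  finally show ?thesis using smass_nonneg[of f] by (subst (asm) ennreal_inj) auto
qed

lemma smass_mono:
  assumes f: "f \<in> FM Q M" and "S \<subseteq> T"
  shows "smass f S \<le> smass f T"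
proof -
  have "ennreal (smass f S) \<le> ennreal (smass f T)"
    unfolding smass_eq[OF f] using assms(2) by (intro nn_integral_mono) (auto simp: indicator_def)
  then show ?thesis by (simp add: smass_nonneg)
qed

context casimir
begin

text \<open>\<open>Q 0 = 0\<close>, so a cut-off function has no Casimir energy outside its set, and
  energies over disjoint sets add. Equality is replaced by an inequality because the two sets may
  leave a gap.\<close>

lemma Pfun_cut:
  assumes f: "phase f" and S: "S \<in> sets borel" "T \<in> sets borel" "S \<inter> T = {}"
  shows "Pfun Q (cut S f) + Pfun Q (cut T f) \<le> Pfun Q f"
proof -
  note pS = phase_cut[OF f S(1)] and pT = phase_cut[OF f S(2)]
  have Qm: "(\<lambda>z. Q (g z)) \<in> borel_measurable borel" if "phase g" for g
    using phaseD[OF that] by (intro measurable_Q_comp) auto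
  have "Cas Q (cut S f) + Cas Q (cut T f) = (\<integral>\<^sup>+z. ennreal (Q (cut S f z)) + ennreal (Q (cut T f z)) \<partial>lborel)"
    unfolding Cas_def using Qm[OF pS] Qm[OF pT] by (subst nn_integral_add) auto
  also have "\<dots> \<le> Cas Q f"
    unfolding Cas_def using S(3) by (intro nn_integral_mono) (auto simp: cut_def indicator_def Q_zero)
  finally have 1: "Cas Q (cut S f) + Cas Q (cut T f) \<le> Cas Q f" .
  have "Ekin (cut S f) + Ekin (cut T f) = (\<integral>\<^sup>+z. ennreal (norm (snd z) ^ 2 / 2 * cut S f z) + ennreal (norm (snd z) ^ 2 / 2 * cut T f z) \<partial>lborel)"
    unfolding Ekin_def using measurable_kinetic[OF phaseD(1)[OF pS]] measurable_kinetic[OF phaseD(1)[OF pT]]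
    by (subst nn_integral_add) auto
  also have "\<dots> \<le> Ekin f"
    unfolding Ekin_def using S(3) by (intro nn_integral_mono) (auto simp: cut_def indicator_def)
  finally have 2: "Ekin (cut S f) + Ekin (cut T f) \<le> Ekin f" .
  show ?thesis unfolding Pfun_def using add_mono[OF 1 2] by (simp add: add_ac)
qed

lemma cut_in_FM:
  assumes f: "f \<in> FM Q M" and S: "S \<in> sets borel"
  shows "cut S f \<in> FM Q (smass f S)"
proof -
  note F = FM_D[OF f]
  have p: "phase (cut S f)" by (rule phase_cut[OF F(1) S])
  show ?thesis
  proof (rule FM_I[OF p])
    have "(\<integral>\<^sup>+z. ennreal (cut S f z) \<partial>lborel) \<le> (\<integral>\<^sup>+z. ennreal (f z) \<partial>lborel)"
      using phaseD(2)[OF F(1)] by (intro nn_integral_mono ennreal_leI) (auto simp: cut_def indicator_def)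
    then have fin: "(\<integral>\<^sup>+z. ennreal (cut S f z) \<partial>lborel) < \<infinity>" using F(2) le_less_trans by fastforce
    have "(\<integral>\<^sup>+z. ennreal (cut S f z) \<partial>lborel) = (\<integral>\<^sup>+x. ennreal (rho f x) * indicator S x \<partial>lborel)"
      unfolding nn_integral_rho[OF p fin, symmetric] rho_cut by (intro nn_integral_cong) (auto simp: indicator_def)
    then show "(\<integral>\<^sup>+z. ennreal (cut S f z) \<partial>lborel) = ennreal (smass f S)" unfolding smass_eq[OF f] .
    have "Pfun Q (cut S f) \<le> Pfun Q f"
    proof -
      have "Pfun Q (cut S f) \<le> Pfun Q (cut S f) + Pfun Q (cut {} f)" by simp
      also have "\<dots> \<le> Pfun Q f" by (rule Pfun_cut[OF F(1) S]) auto
      finally show ?thesis .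
    qed
    then show "Pfun Q (cut S f) < \<infinity>" using F(7) by (rule le_less_trans)
  qed (rule smass_nonneg)
qed

text \<open>Inner ball and exterior are admissible for their own masses, and scaling compares each
  with \<open>hM Q M\<close>. The shell between them is dropped from the convex energy; in the field
  energy it appears, with the interaction across the gap, in the error term.\<close>

lemma HC_split_lower_bound:
  assumes f: "f \<in> FM Q M" and M: "0 < M" and d: "dens M A (rho f)" and r: "0 < r" and jJ: "j < J"
    and m1: "0 < smass f (ball 0 j)" and m3: "0 < smass f (- ball 0 J)"
  shows "((smass f (ball 0 j) / M) powr (1 + scal_exp) + (smass f (- ball 0 J) / M) powr (1 + scal_exp)) * hM Q M
      - (16 * shell_const * M\<^sup>2 / (J - j) + 2 * coul_const A M (smass f (ball 0 J - ball 0 j)) r) / (8 * pi) \<le> HC Q f"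
proof -
  let ?S1 = "ball (0::real^3) j" and ?S2 = "ball (0::real^3) J - ball 0 j" and ?S3 = "- ball (0::real^3) J"
  have sub: "?S1 \<subseteq> ball 0 J" using jJ by auto
  define p where "p S = (\<lambda>x. indicator S x * rho f x)" for S :: "(real^3) set"
  have rc: "rho (cut S f) = p S" for S by (simp add: rho_cut p_def)
  note F = FM_D[OF f]
  have dp: "dens M A (p S)" if "S \<in> sets borel" for S
    unfolding p_def using that rho_nonneg[OF F(1)] measurable_rho[OF phaseD(1)[OF F(1)]]
    by (intro dens_le[OF d]) (auto simp: indicator_def)
  have mS: "?S1 \<in> sets borel" "?S2 \<in> sets borel" "?S3 \<in> sets borel" by auto
  have scaled: "(smass f S / M) powr (1 + scal_exp) * hM Q M \<le> HC Q (cut S f)" if S: "S \<in> sets borel" and pos: "0 < smass f S" for S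
  proof -
    have le: "smass f S \<le> M" using smass_mono[OF f, of S UNIV] smass_UNIV[OF f] by simp
    have "hM Q M \<le> (M / smass f S) powr (1 + scal_exp) * HC Q (cut S f)"
      by (rule hM_le_scaled[OF pos le cut_in_FM[OF f S]])
    then have "(smass f S / M) powr (1 + scal_exp) * hM Q M \<le> (smass f S / M) powr (1 + scal_exp) * ((M / smass f S) powr (1 + scal_exp) * HC Q (cut S f))"
      by (intro mult_left_mono) auto
    also have "\<dots> = ((smass f S / M) * (M / smass f S)) powr (1 + scal_exp) * HC Q (cut S f)"
      using M pos by (subst powr_mult) auto
    also have "(smass f S / M) * (M / smass f S) = 1" using M pos by simp
    finally show ?thesis by simp
  qed
  have "ennreal (field_energy (rho f)) \<le> ennreal (field_energy (p ?S1)) + ennreal (field_energy (p ?S3))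
      + ennreal (16 * shell_const * M\<^sup>2 / (J - j) + 2 * coul_const A M (smass f ?S2) r)"
    unfolding ennreal_field_energy[OF d] ennreal_field_energy[OF dp[OF mS(1)]] ennreal_field_energy[OF dp[OF mS(3)]]
  proof (rule fld_split_le[OF d dp[OF mS(1)] dp[OF mS(2)] dp[OF mS(3)] _ _ smass_nonneg r])
    fix x show "rho f x = p ?S1 x + p ?S2 x + p ?S3 x" using sub by (auto simp: p_def indicator_def)
  next
    show "(\<integral>\<^sup>+x. ennreal (p ?S2 x) \<partial>lborel) \<le> ennreal (smass f ?S2)"
      unfolding smass_eq[OF f] by (intro nn_integral_mono) (auto simp: p_def indicator_def)
  next
    fix x y assume "p ?S1 x \<noteq> 0" "p ?S3 y \<noteq> 0"
    then have "norm x < j" "J \<le> norm y" by (auto simp: p_def indicator_def split: if_splits)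
    then show "J - j \<le> norm (x - y)" using norm_triangle_ineq2[of y x] by (simp add: norm_minus_commute)
  qed (use jJ in simp)
  also have "\<dots> = ennreal (field_energy (p ?S1) + field_energy (p ?S3) + (16 * shell_const * M\<^sup>2 / (J - j) + 2 * coul_const A M (smass f ?S2) r))"
    using M r jJ shell_const_pos smass_nonneg[of f ?S2] densD(4)[OF d] unfolding coul_const_def
    by (simp add: field_energy_nonneg ennreal_plus[symmetric] del: ennreal_plus)
  finally have fe: "field_energy (rho f) \<le> field_energy (p ?S1) + field_energy (p ?S3) + (16 * shell_const * M\<^sup>2 / (J - j) + 2 * coul_const A M (smass f ?S2) r)"
    using M r jJ shell_const_pos smass_nonneg[of f ?S2] densD(4)[OF d] unfolding coul_const_def
    by (subst (asm) ennreal_le_iff) (auto simp: field_energy_nonneg intro!: add_nonneg_nonneg)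
  have "Pfun Q (cut ?S1 f) + Pfun Q (cut ?S3 f) \<le> Pfun Q f"
    using sub by (intro Pfun_cut[OF F(1)]) auto
  then have "ennreal (enn2real (Pfun Q (cut ?S1 f))) + ennreal (enn2real (Pfun Q (cut ?S3 f))) \<le> ennreal (enn2real (Pfun Q f))"
    using FM_D(4)[OF cut_in_FM[OF f mS(1)]] FM_D(4)[OF cut_in_FM[OF f mS(3)]] F(4) by simp
  then have Ps: "enn2real (Pfun Q (cut ?S1 f)) + enn2real (Pfun Q (cut ?S3 f)) \<le> enn2real (Pfun Q f)"
    by (simp add: ennreal_plus[symmetric] del: ennreal_plus)
  have "(smass f ?S1 / M) powr (1 + scal_exp) * hM Q M + (smass f ?S3 / M) powr (1 + scal_exp) * hM Q M \<le> HC Q (cut ?S1 f) + HC Q (cut ?S3 f)"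
    using scaled[OF mS(1) m1] scaled[OF mS(3) m3] by (rule add_mono)
  also have "\<dots> = enn2real (Pfun Q (cut ?S1 f)) + enn2real (Pfun Q (cut ?S3 f)) - (field_energy (p ?S1) + field_energy (p ?S3)) / (8 * pi)"
    unfolding HC_eq rc by (simp add: add_divide_distrib)
  also have "\<dots> \<le> enn2real (Pfun Q f) - (field_energy (rho f) - (16 * shell_const * M\<^sup>2 / (J - j) + 2 * coul_const A M (smass f ?S2) r)) / (8 * pi)"
    using fe by (intro diff_mono Ps divide_right_mono) auto
  also have "\<dots> = HC Q f + (16 * shell_const * M\<^sup>2 / (J - j) + 2 * coul_const A M (smass f ?S2) r) / (8 * pi)"
    unfolding HC_eq by (simp add: diff_divide_distrib)
  finally show ?thesis by (simp add: distrib_right)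
qed

end

text \<open>Strict superadditivity of a power above 1; combined with the negativity of h_M it
  excludes a division of the mass.\<close>

lemma powr_add_lt_one:
  fixes t e :: real
  assumes "0 < t" "t < 1" "0 < e"
  shows "t powr (1 + e) + (1 - t) powr (1 + e) < 1"
proof -
  have *: "s powr (1 + e) < s" if "0 < s" "s < 1" for s :: real
  proof -
    have "s powr (1 + e) = s * s powr e" using that by (simp add: powr_add)
    also have "\<dots> < s * 1" using that assms using powr_less_mono2[of e s 1] by (intro mult_strict_left_mono) auto
    finally show ?thesis by simp
  qed
  show ?thesis using *[of t] *[of "1 - t"] assms by linarith
qed

section \<open>Tightness of the mass\<close>

context casimir
begin

text \<open>\<open>L\<close> is the mass that stays in bounded regions, and \<open>conc\<close>
  gives \<open>L > 0\<close>. If \<open>L < M\<close>, there are radii \<open>j < J\<close> whose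
  balls both carry nearly \<open>L\<close>: the shell is almost empty, while masses near
  \<open>L\<close> and \<open>M - L\<close> lie on its two sides. The splitting bound is passed to
  the limit in \<open>n\<close> at fixed \<open>k\<close>, then in \<open>k\<close>, and contradicts
  superadditivity.\<close>

lemma mass_tight:
  fixes g :: "nat \<Rightarrow> phase_fun" and mu :: "nat \<Rightarrow> real"
  assumes M: "0 < M" and g: "\<And>n. g n \<in> FM Q M" and d: "\<And>n. dens M A (rho (g n))"
    and lim: "(\<lambda>n. HC Q (g n)) \<longlonglongrightarrow> hM Q M"
    and d0: "0 < d0" and conc: "\<And>n. d0 \<le> smass (g n) (ball 0 (real R0))"
    and mu: "\<And>j. (\<lambda>n. smass (g n) (ball 0 (real j))) \<longlonglongrightarrow> mu j"
    and e: "0 < e"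
  shows "\<exists>j N. \<forall>n\<ge>N. smass (g n) (- ball 0 (real j)) < e"
proof -
  have mu_le: "mu j \<le> M" for j
    using mu[of j] smass_mono[OF g, of "ball 0 (real j)" UNIV] smass_UNIV[OF g] by (intro LIMSEQ_le_const2[OF mu[of j]]) auto
  have mu_mono: "mu i \<le> mu j" if "i \<le> j" for i j
    using that by (intro LIMSEQ_le[OF mu mu] exI allI impI smass_mono[OF g]) auto
  have inc: "incseq mu" using mu_mono by (auto simp: incseq_def)
  obtain L where L: "mu \<longlonglongrightarrow> L" "\<And>j. mu j \<le> L"
    using incseq_convergent[OF inc, of M] mu_le by auto
  have LM: "L \<le> M" using mu_le by (intro LIMSEQ_le_const2[OF L(1)]) auto
  have "d0 \<le> mu R0" using conc by (intro LIMSEQ_le_const[OF mu[of R0]]) auto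
  then have L0: "0 < L" using L(2)[of R0] d0 by linarith
  have compl: "smass (g n) (- ball 0 (real j)) = M - smass (g n) (ball 0 (real j))" for n j
  proof -
    have "smass (g n) (ball 0 (real j) \<union> - ball 0 (real j)) = smass (g n) (ball 0 (real j)) + smass (g n) (- ball 0 (real j))"
      by (rule smass_Un[OF g]) auto
    then show ?thesis using smass_UNIV[OF g, of n] by simp
  qed
  have "L = M"
  proof (rule ccontr)
    assume "L \<noteq> M"
    then have LM': "L < M" using LM by simp
    define h where "h = hM Q M"
    have h: "h < 0" unfolding h_def by (rule hM_neg[OF M])
    \<comment> \<open>The shell mass is at most \<open>2 * ep k\<close> and the splitting radius is
      \<open>1 / Suc k\<close>; the square makes their quotient, which enters
      \<open>coul_const\<close>, tend to 0.\<close>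
    define ep where "ep k = (1 / real (Suc k))\<^sup>2" for k :: nat
    define b where "b k = (((L + ep k) / M) powr (1 + scal_exp) + ((M - L + ep k) / M) powr (1 + scal_exp)) * h
        - (16 * shell_const * M\<^sup>2 / real (Suc k) + 2 * coul_const A M (2 * ep k) (1 / real (Suc k))) / (8 * pi)" for k
    have ep0: "0 < ep k" for k by (simp add: ep_def)
    have inv0: "(\<lambda>k. 1 / real (Suc k)) \<longlonglongrightarrow> 0" using LIMSEQ_inverse_real_of_nat by (simp add: inverse_eq_divide)
    have ep_lim: "ep \<longlonglongrightarrow> 0" unfolding ep_def[abs_def] using tendsto_power[OF inv0, of 2] by simp
    have coul_lim: "(\<lambda>k. coul_const A M (2 * ep k) (1 / real (Suc k))) \<longlonglongrightarrow> 0"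
    proof -
      have e: "2 * ep k * M / (1 / real (Suc k)) = 2 * M * (1 / real (Suc k))" for k
        by (simp add: ep_def power2_eq_square)
      have s: "(\<lambda>k. sqrt (1 / real (Suc k))) \<longlonglongrightarrow> 0" using tendsto_real_sqrt[OF inv0] by simp
      have "(\<lambda>k. 8 * shell_const * (sqrt (1 / real (Suc k)) * (A\<^sup>2 + shell_const * A) + 2 * M * (1 / real (Suc k))))
         \<longlonglongrightarrow> 8 * shell_const * (0 * (A\<^sup>2 + shell_const * A) + 2 * M * 0)"
        by (intro tendsto_intros s inv0)
      then show ?thesis unfolding coul_const_def e by simp
    qed
    have "b \<longlonglongrightarrow> (((L + 0) / M) powr (1 + scal_exp) + ((M - L + 0) / M) powr (1 + scal_exp)) * h - (16 * shell_const * M\<^sup>2 * 0 + 2 * 0) / (8 * pi)"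
    proof -
      have q: "16 * shell_const * M\<^sup>2 / real (Suc k) = 16 * shell_const * M\<^sup>2 * (1 / real (Suc k))" for k by simp
      show ?thesis unfolding b_def[abs_def] q
        using L0 LM' M by (intro tendsto_intros ep_lim coul_lim inv0) auto
    qed
    then have blim: "b \<longlonglongrightarrow> ((L / M) powr (1 + scal_exp) + ((M - L) / M) powr (1 + scal_exp)) * h" by simp
    have "\<forall>\<^sub>F k in sequentially. ep k < min L (M - L)"
      using ep_lim L0 LM' by (intro order_tendstoD(2)[OF ep_lim]) auto
    then have "\<forall>\<^sub>F k in sequentially. b k \<le> h"
    proof eventually_elim
      case (elim k)
      have ek: "ep k < L" "ep k < M - L" using elim by auto
      obtain j where j: "L - ep k < mu j"
        using order_tendstoD(1)[OF L(1), of "L - ep k"] ep0[of k] by (auto simp: eventually_sequentially)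
      \<comment> \<open>A gap of width \<open>Suc k\<close> makes the interaction across the shell
        of order \<open>1 / Suc k\<close>. The outer ball still has limit mass within
        \<open>ep k\<close> of \<open>L\<close>, because \<open>mu\<close> is increasing with limit
        \<open>L\<close>.\<close>
      define J where "J = j + Suc k"
      have muJ: "L - ep k < mu J" using j mu_mono[of j J] by (simp add: J_def)
      have ev1: "\<forall>\<^sub>F n in sequentially. L - ep k < smass (g n) (ball 0 (real j)) \<and> smass (g n) (ball 0 (real j)) < L + ep k"
        using order_tendstoD[OF mu[of j]] j L(2)[of j] ep0[of k] by (intro eventually_conj) auto
      have ev2: "\<forall>\<^sub>F n in sequentially. L - ep k < smass (g n) (ball 0 (real J)) \<and> smass (g n) (ball 0 (real J)) < L + ep k"
        using order_tendstoD[OF mu[of J]] muJ L(2)[of J] ep0[of k] by (intro eventually_conj) auto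
      have "\<forall>\<^sub>F n in sequentially. b k \<le> HC Q (g n)"
        using ev1 ev2
      proof eventually_elim
        case (elim n)
        let ?m1 = "smass (g n) (ball 0 (real j))" and ?mJ = "smass (g n) (ball 0 (real J))"
        have m3: "smass (g n) (- ball 0 (real J)) = M - ?mJ" by (rule compl)
        have "smass (g n) (ball 0 (real j) \<union> (ball 0 (real J) - ball 0 (real j))) = ?m1 + smass (g n) (ball 0 (real J) - ball 0 (real j))"
          by (rule smass_Un[OF g]) auto
        moreover have "ball 0 (real j) \<union> (ball 0 (real J) - ball 0 (real j)) = ball (0::real^3) (real J)"
          by (auto simp: J_def)
        ultimately have m2: "smass (g n) (ball 0 (real J) - ball 0 (real j)) = ?mJ - ?m1" by simp
        have m2': "?mJ - ?m1 \<le> 2 * ep k" using elim by linarith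
        have key: "((?m1 / M) powr (1 + scal_exp) + ((M - ?mJ) / M) powr (1 + scal_exp)) * h
           - (16 * shell_const * M\<^sup>2 / (real J - real j) + 2 * coul_const A M (?mJ - ?m1) (1 / real (Suc k))) / (8 * pi) \<le> HC Q (g n)"
          unfolding h_def m3[symmetric] m2[symmetric]
          using elim ek m3 by (intro HC_split_lower_bound[OF g M d]) (auto simp: J_def)
        have "(?m1 / M) powr (1 + scal_exp) + ((M - ?mJ) / M) powr (1 + scal_exp)
            \<le> ((L + ep k) / M) powr (1 + scal_exp) + ((M - L + ep k) / M) powr (1 + scal_exp)"
          using elim ek M scal_exp_pos smass_nonneg[of "g n" "ball 0 (real j)"]
          by (intro add_mono powr_mono2 divide_right_mono divide_nonneg_pos) auto
        then have 1: "(((L + ep k) / M) powr (1 + scal_exp) + ((M - L + ep k) / M) powr (1 + scal_exp)) * h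
            \<le> ((?m1 / M) powr (1 + scal_exp) + ((M - ?mJ) / M) powr (1 + scal_exp)) * h"
          using h by (intro mult_right_mono_neg) auto
        have "coul_const A M (?mJ - ?m1) (1 / real (Suc k)) \<le> coul_const A M (2 * ep k) (1 / real (Suc k))"
          unfolding coul_const_def using m2' M shell_const_pos
          by (intro mult_left_mono add_left_mono divide_right_mono mult_right_mono) auto
        then have 2: "(16 * shell_const * M\<^sup>2 / (real J - real j) + 2 * coul_const A M (?mJ - ?m1) (1 / real (Suc k))) / (8 * pi)
           \<le> (16 * shell_const * M\<^sup>2 / real (Suc k) + 2 * coul_const A M (2 * ep k) (1 / real (Suc k))) / (8 * pi)"
          by (intro divide_right_mono add_mono) (auto simp: J_def)
        show ?case unfolding b_def using key 1 2 by linarith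
      qed
      then show ?case unfolding h_def
        by (intro tendsto_lowerbound[OF lim]) auto
    qed
    then have "((L / M) powr (1 + scal_exp) + ((M - L) / M) powr (1 + scal_exp)) * h \<le> h"
      by (intro tendsto_upperbound[OF blim]) auto
    moreover have "(M - L) / M = 1 - L / M" using M by (simp add: field_simps)
    moreover have "(L / M) powr (1 + scal_exp) + (1 - L / M) powr (1 + scal_exp) < 1"
      using L0 LM' M scal_exp_pos by (intro powr_add_lt_one) auto
    ultimately show False
      using mult_strict_right_mono_neg[of "(L / M) powr (1 + scal_exp) + (1 - L / M) powr (1 + scal_exp)" 1 h] h by simp
  qed
  then obtain j where j: "M - e < mu j"
    using order_tendstoD(1)[OF L(1), of "M - e"] e by (auto simp: eventually_sequentially)
  have "\<forall>\<^sub>F n in sequentially. M - e < smass (g n) (ball 0 (real j))"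
    by (rule order_tendstoD(1)[OF mu j])
  then show ?thesis unfolding eventually_sequentially compl by (metis diff_less_eq less_diff_eq add.commute)
qed

end

section \<open>Compactness of the field\<close>

text \<open>The field kernel of a uniformly charged ball of radius \<open>r\<close>: it coincides
  with the Coulomb kernel outside the ball and is linear inside, hence bounded and
  Lipschitz.\<close>

definition tkern :: "real \<Rightarrow> real^3 \<Rightarrow> real^3" where
  "tkern r w = (1 / max r (norm w) ^ 3) *\<^sub>R w"

lemma norm_tkern_le:
  assumes r: "0 < r"
  shows "norm (tkern r w) \<le> 1 / r\<^sup>2"
proof -
  define m where "m = max r (norm w)"
  have m: "r \<le> m" "norm w \<le> m" "0 < m" using r by (auto simp: m_def)
  have "norm (tkern r w) = norm w / m ^ 3" using m by (simp add: tkern_def m_def)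
  also have "\<dots> \<le> m / m ^ 3" using m by (intro divide_right_mono) auto
  also have "\<dots> = 1 / m\<^sup>2" using m by (simp add: power2_eq_square power3_eq_cube)
  also have "\<dots> \<le> 1 / r\<^sup>2" using m r by (intro divide_left_mono power_mono) (auto intro!: mult_pos_pos)
  finally show ?thesis .
qed

text \<open>The difference splits into \<open>w - u\<close> with weight \<open>1 / m ^ 3\<close> and
  \<open>u\<close> with weight \<open>1 / m ^ 3 - 1 / n ^ 3\<close>. The latter has the factor
  \<open>n - m\<close> and, since \<open>norm u \<le> n\<close>, three terms bounded by
  \<open>1 / r ^ 3\<close>; with the first one this makes 4.\<close>

lemma tkern_lipschitz:
  assumes r: "0 < r"
  shows "norm (tkern r w - tkern r u) \<le> 4 / r ^ 3 * norm (w - u)"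
proof -
  define m n where "m = max r (norm w)" and "n = max r (norm u)"
  have m: "r \<le> m" "0 < m" and n: "r \<le> n" "0 < n" "norm u \<le> n" using r by (auto simp: m_def n_def)
  define D where "D = norm (w - u)"
  have D: "0 \<le> D" by (simp add: D_def)
  have "\<bar>norm w - norm u\<bar> \<le> D" unfolding D_def by (rule norm_triangle_ineq3)
  then have mn: "\<bar>n - m\<bar> \<le> D" unfolding m_def n_def by linarith
  have inv: "1 / m \<le> 1 / r" "1 / n \<le> 1 / r" using m n r by (auto intro!: divide_left_mono mult_pos_pos)
  have i3: "a * b * c \<le> d * d * d" if "a \<le> d" "b \<le> d" "c \<le> d" "0 \<le> a" "0 \<le> b" "0 \<le> c" for a b c d :: real
    using that by (intro mult_mono) auto
  have inv3: "1 / m * (1 / m) * (1 / m) \<le> 1 / r * (1 / r) * (1 / r)" "1 / m * (1 / m) * (1 / n) \<le> 1 / r * (1 / r) * (1 / r)"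
     "1 / m * (1 / n) * (1 / n) \<le> 1 / r * (1 / r) * (1 / r)"
    using i3[OF inv(1) inv(1) inv(1)] i3[OF inv(1) inv(1) inv(2)] i3[OF inv(1) inv(2) inv(2)] m n by simp_all
  have "tkern r w - tkern r u = (1 / m ^ 3) *\<^sub>R (w - u) + (1 / m ^ 3 - 1 / n ^ 3) *\<^sub>R u"
    by (simp add: tkern_def m_def n_def algebra_simps)
  then have "norm (tkern r w - tkern r u) \<le> norm ((1 / m ^ 3) *\<^sub>R (w - u)) + norm ((1 / m ^ 3 - 1 / n ^ 3) *\<^sub>R u)"
    by (simp only: norm_triangle_ineq)
  also have "\<dots> \<le> 1 / m ^ 3 * D + \<bar>1 / m ^ 3 - 1 / n ^ 3\<bar> * n"
    using m n by (auto simp: D_def intro!: add_mono mult_left_mono)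
  also have "\<bar>1 / m ^ 3 - 1 / n ^ 3\<bar> * n = \<bar>n - m\<bar> * (1 / m * (1 / m) * (1 / m) + 1 / m * (1 / m) * (1 / n) + 1 / m * (1 / n) * (1 / n))"
  proof -
    have e: "1 / m ^ 3 - 1 / n ^ 3 = (n - m) * (n\<^sup>2 + m * n + m\<^sup>2) / (m ^ 3 * n ^ 3)"
      using m n by (simp add: field_simps power2_eq_square power3_eq_cube)
    have "\<bar>1 / m ^ 3 - 1 / n ^ 3\<bar> = \<bar>n - m\<bar> * (n\<^sup>2 + m * n + m\<^sup>2) / (m ^ 3 * n ^ 3)"
      unfolding e using m n by (simp add: abs_mult)
    then have "\<bar>1 / m ^ 3 - 1 / n ^ 3\<bar> * n = \<bar>n - m\<bar> * ((n\<^sup>2 + m * n + m\<^sup>2) / (m ^ 3 * n ^ 3) * n)" by simp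
    also have "(n\<^sup>2 + m * n + m\<^sup>2) / (m ^ 3 * n ^ 3) * n = 1 / m * (1 / m) * (1 / m) + 1 / m * (1 / m) * (1 / n) + 1 / m * (1 / n) * (1 / n)"
      using m n by (simp add: field_simps power2_eq_square power3_eq_cube)
    finally show ?thesis .
  qed
  also have "1 / m ^ 3 * D + \<dots> \<le> (1 / r * (1 / r) * (1 / r)) * D + D * ((1 / r * (1 / r) * (1 / r)) + (1 / r * (1 / r) * (1 / r)) + (1 / r * (1 / r) * (1 / r)))"
  proof -
    have gen: "a * D + X * (a + b + c) \<le> Z * D + D * (Z + Z + Z)"
      if "a \<le> Z" "b \<le> Z" "c \<le> Z" "0 \<le> a" "0 \<le> b" "0 \<le> c" "0 \<le> X" "X \<le> D" for a b c X Z :: real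
      using that D by (intro add_mono mult_mono) auto
    have "1 / m ^ 3 = 1 / m * (1 / m) * (1 / m)" by (simp add: power3_eq_cube)
    then show ?thesis using gen[OF inv3 _ _ _ _ mn] m n by (simp only:) auto
  qed
  also have "\<dots> = 4 / r ^ 3 * D" by (simp add: power3_eq_cube field_simps)
  finally show ?thesis unfolding D_def .
qed

lemma tkern_diff_le:
  assumes r: "0 < r"
  shows "norm ((1 / norm w ^ 3) *\<^sub>R w - tkern r w) \<le> indicator (ball 0 r) w / norm w ^ 2"
proof (cases "norm w < r \<and> w \<noteq> 0")
  case True
  have "1 / r ^ 3 \<le> 1 / norm w ^ 3" using True r by (intro divide_left_mono power_mono) auto
  then have "norm ((1 / norm w ^ 3) *\<^sub>R w - tkern r w) = (1 / norm w ^ 3 - 1 / r ^ 3) * norm w"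
    using True by (simp add: tkern_def scaleR_left_diff_distrib[symmetric])
  also have "\<dots> \<le> 1 / norm w ^ 3 * norm w" using r by (intro mult_right_mono) auto
  also have "\<dots> = 1 / norm w ^ 2" using True by (simp add: power2_eq_square power3_eq_cube)
  finally show ?thesis using True by simp
next
  case False
  then show ?thesis by (auto simp: tkern_def max_def)
qed

lemma measurable_tkern [measurable]: "tkern r \<in> borel_measurable borel"
  unfolding tkern_def[abs_def] by measurable

section \<open>Regularised fields and their compactness\<close>

definition tfld :: "real \<Rightarrow> (real^3 \<Rightarrow> real) \<Rightarrow> real^3 \<Rightarrow> real^3" where
  "tfld r p x = (\<integral>y. p y *\<^sub>R tkern r (x - y) \<partial>lborel)"

lemma dens_integrable:
  assumes "dens M A p"
  shows "integrable lborel p" "(\<integral>x. p x \<partial>lborel) \<le> M"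
proof -
  note p = densD[OF assms]
  have m: "p \<in> borel_measurable lborel" using p(1) by simp
  show i: "integrable lborel p"
    using p le_less_trans[OF p(5) ennreal_less_top] m by (intro integrableI_nonneg) auto
  have "ennreal (\<integral>x. p x \<partial>lborel) \<le> ennreal M"
    using nn_integral_eq_integral[OF i] p by simp
  then show "(\<integral>x. p x \<partial>lborel) \<le> M" using p by simp
qed

lemma integrable_tkern:
  assumes p: "dens M A p" and r: "0 < r"
  shows "integrable lborel (\<lambda>y. p y *\<^sub>R tkern r (x - y))"
proof (rule Bochner_Integration.integrable_bound)
  note [measurable] = densD(1)[OF p]
  show "integrable lborel (\<lambda>y. p y * (1 / r\<^sup>2))" using dens_integrable[OF p] by simp
  show "(\<lambda>y. p y *\<^sub>R tkern r (x - y)) \<in> borel_measurable lborel" by measurable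
  show "AE y in lborel. norm (p y *\<^sub>R tkern r (x - y)) \<le> norm (p y * (1 / r\<^sup>2))"
    using norm_tkern_le[OF r] by (intro AE_I2) (simp add: abs_mult mult_left_mono del: times_divide_eq_right)
qed

lemma norm_tfld_le:
  assumes p: "dens M A p" and r: "0 < r"
  shows "norm (tfld r p x) \<le> M / r\<^sup>2"
proof -
  have "norm (tfld r p x) \<le> (\<integral>y. norm (p y *\<^sub>R tkern r (x - y)) \<partial>lborel)"
    unfolding tfld_def by (rule integral_norm_bound)
  also have "\<dots> \<le> (\<integral>y. p y * (1 / r\<^sup>2) \<partial>lborel)"
  proof (rule integral_mono)
    show "integrable lborel (\<lambda>y. norm (p y *\<^sub>R tkern r (x - y)))" by (intro integrable_norm integrable_tkern[OF p r])
    show "integrable lborel (\<lambda>y. p y * (1 / r\<^sup>2))" using dens_integrable[OF p] by simp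
    fix y
    show "norm (p y *\<^sub>R tkern r (x - y)) \<le> p y * (1 / r\<^sup>2)"
      using densD(2)[OF p, of y] norm_tkern_le[OF r, of "x - y"] mult_left_mono[OF norm_tkern_le[OF r, of "x - y"] densD(2)[OF p, of y]] by simp
  qed
  also have "\<dots> = (\<integral>y. p y \<partial>lborel) * (1 / r\<^sup>2)" by simp
  also have "\<dots> \<le> M * (1 / r\<^sup>2)" using dens_integrable(2)[OF p] by (intro mult_right_mono) auto
  finally show ?thesis by simp
qed

lemma tfld_lipschitz:
  assumes p: "dens M A p" and r: "0 < r"
  shows "norm (tfld r p x - tfld r p x') \<le> M * (4 / r ^ 3 * norm (x - x'))"
proof -
  have "tfld r p x - tfld r p x' = (\<integral>y. p y *\<^sub>R tkern r (x - y) - p y *\<^sub>R tkern r (x' - y) \<partial>lborel)"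
    unfolding tfld_def using integrable_tkern[OF p r] by (intro Bochner_Integration.integral_diff[symmetric])
  also have "norm \<dots> \<le> (\<integral>y. norm (p y *\<^sub>R tkern r (x - y) - p y *\<^sub>R tkern r (x' - y)) \<partial>lborel)"
    by (rule integral_norm_bound)
  also have "\<dots> \<le> (\<integral>y. p y * (4 / r ^ 3 * norm (x - x')) \<partial>lborel)"
  proof (rule integral_mono)
    show "integrable lborel (\<lambda>y. norm (p y *\<^sub>R tkern r (x - y) - p y *\<^sub>R tkern r (x' - y)))"
      using integrable_tkern[OF p r] by (intro integrable_norm Bochner_Integration.integrable_diff)
    show "integrable lborel (\<lambda>y. p y * (4 / r ^ 3 * norm (x - x')))" using dens_integrable[OF p] by (intro integrable_mult_left)
    fix y
    have "norm (p y *\<^sub>R tkern r (x - y) - p y *\<^sub>R tkern r (x' - y)) = p y * norm (tkern r (x - y) - tkern r (x' - y))"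
      using densD(2)[OF p] by (simp add: scaleR_right_diff_distrib[symmetric])
    also have "\<dots> \<le> p y * (4 / r ^ 3 * norm ((x - y) - (x' - y)))"
      by (intro mult_left_mono tkern_lipschitz r densD(2)[OF p])
    finally show "norm (p y *\<^sub>R tkern r (x - y) - p y *\<^sub>R tkern r (x' - y)) \<le> p y * (4 / r ^ 3 * norm (x - x'))" by simp
  qed
  also have "\<dots> = (\<integral>y. p y \<partial>lborel) * (4 / r ^ 3 * norm (x - x'))" by (rule integral_mult_left_zero)
  also have "\<dots> \<le> M * (4 / r ^ 3 * norm (x - x'))" using dens_integrable(2)[OF p] r by (intro mult_right_mono) auto
  finally show ?thesis .
qed

text \<open>The two kernels differ only inside the ball of radius \<open>r\<close>, and there by at
  most \<open>1 / norm w ^ 2\<close>. The error is thus the local Riesz potential, small in L^2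
  uniformly over densities with the same \<open>A\<close>.\<close>

lemma AE_fld_tfld:
  assumes p: "dens M A p" and r: "0 < r"
  shows "AE x in lborel. ennreal (norm (fld p x - tfld r p x)) \<le> riesz (ball 0 r) (\<lambda>x. ennreal (p x)) x"
  using AE_riesz_finite[OF p]
proof eventually_elim
  case (elim x)
  note [measurable] = densD(1)[OF p]
  let ?D = "\<lambda>y. (p y / norm (x - y) ^ 3) *\<^sub>R (x - y) - p y *\<^sub>R tkern r (x - y)"
  have i: "integrable lborel ?D"
    by (intro Bochner_Integration.integrable_diff integrable_coulomb_kernel integrable_tkern[OF p r]) (use elim in auto)
  have "fld p x - tfld r p x = (\<integral>y. ?D y \<partial>lborel)"
    unfolding fld_def tfld_def
    by (intro Bochner_Integration.integral_diff[symmetric] integrable_coulomb_kernel integrable_tkern[OF p r]) (use elim in auto)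
  then have "ennreal (norm (fld p x - tfld r p x)) \<le> (\<integral>\<^sup>+y. ennreal (norm (?D y)) \<partial>lborel)"
    using integral_norm_bound_ennreal[OF i] by simp
  also have "\<dots> \<le> riesz (ball 0 r) (\<lambda>x. ennreal (p x)) x"
    unfolding riesz_def
  proof (rule nn_integral_mono)
    fix y
    have "?D y = p y *\<^sub>R ((1 / norm (x - y) ^ 3) *\<^sub>R (x - y) - tkern r (x - y))" by (simp add: scaleR_right_diff_distrib)
    then have "norm (?D y) = p y * norm ((1 / norm (x - y) ^ 3) *\<^sub>R (x - y) - tkern r (x - y))"
      using densD(2)[OF p, of y] by simp
    also have "\<dots> \<le> p y * (indicator (ball 0 r) (x - y) / norm (x - y) ^ 2)"
      by (intro mult_left_mono tkern_diff_le r densD(2)[OF p])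
    finally have "ennreal (norm (?D y)) \<le> ennreal (p y * (indicator (ball 0 r) (x - y) / norm (x - y) ^ 2))" by (rule ennreal_leI)
    also have "\<dots> = ennreal (p y) * (indicator (ball 0 r) (x - y) * ennreal (1 / norm (x - y) ^ 2))"
      using densD(2)[OF p, of y] by (auto simp: ennreal_mult[symmetric] indicator_def)
    finally show "ennreal (norm (?D y)) \<le> ennreal (p y) * (indicator (ball 0 r) (x - y) * ennreal (1 / norm (x - y) ^ 2))" .
  qed
  finally show ?case .
qed

text \<open>At fixed scale the regularised fields are uniformly bounded and equi-Lipschitz, so
  Arzela-Ascoli applies on each ball. A single index \<open>k\<close> couples the scale
  \<open>1 / Suc k\<close> with the radius \<open>Suc k\<close>, and a diagonal sequence handles all
  \<open>k\<close>. The conclusion is a Cauchy property, so limits for different \<open>k\<close>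
  need not be compared.\<close>

lemma tfld_subseq:
  fixes p :: "nat \<Rightarrow> real^3 \<Rightarrow> real"
  assumes p: "\<And>n. dens M A (p n)"
  shows "\<exists>s. strict_mono (s::nat \<Rightarrow> nat) \<and> (\<forall>k e. 0 < e \<longrightarrow> (\<exists>N. \<forall>m\<ge>N. \<forall>n\<ge>N. \<forall>x\<in>cball 0 (real (Suc k)).
     norm (tfld (1 / real (Suc k)) (p (s m)) x - tfld (1 / real (Suc k)) (p (s n)) x) < e))"
proof -
  define P where "P k s \<longleftrightarrow> (\<forall>e>0. \<exists>N. \<forall>m\<ge>N. \<forall>n\<ge>N. \<forall>x\<in>cball 0 (real (Suc k)).
     norm (tfld (1 / real (Suc k)) (p (s m)) x - tfld (1 / real (Suc k)) (p (s n)) x) < e)" for k and s :: "nat \<Rightarrow> nat"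
  have M0: "0 \<le> M" using densD(3)[OF p] .
  have "\<exists>r'. strict_mono r' \<and> P k (s \<circ> r')" for k and s :: "nat \<Rightarrow> nat"
  proof -
    define r where "r = 1 / real (Suc k)"
    have r: "0 < r" by (simp add: r_def)
    define S where "S = cball (0::real^3) (real (Suc k))"
    have S: "compact S" by (simp add: S_def)
    define c where "c = M * (4 / r ^ 3) + 1"
    have c: "0 < c" using M0 r by (auto simp: c_def intro!: add_nonneg_pos)
    have eq: "\<exists>d. 0 < d \<and> (\<forall>n y. y \<in> S \<and> norm (x - y) < d \<longrightarrow> norm (tfld r (p (s n)) x - tfld r (p (s n)) y) < e)"
      if "0 < e" for x e
    proof (intro exI[of _ "e / c"] conjI allI impI)
      show "0 < e / c" using that c by simp
      fix n y assume y: "y \<in> S \<and> norm (x - y) < e / c"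
      have "norm (tfld r (p (s n)) x - tfld r (p (s n)) y) \<le> M * (4 / r ^ 3 * norm (x - y))"
        by (rule tfld_lipschitz[OF p r])
      also have "\<dots> \<le> c * norm (x - y)" by (simp only: c_def distrib_right mult.assoc) simp
      also have "\<dots> < e" using y c by (simp add: field_simps)
      finally show "norm (tfld r (p (s n)) x - tfld r (p (s n)) y) < e" .
    qed
    obtain g :: "real^3 \<Rightarrow> real^3" and k' :: "nat \<Rightarrow> nat" where k': "strict_mono k'"
      and conv: "\<And>e. 0 < e \<Longrightarrow> \<exists>N. \<forall>n x. n \<ge> N \<and> x \<in> S \<longrightarrow> norm (tfld r (p (s (k' n))) x - g x) < e"
      using Arzela_Ascoli[of S "\<lambda>n. tfld r (p (s n))" "M / r\<^sup>2", OF S norm_tfld_le[OF p r] eq] by metis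
    have "P k (s \<circ> k')"
      unfolding P_def
    proof (intro allI impI)
      fix e :: real assume "0 < e"
      then obtain N where N: "\<And>n x. n \<ge> N \<Longrightarrow> x \<in> S \<Longrightarrow> norm (tfld r (p (s (k' n))) x - g x) < e / 2"
        using conv[of "e / 2"] by auto
      show "\<exists>N. \<forall>m\<ge>N. \<forall>n\<ge>N. \<forall>x\<in>cball 0 (real (Suc k)). norm (tfld (1 / real (Suc k)) (p ((s \<circ> k') m)) x - tfld (1 / real (Suc k)) (p ((s \<circ> k') n)) x) < e"
      proof (intro exI[of _ N] allI impI ballI)
        fix m n and x :: "real^3" assume mn: "N \<le> m" "N \<le> n" and x: "x \<in> cball 0 (real (Suc k))"
        have "norm (tfld r (p (s (k' m))) x - tfld r (p (s (k' n))) x) < e"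
          using N[OF mn(1), of x] N[OF mn(2), of x] x unfolding S_def[symmetric]
          using norm_triangle_ineq4[of "tfld r (p (s (k' m))) x - g x" "tfld r (p (s (k' n))) x - g x"] by simp
        then show "norm (tfld (1 / real (Suc k)) (p ((s \<circ> k') m)) x - tfld (1 / real (Suc k)) (p ((s \<circ> k') n)) x) < e"
          by (simp add: r_def)
      qed
    qed
    then show ?thesis using k' by blast
  qed
  then interpret subseqs P by unfold_locales
  have diag: "P k (diagseq \<circ> (+) (Suc k))" for k
  proof (rule diagseq_holds)
    fix r s :: "nat \<Rightarrow> nat" and n assume r: "strict_mono r" and s: "P n s"
    show "P n (s \<circ> r)" unfolding P_def
    proof (intro allI impI)
      fix e :: real assume "0 < e"
      then obtain N where N: "\<forall>m\<ge>N. \<forall>k\<ge>N. \<forall>x\<in>cball 0 (real (Suc n)). norm (tfld (1 / real (Suc n)) (p (s m)) x - tfld (1 / real (Suc n)) (p (s k)) x) < e"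
        using s unfolding P_def by blast
      then show "\<exists>N. \<forall>m\<ge>N. \<forall>k\<ge>N. \<forall>x\<in>cball 0 (real (Suc n)). norm (tfld (1 / real (Suc n)) (p ((s \<circ> r) m)) x - tfld (1 / real (Suc n)) (p ((s \<circ> r) k)) x) < e"
        using seq_suble[OF r] by (intro exI[of _ N]) (auto intro: order_trans)
    qed
  qed
  \<comment> \<open>The diagonal sequence is a subsequence of the \<open>k\<close>-th one only after
    its first \<open>Suc k\<close> terms; a Cauchy property ignores them.\<close>
  have Pd: "P k diagseq" for k
  proof -
    show ?thesis
    proof (rule iffD2[OF P_def], intro allI impI)
      fix e :: real assume "0 < e"
      then obtain N where N: "\<forall>m\<ge>N. \<forall>n\<ge>N. \<forall>x\<in>cball 0 (real (Suc k)). norm (tfld (1 / real (Suc k)) (p (diagseq (Suc k + m))) x - tfld (1 / real (Suc k)) (p (diagseq (Suc k + n))) x) < e"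
        using iffD1[OF P_def diag[of k]] unfolding o_def by blast
      show "\<exists>N. \<forall>m\<ge>N. \<forall>n\<ge>N. \<forall>x\<in>cball 0 (real (Suc k)). norm (tfld (1 / real (Suc k)) (p (diagseq m)) x - tfld (1 / real (Suc k)) (p (diagseq n)) x) < e"
      proof (intro exI[of _ "N + Suc k"] allI impI ballI)
        fix m n and x :: "real^3" assume "N + Suc k \<le> m" "N + Suc k \<le> n" "x \<in> cball 0 (real (Suc k))"
        then show "norm (tfld (1 / real (Suc k)) (p (diagseq m)) x - tfld (1 / real (Suc k)) (p (diagseq n)) x) < e"
          using N[rule_format, of "m - Suc k" "n - Suc k" x] by simp
      qed
    qed
  qed
  have "\<exists>s. strict_mono s \<and> (\<forall>k. P k s)" using subseq_diagseq Pd by blast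
  then show ?thesis unfolding P_def by blast
qed

text \<open>Masses and radius shrink at the same rate, so the far term \<open>m * M / r\<close>
  still tends to 0. The case \<open>c = 0\<close> covers the purely local bound.\<close>

lemma coul_const_small:
  assumes e: "0 < e" and c': "0 < c'"
  shows "\<exists>k0. \<forall>k\<ge>k0. coul_const A (c / real (Suc k)) (c / real (Suc k)) (c' / real (Suc k)) < e"
proof -
  have inv0: "(\<lambda>k. 1 / real (Suc k)) \<longlonglongrightarrow> 0" using LIMSEQ_inverse_real_of_nat by (simp add: inverse_eq_divide)
  have s: "(\<lambda>k. sqrt (c' * (1 / real (Suc k)))) \<longlonglongrightarrow> sqrt (c' * 0)" by (intro tendsto_intros inv0)
  have eq: "coul_const A (c / real (Suc k)) (c / real (Suc k)) (c' / real (Suc k))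
     = 8 * shell_const * (sqrt (c' * (1 / real (Suc k))) * (A\<^sup>2 + shell_const * A) + (c * c / c') * (1 / real (Suc k)))" for k
  proof -
    have "c / S * (c / S) / (c' / S) = (c * c / c') * (1 / S)" if "0 < S" for S :: real
      using that c' by (simp add: field_simps)
    from this[of "real (Suc k)"] show ?thesis unfolding coul_const_def by simp
  qed
  have "(\<lambda>k. 8 * shell_const * (sqrt (c' * (1 / real (Suc k))) * (A\<^sup>2 + shell_const * A) + (c * c / c') * (1 / real (Suc k))))
     \<longlonglongrightarrow> 8 * shell_const * (sqrt (c' * 0) * (A\<^sup>2 + shell_const * A) + (c * c / c') * 0)"
    by (intro tendsto_intros s inv0)
  then have "(\<lambda>k. coul_const A (c / real (Suc k)) (c / real (Suc k)) (c' / real (Suc k))) \<longlonglongrightarrow> 0" unfolding eq by simp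
  from order_tendstoD(2)[OF this e] show ?thesis unfolding eventually_sequentially .
qed

text \<open>Outside radius \<open>S\<close>, sources in the half ball are at distance at least
  \<open>norm x / 2\<close>, so the potential is at most \<open>4 * M / norm x ^ 2\<close>, whose
  square is integrable at infinity.\<close>

lemma riesz_tail_le:
  assumes p: "dens M A p" and S: "0 < S" and [measurable]: "B \<in> sets borel" and B: "B \<subseteq> ball 0 (S / 2)"
  shows "(\<integral>\<^sup>+x. indicator (- ball 0 S) x * riesz UNIV (\<lambda>y. ennreal (p y) * indicator B y) x ^ 2 \<partial>lborel) \<le> ennreal (16 * M\<^sup>2 * shell_const / S)"
proof -
  note [measurable] = densD(1)[OF p]
  have "(\<integral>\<^sup>+x. indicator (- ball 0 S) x * riesz UNIV (\<lambda>y. ennreal (p y) * indicator B y) x ^ 2 \<partial>lborel)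
     \<le> (\<integral>\<^sup>+(x::real^3). ennreal (16 * M\<^sup>2) * ennreal (indicator (- ball 0 S) x / norm x ^ 4) \<partial>lborel)"
  proof (rule nn_integral_mono)
    fix x :: "real^3"
    show "indicator (- ball 0 S) x * riesz UNIV (\<lambda>y. ennreal (p y) * indicator B y) x ^ 2 \<le> ennreal (16 * M\<^sup>2) * ennreal (indicator (- ball 0 S) x / norm x ^ 4)"
    proof (cases "norm x < S")
      case False
      have "riesz UNIV (\<lambda>y. ennreal (p y) * indicator B y) x \<le> (\<integral>\<^sup>+y. ennreal (p y) * ennreal (4 / norm x ^ 2) \<partial>lborel)"
        unfolding riesz_def
      proof (rule nn_integral_mono)
        fix y
        show "ennreal (p y) * indicator B y * (indicator UNIV (x - y) * ennreal (1 / norm (x - y) ^ 2)) \<le> ennreal (p y) * ennreal (4 / norm x ^ 2)"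
        proof (cases "y \<in> B")
          case True
          then have "norm y < S / 2" using B by auto
          then have "norm x / 2 \<le> norm (x - y)" using False norm_triangle_ineq2[of x y] by simp
          then have "(norm x / 2)\<^sup>2 \<le> norm (x - y) ^ 2" by (intro power_mono) auto
          then have "1 / norm (x - y) ^ 2 \<le> 1 / (norm x / 2)\<^sup>2"
            using False S \<open>norm x / 2 \<le> norm (x - y)\<close> by (intro divide_left_mono mult_pos_pos zero_less_power) auto
          also have "\<dots> = 4 / norm x ^ 2" by (simp add: power_divide)
          finally show ?thesis using True by (auto intro!: mult_left_mono ennreal_leI)
        qed simp
      qed
      also have "\<dots> = (\<integral>\<^sup>+y. ennreal (p y) \<partial>lborel) * ennreal (4 / norm x ^ 2)" by (rule nn_integral_multc) measurable
      also have "\<dots> \<le> ennreal M * ennreal (4 / norm x ^ 2)" by (intro mult_right_mono densD(5)[OF p]) simp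
      also have "\<dots> = ennreal (M * (4 / norm x ^ 2))" using densD(3)[OF p] by (simp only: ennreal_mult')
      finally have "riesz UNIV (\<lambda>y. ennreal (p y) * indicator B y) x ^ 2 \<le> ennreal (M * (4 / norm x ^ 2)) ^ 2" by (rule power_mono) simp
      also have "\<dots> = ennreal ((M * (4 / norm x ^ 2))\<^sup>2)" using densD(3)[OF p] by (intro ennreal_power) simp
      also have "(M * (4 / norm x ^ 2))\<^sup>2 = (16 * M\<^sup>2) * (1 / norm x ^ 4)" by (simp add: power_mult_distrib power_divide power_mult[symmetric])
      finally show ?thesis using False by (simp add: ennreal_mult[symmetric])
    qed simp
  qed
  also have "\<dots> = ennreal (16 * M\<^sup>2) * (\<integral>\<^sup>+(x::real^3). ennreal (indicator (- ball 0 S) x / norm x ^ 4) \<partial>lborel)"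
    by (rule nn_integral_cmult) measurable
  also have "\<dots> \<le> ennreal (16 * M\<^sup>2) * ennreal (shell_const / S)"
    by (intro mult_left_mono nn_integral_inverse_fourth_outside S) simp
  also have "\<dots> = ennreal (16 * M\<^sup>2 * shell_const / S)" using S shell_const_pos by (simp add: ennreal_mult[symmetric])
  finally show ?thesis .
qed

lemma ennreal_add_square_le: "(a + b) ^ 2 \<le> 2 * a ^ 2 + 2 * (b ^ 2)" for a b :: ennreal
proof (cases "a = top \<or> b = top")
  case True
  then show ?thesis by (auto simp: power2_eq_square ennreal_mult_top)
next
  case False
  then obtain x y where xy: "a = ennreal x" "b = ennreal y" "0 \<le> x" "0 \<le> y" by (metis ennreal_cases)
  have "(x + y)\<^sup>2 \<le> 2 * x\<^sup>2 + 2 * y\<^sup>2" using sum_squares_bound[of x y] by (simp add: power2_sum)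
  then have "ennreal ((x + y)\<^sup>2) \<le> ennreal (2 * x\<^sup>2 + 2 * y\<^sup>2)" by (rule ennreal_leI)
  moreover have "ennreal ((x + y)\<^sup>2) = (a + b) ^ 2"
    using xy by (simp add: ennreal_power[symmetric])
  moreover have "ennreal (2 * x\<^sup>2 + 2 * y\<^sup>2) = 2 * a ^ 2 + 2 * (b ^ 2)"
    unfolding xy(1,2) ennreal_power[OF xy(3)] ennreal_power[OF xy(4)] using xy(3,4)
    by (simp add: ennreal_mult)
  ultimately show ?thesis by simp
qed

text \<open>Inside a large ball the field is its regularisation plus a local error, and the
  regularisations converge uniformly. Outside that ball the sources near the origin leave only a
  decaying tail. The remaining sources have small mass by tightness, hence a small field
  everywhere.\<close>

lemma fld_cauchy:
  fixes p :: "nat \<Rightarrow> real^3 \<Rightarrow> real"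
  assumes p: "\<And>n. dens M A (p n)"
    and tight: "\<And>e. 0 < e \<Longrightarrow> \<exists>j N. \<forall>n\<ge>N. (\<integral>\<^sup>+x. ennreal (p n x) * indicator (- ball 0 (real j)) x \<partial>lborel) \<le> ennreal e"
    and unif: "\<And>k e. 0 < e \<Longrightarrow> \<exists>N. \<forall>m\<ge>N. \<forall>n\<ge>N. \<forall>x\<in>cball 0 (real (Suc k)).
     norm (tfld (1 / real (Suc k)) (p m) x - tfld (1 / real (Suc k)) (p n) x) < e"
    and e: "0 < e"
  shows "\<exists>N. \<forall>m\<ge>N. \<forall>n\<ge>N. (\<integral>\<^sup>+x. ennreal (norm (fld (p m) x - fld (p n) x) ^ 2) \<partial>lborel) \<le> ennreal e"
proof -
  note [measurable] = densD(1)[OF p]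
  \<comment> \<open>Each of the two indices costs \<open>12 * e0 = e / 4\<close>, and the
    regularised fields add another \<open>e / 4\<close>.\<close>
  define e0 where "e0 = e / 48"
  have e0: "0 < e0" using e by (simp add: e0_def)
  obtain k0 where k0: "coul_const A (1 / real (Suc k0)) (1 / real (Suc k0)) (1 / real (Suc k0)) < e0"
    using coul_const_small[OF e0, of 1 A 1] by auto
  define d where "d = 1 / real (Suc k0)"
  have d: "0 < d" "coul_const A d d d < e0" using k0 by (auto simp: d_def)
  obtain j N1 where jN: "\<And>n. N1 \<le> n \<Longrightarrow> (\<integral>\<^sup>+x. ennreal (p n x) * indicator (- ball 0 (real j)) x \<partial>lborel) \<le> ennreal d"
    using tight[OF d(1)] by blast
  obtain k1 where k1: "\<And>k. k1 \<le> k \<Longrightarrow> coul_const A (0 / real (Suc k)) (0 / real (Suc k)) (2 / real (Suc k)) < e0"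
    using coul_const_small[OF e0, of 2 A 0] by auto
  obtain k2 :: nat where k2: "16 * M\<^sup>2 * shell_const / e0 < real k2"
    using reals_Archimedean2 by blast
  define k where "k = max k1 (max k2 (2 * j))"
  define r where "r = 1 / real (Suc k)"
  define S where "S = real (Suc k)"
  have r: "0 < r" and S: "0 < S" and rS: "r = 1 / S" by (auto simp: r_def S_def)
  have jS: "real j \<le> S / 2" by (simp add: S_def k_def)
  have loc: "coul_const A 0 0 (2 * r) < e0" using k1[of k] by (simp add: r_def k_def)
  have tail: "16 * M\<^sup>2 * shell_const / S \<le> e0"
  proof -
    have "16 * M\<^sup>2 * shell_const / e0 \<le> S" using k2 by (simp add: S_def k_def)
    then show ?thesis using e0 S by (simp add: field_simps)
  qed
  define V where "V = measure lborel (cball (0::real^3) S)"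
  have V: "emeasure lborel (cball (0::real^3) S) = ennreal V"
    unfolding V_def using emeasure_lborel_cball_finite[of "0::real^3" S] by (intro emeasure_eq_ennreal_measure) auto
  have V0: "0 \<le> V" by (simp add: V_def)
  define et where "et = sqrt (e / (8 * (V + 1)))"
  have et: "0 < et" using e V0 by (simp add: et_def)
  have et2: "2 * et\<^sup>2 * V \<le> e / 4"
  proof -
    have "et\<^sup>2 = e / (8 * (V + 1))" using e V0 by (simp add: et_def)
    then have "2 * et\<^sup>2 * V = e / 4 * (V / (V + 1))" using V0 by (simp add: field_simps)
    also have "\<dots> \<le> e / 4 * 1" using e V0 by (intro mult_left_mono) auto
    finally show ?thesis by simp
  qed
  obtain N2 where N2: "\<And>m n x. N2 \<le> m \<Longrightarrow> N2 \<le> n \<Longrightarrow> norm x \<le> S \<Longrightarrow> norm (tfld r (p m) x - tfld r (p n) x) < et"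
    using unif[OF et, of k] unfolding S_def[symmetric] rS[symmetric] by (auto simp: Ball_def)
  define Loc where "Loc n = riesz (ball 0 r) (\<lambda>x. ennreal (p n x))" for n
  define Rin where "Rin n = riesz UNIV (\<lambda>x. ennreal (p n x) * indicator (ball 0 (real j)) x)" for n
  define Rout where "Rout n = riesz UNIV (\<lambda>x. ennreal (p n x) * indicator (- ball 0 (real j)) x)" for n
  have [measurable]: "Loc n \<in> borel_measurable borel" "Rin n \<in> borel_measurable borel" "Rout n \<in> borel_measurable borel" for n
    unfolding Loc_def Rin_def Rout_def by measurable
  \<comment> \<open>One majorant serves both regions of \<open>x\<close>. The factor 4 comes from
    applying \<open>(a + b)^2 \<le> 2 a^2 + 2 b^2\<close> twice.\<close>
  define H where "H n x = 4 * Loc n x ^ 2 + 4 * (indicator (- ball 0 S) x * Rin n x ^ 2) + 4 * Rout n x ^ 2" for n x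
  have [measurable]: "H n \<in> borel_measurable borel" for n unfolding H_def[abs_def] by measurable
  have H: "(\<integral>\<^sup>+x. H n x \<partial>lborel) \<le> ennreal (12 * e0)" if n: "N1 \<le> n" for n
  proof -
    have 1: "(\<integral>\<^sup>+x. Loc n x ^ 2 \<partial>lborel) \<le> ennreal e0"
      unfolding Loc_def by (rule order_trans[OF riesz_local_square_le[OF p r] ennreal_leI[OF less_imp_le[OF loc]]])
    have 2: "(\<integral>\<^sup>+x. indicator (- ball 0 S) x * Rin n x ^ 2 \<partial>lborel) \<le> ennreal e0"
      unfolding Rin_def
      by (rule order_trans[OF riesz_tail_le[OF p S] ennreal_leI[OF tail]]) (use jS in auto)
    have dp: "dens M A (\<lambda>x. p n x * indicator (- ball 0 (real j)) x)"
      using densD(2)[OF p] by (intro dens_le[OF p[of n]]) (auto simp: indicator_def)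
    have eqn: "ennreal (p n x * indicator (- ball 0 (real j)) x) = ennreal (p n x) * indicator (- ball 0 (real j)) x" for x
      by (auto simp: indicator_def)
    have dd: "dens d A (\<lambda>x. p n x * indicator (- ball 0 (real j)) x)"
      using densD[OF dp] jN[OF n] d unfolding dens_def by (auto simp: eqn)
    have 3: "(\<integral>\<^sup>+x. Rout n x ^ 2 \<partial>lborel) \<le> ennreal e0"
      unfolding Rout_def eqn[symmetric] by (rule order_trans[OF riesz_square_le[OF dd d(1)] ennreal_leI[OF less_imp_le[OF d(2)]]])
    have "(\<integral>\<^sup>+x. H n x \<partial>lborel) = 4 * (\<integral>\<^sup>+x. Loc n x ^ 2 \<partial>lborel) + 4 * (\<integral>\<^sup>+x. indicator (- ball 0 S) x * Rin n x ^ 2 \<partial>lborel) + 4 * (\<integral>\<^sup>+x. Rout n x ^ 2 \<partial>lborel)"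
      unfolding H_def by (simp add: nn_integral_add nn_integral_cmult)
    also have "\<dots> \<le> 4 * ennreal e0 + 4 * ennreal e0 + 4 * ennreal e0"
      by (intro add_mono mult_left_mono 1 2 3) auto
    also have "\<dots> = ennreal (12 * e0)"
      using e0 by (simp add: ennreal_mult[symmetric] ennreal_plus[symmetric] ennreal_numeral[symmetric] del: ennreal_plus ennreal_numeral)
    finally show ?thesis .
  qed
  show ?thesis
  proof (intro exI[of _ "max N1 N2"] allI impI)
    fix m n assume "max N1 N2 \<le> m" "max N1 N2 \<le> n"
    then have mn: "N1 \<le> m" "N1 \<le> n" "N2 \<le> m" "N2 \<le> n" by auto
    have "(\<integral>\<^sup>+x. ennreal (norm (fld (p m) x - fld (p n) x) ^ 2) \<partial>lborel)
       \<le> (\<integral>\<^sup>+x. H m x + H n x + ennreal (2 * et\<^sup>2) * indicator (cball 0 S) x \<partial>lborel)"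
    proof (rule nn_integral_mono_AE)
      show "AE x in lborel. ennreal (norm (fld (p m) x - fld (p n) x) ^ 2) \<le> H m x + H n x + ennreal (2 * et\<^sup>2) * indicator (cball 0 S) x"
        using AE_fld_tfld[OF p r, of m] AE_fld_tfld[OF p r, of n]
      proof eventually_elim
        case (elim x)
        show ?case
        proof (cases "norm x \<le> S")
          case True
          have "norm (fld (p m) x - fld (p n) x) \<le> (norm (fld (p m) x - tfld r (p m) x) + norm (fld (p n) x - tfld r (p n) x)) + norm (tfld r (p m) x - tfld r (p n) x)"
            by norm
          then have "norm (fld (p m) x - fld (p n) x) \<le> (norm (fld (p m) x - tfld r (p m) x) + norm (fld (p n) x - tfld r (p n) x)) + et"
            using N2[OF mn(3,4) True] by linarith
          then have "ennreal (norm (fld (p m) x - fld (p n) x)) \<le> ennreal (norm (fld (p m) x - tfld r (p m) x) + norm (fld (p n) x - tfld r (p n) x) + et)"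
            by (rule ennreal_leI)
          also have "\<dots> = ennreal (norm (fld (p m) x - tfld r (p m) x)) + ennreal (norm (fld (p n) x - tfld r (p n) x)) + ennreal et"
            using et by simp
          also have "\<dots> \<le> (Loc m x + Loc n x) + ennreal et"
            using elim unfolding Loc_def by (intro add_mono) auto
          finally have "ennreal (norm (fld (p m) x - fld (p n) x)) ^ 2 \<le> ((Loc m x + Loc n x) + ennreal et) ^ 2"
            by (rule power_mono) simp
          also have "\<dots> \<le> 2 * (Loc m x + Loc n x) ^ 2 + 2 * (ennreal et) ^ 2" by (rule ennreal_add_square_le)
          also have "\<dots> \<le> 2 * (2 * Loc m x ^ 2 + 2 * Loc n x ^ 2) + 2 * (ennreal et) ^ 2"
            by (intro add_mono mult_left_mono ennreal_add_square_le) auto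
          also have "\<dots> = 4 * Loc m x ^ 2 + 4 * Loc n x ^ 2 + ennreal (2 * et\<^sup>2)"
          proof -
            have "2 * (ennreal et) ^ 2 = ennreal (2 * et\<^sup>2)" using et by (simp add: ennreal_power ennreal_mult)
            then show ?thesis by (simp add: distrib_left mult.assoc[symmetric])
          qed
          also have "\<dots> \<le> H m x + H n x + ennreal (2 * et\<^sup>2) * indicator (cball 0 S) x"
            using True unfolding H_def by (intro add_mono) (auto simp: add.assoc)
          finally show ?thesis by (simp add: ennreal_power)
        next
          case False
          have R: "ennreal (norm (fld (p i) x)) \<le> Rin i x + Rout i x" for i
          proof -
            have "ennreal (norm (fld (p i) x)) \<le> riesz UNIV (\<lambda>y. ennreal (p i y)) x"
              using norm_fld_le[OF densD(1)[OF p], of i x] densD(2)[OF p] by simp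
            also have "\<dots> = Rin i x + Rout i x"
              unfolding Rin_def Rout_def riesz_def
              by (subst nn_integral_add[symmetric]) (auto intro!: nn_integral_cong simp: indicator_def)
            finally show ?thesis .
          qed
          have "ennreal (norm (fld (p m) x - fld (p n) x)) \<le> ennreal (norm (fld (p m) x) + norm (fld (p n) x))"
            by (intro ennreal_leI norm_triangle_ineq4)
          also have "\<dots> = ennreal (norm (fld (p m) x)) + ennreal (norm (fld (p n) x))" by simp
          also have "\<dots> \<le> (Rin m x + Rout m x) + (Rin n x + Rout n x)" by (intro add_mono R)
          finally have "ennreal (norm (fld (p m) x - fld (p n) x)) ^ 2 \<le> ((Rin m x + Rout m x) + (Rin n x + Rout n x)) ^ 2"
            by (rule power_mono) simp
          also have "\<dots> \<le> 2 * (Rin m x + Rout m x) ^ 2 + 2 * (Rin n x + Rout n x) ^ 2" by (rule ennreal_add_square_le)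
          also have "\<dots> \<le> 2 * (2 * Rin m x ^ 2 + 2 * Rout m x ^ 2) + 2 * (2 * Rin n x ^ 2 + 2 * Rout n x ^ 2)"
            by (intro add_mono mult_left_mono ennreal_add_square_le) auto
          also have "\<dots> = (4 * Rin m x ^ 2 + 4 * Rout m x ^ 2) + (4 * Rin n x ^ 2 + 4 * Rout n x ^ 2)"
            by (simp add: distrib_left mult.assoc[symmetric])
          also have "\<dots> \<le> H m x + H n x"
            using False unfolding H_def by (intro add_mono) (auto simp: add.assoc)
          also have "\<dots> \<le> H m x + H n x + ennreal (2 * et\<^sup>2) * indicator (cball 0 S) x" by simp
          finally show ?thesis by (simp add: ennreal_power)
        qed
      qed
    qed
    also have "\<dots> = (\<integral>\<^sup>+x. H m x \<partial>lborel) + (\<integral>\<^sup>+x. H n x \<partial>lborel) + ennreal (2 * et\<^sup>2) * ennreal V"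
      unfolding V[symmetric] by (simp add: nn_integral_add nn_integral_cmult_indicator)
    also have "\<dots> \<le> ennreal (12 * e0) + ennreal (12 * e0) + ennreal (2 * et\<^sup>2) * ennreal V"
      by (intro add_mono H mn order_refl)
    also have "\<dots> = ennreal (12 * e0 + 12 * e0 + 2 * et\<^sup>2 * V)"
      using e0 V0 by (simp add: ennreal_mult[symmetric] ennreal_plus[symmetric] del: ennreal_plus)
    also have "\<dots> \<le> ennreal e" using et2 by (intro ennreal_leI) (use e in \<open>simp add: e0_def\<close>)
    finally show "(\<integral>\<^sup>+x. ennreal (norm (fld (p m) x - fld (p n) x) ^ 2) \<partial>lborel) \<le> ennreal e" .
  qed
qed

section \<open>Strict convexity and strong convergence\<close>

text \<open>Along a fast subsequence, consecutive terms differ by \<open>(1/2)^k\<close> or more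
  only on sets of measure at most \<open>(1/2)^k\<close>. Borel-Cantelli then gives almost
  everywhere an absolutely convergent telescoping series. Only these exceptional sets have to have
  finite measure, so the whole space may be infinite.\<close>

lemma AE_convergent_subseq_of_Cauchy_in_measure:
  fixes f :: "nat \<Rightarrow> 'a \<Rightarrow> real"
  assumes [measurable]: "\<And>n. f n \<in> borel_measurable M"
    and cauchy: "\<And>e. 0 < e \<Longrightarrow> \<exists>N. \<forall>m\<ge>N. \<forall>n\<ge>N. emeasure M {z \<in> space M. e \<le> \<bar>f m z - f n z\<bar>} \<le> ennreal e"
  shows "\<exists>r. strict_mono (r::nat \<Rightarrow> nat) \<and> (AE z in M. convergent (\<lambda>k. f (r k) z))"
proof -
  define good where "good k N \<longleftrightarrow> (\<forall>m\<ge>N. \<forall>n\<ge>N. emeasure M {z \<in> space M. (1/2)^k \<le> \<bar>f m z - f n z\<bar>} \<le> ennreal ((1/2)^k))" for k N :: nat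
  have ex: "\<exists>N. good k N" for k unfolding good_def using cauchy[of "(1/2)^k"] by simp
  have mono: "good k N \<Longrightarrow> N \<le> N' \<Longrightarrow> good k N'" for k N N' unfolding good_def by (meson order_trans)
  have "\<exists>r. \<forall>k. good k (r k) \<and> r k < r (Suc k)"
  proof (rule dependent_nat_choice)
    show "\<exists>x. good 0 x" by (rule ex)
    fix x k
    obtain N where "good (Suc k) N" using ex by blast
    then show "\<exists>y. good (Suc k) y \<and> x < y"
      by (intro exI[of _ "max N (Suc x)"]) (auto intro: mono)
  qed
  then obtain r where r: "\<And>k. good k (r k)" "\<And>k. r k < r (Suc k)" by blast
  have sm: "strict_mono r" using r(2) by (simp add: strict_mono_Suc_iff)
  define A where "A k = {z \<in> space M. (1/2)^k \<le> \<bar>f (r (Suc k)) z - f (r k) z\<bar>}" for k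
  have [measurable]: "A k \<in> sets M" for k unfolding A_def by measurable
  have eA: "emeasure M (A k) \<le> ennreal ((1/2)^k)" for k
    using r(1)[of k] r(2)[of k] unfolding good_def A_def by (simp add: less_imp_le)
  have fin: "emeasure M (A k) < \<infinity>" for k using le_less_trans[OF eA ennreal_less_top] by simp
  have "measure M (A k) \<le> (1/2)^k" for k
    using enn2real_mono[OF eA, of k] by (simp add: measure_def)
  then have "summable (\<lambda>k. measure M (A k))"
    by (intro summable_comparison_test[OF _ summable_geometric[of "1/2::real"]]) auto
  from borel_cantelli_AE1[OF _ fin this] have "AE z in M. eventually (\<lambda>k. z \<in> space M - A k) sequentially" by simp
  then have "AE z in M. convergent (\<lambda>k. f (r k) z)"
  proof eventually_elim
    case (elim z)
    have "\<forall>\<^sub>F k in sequentially. norm (f (r (Suc k)) z - f (r k) z) \<le> (1/2)^k"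
      using elim by eventually_elim (auto simp: A_def)
    then have "summable (\<lambda>k. f (r (Suc k)) z - f (r k) z)"
      by (rule summable_comparison_test_ev) (rule summable_geometric, simp)
    then have "convergent (\<lambda>n. \<Sum>k<n. f (r (Suc k)) z - f (r k) z)" by (simp add: summable_iff_convergent)
    then have "convergent (\<lambda>n. (\<Sum>k<n. f (r (Suc k)) z - f (r k) z) + f (r 0) z)"
      by (intro convergent_add convergent_const)
    then show ?case by (simp add: sum_lessThan_telescope[of "\<lambda>k. f (r k) z"])
  qed
  then show ?thesis using sm by blast
qed

section \<open>The midpoint convexity defect\<close>

definition (in casimir) defect :: "real \<Rightarrow> real \<Rightarrow> real" where
  "defect a b = Q a / 2 + Q b / 2 - Q ((a + b) / 2)"

context casimir
begin

lemma defect_nonneg: "0 \<le> a \<Longrightarrow> 0 \<le> b \<Longrightarrow> 0 \<le> defect a b"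
  using Q_midpoint_le[of a b] by (simp add: defect_def)

text \<open>A continuous positive function on a compact set has a positive minimum. The bound
  \<open>L\<close> supplies the compactness: strict convexity may degenerate at large
  values.\<close>

lemma defect_lower_bound:
  assumes e: "0 < e"
  shows "\<exists>c>0. \<forall>a b. 0 \<le> a \<and> a \<le> L \<and> 0 \<le> b \<and> b \<le> L \<and> e \<le> \<bar>a - b\<bar> \<longrightarrow> c \<le> defect a b"
proof -
  define K where "K = ({0..L} \<times> {0..L}) \<inter> {z::real \<times> real. e \<le> \<bar>fst z - snd z\<bar>}"
  have K: "compact K" unfolding K_def
    by (intro compact_Int_closed compact_Times compact_Icc closed_Collect_le continuous_intros)
  show ?thesis
  proof (cases "K = {}")
    case True
    have "\<not> (0 \<le> a \<and> a \<le> L \<and> 0 \<le> b \<and> b \<le> L \<and> e \<le> \<bar>a - b\<bar>)" for a b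
    proof
      assume "0 \<le> a \<and> a \<le> L \<and> 0 \<le> b \<and> b \<le> L \<and> e \<le> \<bar>a - b\<bar>"
      then have "(a, b) \<in> K" by (auto simp: K_def)
      then show False using True by blast
    qed
    then show ?thesis by (intro exI[of _ 1]) auto
  next
    case False
    have cont: "continuous_on K (\<lambda>z. defect (fst z) (snd z))"
      unfolding defect_def
      by (intro continuous_intros continuous_on_compose2[OF Q_continuous]) (auto simp: K_def)
    obtain z where z: "z \<in> K" "\<And>y. y \<in> K \<Longrightarrow> defect (fst z) (snd z) \<le> defect (fst y) (snd y)"
      using continuous_attains_inf[OF K False cont] by blast
    have "0 < defect (fst z) (snd z)"
      using z(1) e Q_midpoint_strict[of "fst z" "snd z"] by (auto simp: K_def defect_def)
    moreover have "defect (fst z) (snd z) \<le> defect a b" if "0 \<le> a \<and> a \<le> L \<and> 0 \<le> b \<and> b \<le> L \<and> e \<le> \<bar>a - b\<bar>" for a b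
      using z(2)[of "(a, b)"] that by (auto simp: K_def)
    ultimately show ?thesis by blast
  qed
qed

lemma measurable_defect:
  assumes "phase f" "phase g"
  shows "(\<lambda>z. defect (f z) (g z)) \<in> borel_measurable borel"
proof -
  note [measurable] = phaseD(1)[OF assms(1)] phaseD(1)[OF assms(2)]
  have "(\<lambda>z. Q (f z)) \<in> borel_measurable borel" "(\<lambda>z. Q (g z)) \<in> borel_measurable borel"
    "(\<lambda>z. Q ((f z + g z) / 2)) \<in> borel_measurable borel"
    using phaseD(2)[OF assms(1)] phaseD(2)[OF assms(2)] by (auto intro!: measurable_Q_comp)
  then show ?thesis unfolding defect_def by measurable
qed

text \<open>Where \<open>f m\<close> and \<open>f n\<close> differ by at least \<open>e\<close>,
  either one of them reaches \<open>L\<close> or the defect is at least \<open>c\<close>. Markov's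
  inequality bounds the first sets through the common mass and the last one through the integral of
  the defect.\<close>

lemma Cauchy_in_measure_of_defect:
  fixes f :: "nat \<Rightarrow> phase_fun"
  assumes f: "\<And>n. phase (f n)" and mass: "\<And>n. (\<integral>\<^sup>+z. ennreal (f n z) \<partial>lborel) = ennreal M" and M: "0 < M"
    and defect: "\<And>e. 0 < e \<Longrightarrow> \<exists>N. \<forall>m\<ge>N. \<forall>n\<ge>N. (\<integral>\<^sup>+z. ennreal (defect (f m z) (f n z)) \<partial>lborel) \<le> ennreal e"
    and e: "0 < e"
  shows "\<exists>N. \<forall>m\<ge>N. \<forall>n\<ge>N. emeasure lborel {z \<in> space lborel. e \<le> \<bar>f m z - f n z\<bar>} \<le> ennreal e"
proof -
  \<comment> \<open>\<open>M / L = e / 4\<close> for each of the two sets of large values, leaving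
    \<open>e / 2\<close> for the defect.\<close>
  define L where "L = 4 * M / e"
  have L: "0 < L" using M e by (simp add: L_def)
  obtain c where c: "0 < c" "\<And>a b. 0 \<le> a \<Longrightarrow> a \<le> L \<Longrightarrow> 0 \<le> b \<Longrightarrow> b \<le> L \<Longrightarrow> e \<le> \<bar>a - b\<bar> \<Longrightarrow> c \<le> defect a b"
    using defect_lower_bound[OF e, of L] by blast
  obtain N where N: "\<And>m n. N \<le> m \<Longrightarrow> N \<le> n \<Longrightarrow> (\<integral>\<^sup>+z. ennreal (defect (f m z) (f n z)) \<partial>lborel) \<le> ennreal (c * e / 2)"
    using defect[of "c * e / 2"] c(1) e by auto
  have markov: "emeasure lborel {z \<in> space lborel. a \<le> g z} \<le> ennreal (1 / a) * (\<integral>\<^sup>+z. ennreal (g z) \<partial>lborel)"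
    if "g \<in> borel_measurable borel" "0 < a" for g :: "phase_fun" and a
  proof -
    have "{z \<in> space lborel. a \<le> g z} = {z \<in> UNIV. 1 \<le> ennreal (1 / a) * ennreal (g z)}"
    proof -
      have "1 \<le> ennreal (1 / a) * ennreal (g z) \<longleftrightarrow> a \<le> g z" for z
      proof -
        have "ennreal (1 / a) * ennreal (g z) = ennreal (g z / a)" using that(2) by (simp add: ennreal_mult'[symmetric])
        moreover have "1 \<le> ennreal (g z / a) \<longleftrightarrow> 1 \<le> g z / a" by (metis ennreal_1 ennreal_le_iff2 not_one_le_zero linear order_trans)
        ultimately show ?thesis using that(2) by simp
      qed
      then show ?thesis by auto
    qed
    also have "emeasure lborel \<dots> \<le> ennreal (1 / a) * (\<integral>\<^sup>+z. ennreal (g z) * indicator UNIV z \<partial>lborel)"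
      using that(1) nn_integral_Markov_inequality[of "\<lambda>z. ennreal (g z)" UNIV lborel "ennreal (1 / a)"] by simp
    finally show ?thesis by simp
  qed
  show ?thesis
  proof (intro exI[of _ N] allI impI)
    fix m n assume mn: "N \<le> m" "N \<le> n"
    let ?A = "\<lambda>g. {z \<in> space lborel. L \<le> g z}" and ?D = "{z \<in> space lborel. c \<le> defect (f m z) (f n z)}"
    have ms: "?A (f k) \<in> sets lborel" for k using phaseD(1)[OF f[of k]] by measurable
    have mD: "?D \<in> sets lborel" using measurable_defect[OF f[of m] f[of n]] by measurable
    have "{z \<in> space lborel. e \<le> \<bar>f m z - f n z\<bar>} \<subseteq> ?A (f m) \<union> ?A (f n) \<union> ?D"
      using c(2) phaseD(2)[OF f] by (auto simp: not_le) (metis less_imp_le not_le)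
    then have "emeasure lborel {z \<in> space lborel. e \<le> \<bar>f m z - f n z\<bar>} \<le> emeasure lborel (?A (f m) \<union> ?A (f n) \<union> ?D)"
      using ms mD by (intro emeasure_mono) auto
    also have "\<dots> \<le> emeasure lborel (?A (f m) \<union> ?A (f n)) + emeasure lborel ?D"
      using ms mD by (intro emeasure_subadditive) auto
    also have "\<dots> \<le> (emeasure lborel (?A (f m)) + emeasure lborel (?A (f n))) + emeasure lborel ?D"
      using ms by (intro add_mono emeasure_subadditive) auto
    finally have sub: "emeasure lborel {z \<in> space lborel. e \<le> \<bar>f m z - f n z\<bar>} \<le> (emeasure lborel (?A (f m)) + emeasure lborel (?A (f n))) + emeasure lborel ?D" .
    have mA: "emeasure lborel (?A (f k)) \<le> ennreal (1 / L) * ennreal M" for k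
      using markov[OF phaseD(1)[OF f[of k]] L] unfolding mass .
    note sub
    also have "(emeasure lborel (?A (f m)) + emeasure lborel (?A (f n))) + emeasure lborel ?D \<le> (ennreal (1 / L) * ennreal M + ennreal (1 / L) * ennreal M) + ennreal (1 / c) * ennreal (c * e / 2)"
    proof (intro add_mono mA)
      show "emeasure lborel ?D \<le> ennreal (1 / c) * ennreal (c * e / 2)"
        by (rule order_trans[OF markov[OF measurable_defect[OF f f] c(1)] mult_left_mono[OF N[OF mn]]]) simp
    qed
    also have "\<dots> = ennreal (1 / L * M + 1 / L * M + 1 / c * (c * e / 2))"
      using L M c(1) e by (simp add: ennreal_mult[symmetric] ennreal_plus[symmetric] del: ennreal_plus)
    also have "1 / L * M + 1 / L * M + 1 / c * (c * e / 2) = e"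
      using M e c(1) by (simp add: L_def)
    finally show "emeasure lborel {z \<in> space lborel. e \<le> \<bar>f m z - f n z\<bar>} \<le> ennreal e" .
  qed
qed

end

section \<open>Energy of midpoints\<close>

lemma fld_cong_AE:
  assumes [measurable]: "p \<in> borel_measurable borel" "q \<in> borel_measurable borel" and "AE x in lborel. p x = q x"
  shows "fld p = fld q"
proof
  fix x
  show "fld p x = fld q x" unfolding fld_def
    using assms(3) by (intro integral_cong_AE) auto
qed

text \<open>Almost everywhere only: at an \<open>x\<close> with a non-integrable slice
  \<open>rho\<close> takes its default value, and linearity may fail.\<close>

lemma AE_rho_lincomb:
  assumes f: "f \<in> FM Q M" and g: "g \<in> FM Q M'"
  shows "AE x in lborel. rho (\<lambda>z. a * f z + b * g z) x = a * rho f x + b * rho g x"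
proof -
  have "AE x in lborel. integrable lborel (\<lambda>v. f (x, v))" "AE x in lborel. integrable lborel (\<lambda>v. g (x, v))"
    using lborel_pair.AE_integrable_fst'[of f] lborel_pair.AE_integrable_fst'[of g] FM_D(5)[OF f] FM_D(5)[OF g]
    by (auto simp: lborel_prod)
  then show ?thesis
    by eventually_elim (simp add: rho_def)
qed

text \<open>The parallelogram identity, integrated. It bounds what the nonconvex term can lose when
  two functions are averaged.\<close>

lemma field_energy_midpoint:
  assumes p: "dens M A p" and q: "dens M A q" and d: "(\<integral>\<^sup>+x. ennreal (norm (fld p x - fld q x) ^ 2) \<partial>lborel) \<le> ennreal D" "0 \<le> D"
  shows "(field_energy p + field_energy q) / 2 \<le> field_energy (\<lambda>x. (p x + q x) / 2) + D / 4"
proof -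
  have half: "(\<lambda>x. (p x + q x) / 2) = (\<lambda>x. (1/2) * p x + (1/2) * q x)" by (auto simp: fun_eq_iff)
  note ip = integrable_fld_square[OF p] and iq = integrable_fld_square[OF q]
  have [measurable]: "fld p \<in> borel_measurable borel" "fld q \<in> borel_measurable borel"
    using densD(1)[OF p] densD(1)[OF q] by measurable
  have id: "integrable lborel (\<lambda>x. norm (fld p x - fld q x) ^ 2)"
    using d le_less_trans[OF d(1) ennreal_less_top] by (intro integrableI_bounded) auto
  have "ennreal (\<integral>x. norm (fld p x - fld q x) ^ 2 \<partial>lborel) \<le> ennreal D"
    using d(1) nn_integral_eq_integral[OF id] by simp
  then have D: "(\<integral>x. norm (fld p x - fld q x) ^ 2 \<partial>lborel) \<le> D" using d(2) by simp
  have "field_energy (\<lambda>x. (p x + q x) / 2) = (\<integral>x. (norm (fld p x) ^ 2 / 2 + norm (fld q x) ^ 2 / 2) - norm (fld p x - fld q x) ^ 2 / 4 \<partial>lborel)"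
    unfolding field_energy_def half
  proof (rule integral_cong_AE)
    show "AE x in lborel. norm (fld (\<lambda>x. 1/2 * p x + 1/2 * q x) x) ^ 2 = (norm (fld p x) ^ 2 / 2 + norm (fld q x) ^ 2 / 2) - norm (fld p x - fld q x) ^ 2 / 4"
      using AE_fld_lincomb[OF p q, of "1/2" "1/2"]
    proof eventually_elim
      case (elim x)
      show ?case unfolding elim
        by (simp add: power2_norm_eq_inner inner_add_left inner_add_right inner_diff_left inner_diff_right inner_commute field_simps)
    qed
  qed (use densD(1)[OF p] densD(1)[OF q] in measurable)
  also have "\<dots> = (\<integral>x. norm (fld p x) ^ 2 / 2 + norm (fld q x) ^ 2 / 2 \<partial>lborel) - (\<integral>x. norm (fld p x - fld q x) ^ 2 / 4 \<partial>lborel)"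
    using ip iq id by (intro Bochner_Integration.integral_diff) auto
  also have "\<dots> = (field_energy p + field_energy q) / 2 - (\<integral>x. norm (fld p x - fld q x) ^ 2 \<partial>lborel) / 4"
    unfolding field_energy_def using ip iq by (subst Bochner_Integration.integral_add) (auto simp: add_divide_distrib)
  finally show ?thesis using D by linarith
qed

context casimir
begin

text \<open>The midpoint is admissible, so its energy is at least \<open>hM Q M\<close>. The kinetic
  energy averages exactly, the Casimir energy falls by the integrated defect, and the field energy
  falls by at most \<open>D / 4\<close>, which after division by \<open>8 * pi\<close> gives the
  last term.\<close>

lemma defect_integral_le:
  assumes M: "0 < M" and f: "f \<in> FM Q M" and g: "g \<in> FM Q M" and df: "dens M A (rho f)" and dg: "dens M A (rho g)"
    and d: "(\<integral>\<^sup>+x. ennreal (norm (fld (rho f) x - fld (rho g) x) ^ 2) \<partial>lborel) \<le> ennreal D" "0 \<le> D"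
  shows "(\<integral>\<^sup>+z. ennreal (defect (f z) (g z)) \<partial>lborel) \<le> ennreal ((HC Q f + HC Q g) / 2 - hM Q M + D / (32 * pi))"
proof -
  note F = FM_D[OF f] and G = FM_D[OF g]
  note [measurable] = phaseD(1)[OF F(1)] phaseD(1)[OF G(1)]
  define h where "h z = (f z + g z) / 2" for z
  have h: "phase h" unfolding h_def[abs_def] phase_def using phaseD(2)[OF F(1)] phaseD(2)[OF G(1)] by auto
  note [measurable] = phaseD(1)[OF h]
  have Qm: "(\<lambda>z. Q (u z)) \<in> borel_measurable borel" if "phase u" for u
    using phaseD[OF that] by (intro measurable_Q_comp) auto
  note [measurable] = Qm[OF h] Qm[OF F(1)] Qm[OF G(1)] measurable_defect[OF F(1) G(1)]
  define Df where "Df = (\<integral>\<^sup>+z. ennreal (defect (f z) (g z)) \<partial>lborel)"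
  define hf where "hf = (1/2::real)"
  have hf: "0 \<le> hf" "hf * a = a / 2" for a by (auto simp: hf_def)
  have half: "ennreal (a / 2) = ennreal hf * ennreal a" for a unfolding hf(2)[symmetric] by (rule ennreal_mult'[OF hf(1)])
  \<comment> \<open>The defect is kept on the side of the midpoint, since subtraction in
    \<open>ennreal\<close> is truncated.\<close>
  have "Cas Q h + Df = (\<integral>\<^sup>+z. ennreal (Q (h z)) + ennreal (defect (f z) (g z)) \<partial>lborel)"
    unfolding Cas_def Df_def by (rule nn_integral_add[symmetric]) measurable
  also have "\<dots> = (\<integral>\<^sup>+z. ennreal hf * ennreal (Q (f z)) + ennreal hf * ennreal (Q (g z)) \<partial>lborel)"
  proof (rule nn_integral_cong)
    fix z
    have nn: "0 \<le> f z" "0 \<le> g z" using phaseD(2)[OF F(1)] phaseD(2)[OF G(1)] by auto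
    have "ennreal (Q (h z)) + ennreal (defect (f z) (g z)) = ennreal (Q (h z) + defect (f z) (g z))"
      using nn Q_nonneg phaseD(2)[OF h] defect_nonneg by simp
    also have "Q (h z) + defect (f z) (g z) = Q (f z) / 2 + Q (g z) / 2" by (simp add: defect_def h_def)
    also have "ennreal \<dots> = ennreal hf * ennreal (Q (f z)) + ennreal hf * ennreal (Q (g z))"
      unfolding half[symmetric] using nn Q_nonneg by simp
    finally show "ennreal (Q (h z)) + ennreal (defect (f z) (g z)) = \<dots>" .
  qed
  also have "\<dots> = ennreal hf * Cas Q f + ennreal hf * Cas Q g"
    unfolding Cas_def by (simp add: nn_integral_add nn_integral_cmult)
  finally have C: "Cas Q h + Df = ennreal hf * Cas Q f + ennreal hf * Cas Q g" .
  have km: "(\<lambda>z. ennreal (norm (snd z) ^ 2 / 2 * u z)) \<in> borel_measurable lborel" if "phase u" for u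
    using measurable_compose[OF measurable_kinetic[OF phaseD(1)[OF that]] measurable_ennreal] by simp
  have "Ekin h = (\<integral>\<^sup>+z. ennreal hf * ennreal (norm (snd z) ^ 2 / 2 * f z) + ennreal hf * ennreal (norm (snd z) ^ 2 / 2 * g z) \<partial>lborel)"
    unfolding Ekin_def
  proof (rule nn_integral_cong)
    fix z
    have "norm (snd z) ^ 2 / 2 * h z = norm (snd z) ^ 2 / 2 * f z / 2 + norm (snd z) ^ 2 / 2 * g z / 2"
      by (simp add: h_def algebra_simps add_divide_distrib)
    then have "ennreal (norm (snd z) ^ 2 / 2 * h z) = ennreal (norm (snd z) ^ 2 / 2 * f z / 2) + ennreal (norm (snd z) ^ 2 / 2 * g z / 2)"
      using phaseD(2)[OF F(1), of z] phaseD(2)[OF G(1), of z] by (simp only:) (intro ennreal_plus, auto)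
    then show "ennreal (norm (snd z) ^ 2 / 2 * h z) = ennreal hf * ennreal (norm (snd z) ^ 2 / 2 * f z) + ennreal hf * ennreal (norm (snd z) ^ 2 / 2 * g z)"
      unfolding half .
  qed
  also have "\<dots> = ennreal hf * Ekin f + ennreal hf * Ekin g"
    unfolding Ekin_def using km[OF F(1)] km[OF G(1)] by (subst nn_integral_add) (auto simp: nn_integral_cmult)
  finally have E: "Ekin h = ennreal hf * Ekin f + ennreal hf * Ekin g" .
  have "Pfun Q h + Df = (Cas Q h + Df) + Ekin h" by (simp add: Pfun_def add_ac)
  also have "\<dots> = ennreal hf * Pfun Q f + ennreal hf * Pfun Q g"
    unfolding C E Pfun_def by (simp add: distrib_left add_ac)
  also have "\<dots> = ennreal hf * ennreal (enn2real (Pfun Q f)) + ennreal hf * ennreal (enn2real (Pfun Q g))"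
    using F(4) G(4) by simp
  also have "\<dots> = ennreal ((enn2real (Pfun Q f) + enn2real (Pfun Q g)) / 2)"
    by (simp add: hf ennreal_mult[symmetric] ennreal_plus[symmetric] add_divide_distrib del: ennreal_plus)
  finally have PD: "Pfun Q h + Df = ennreal ((enn2real (Pfun Q f) + enn2real (Pfun Q g)) / 2)" .
  have "Pfun Q h \<le> Pfun Q h + Df" "Df \<le> Pfun Q h + Df" by auto
  then have Pfin: "Pfun Q h < \<infinity>" and Dfin: "Df < \<infinity>" unfolding PD using le_less_trans[OF _ ennreal_less_top] by auto
  have hF: "h \<in> FM Q M"
  proof (rule FM_I[OF h _ _ Pfin])
    have "(\<integral>\<^sup>+z. ennreal (h z) \<partial>lborel) = (\<integral>\<^sup>+z. ennreal hf * ennreal (f z) + ennreal hf * ennreal (g z) \<partial>lborel)"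
    proof (rule nn_integral_cong)
      fix z show "ennreal (h z) = ennreal hf * ennreal (f z) + ennreal hf * ennreal (g z)"
        unfolding half[symmetric] h_def using phaseD(2)[OF F(1), of z] phaseD(2)[OF G(1), of z] by (simp add: add_divide_distrib)
    qed
    also have "\<dots> = ennreal hf * ennreal M + ennreal hf * ennreal M"
      using F(2) G(2) by (simp add: nn_integral_add nn_integral_cmult)
    also have "\<dots> = ennreal M" using M by (simp add: hf ennreal_mult[symmetric] ennreal_plus[symmetric] del: ennreal_plus)
    finally show "(\<integral>\<^sup>+z. ennreal (h z) \<partial>lborel) = ennreal M" .
  qed (use M in simp)
  have "fld (rho h) = fld (\<lambda>x. (rho f x + rho g x) / 2)"
  proof (rule fld_cong_AE)
    show "AE x in lborel. rho h x = (rho f x + rho g x) / 2"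
      using AE_rho_lincomb[OF f g, of "1/2" "1/2"] by eventually_elim (simp add: h_def[abs_def] add_divide_distrib)
  qed (use measurable_rho[OF phaseD(1)[OF h]] densD(1)[OF df] densD(1)[OF dg] in auto)
  then have "field_energy (rho h) = field_energy (\<lambda>x. (rho f x + rho g x) / 2)" by (simp add: field_energy_def)
  with field_energy_midpoint[OF df dg d]
  have fe: "(field_energy (rho f) + field_energy (rho g)) / 2 \<le> field_energy (rho h) + D / 4" by simp
  have "ennreal (enn2real (Pfun Q h) + enn2real Df) = ennreal ((enn2real (Pfun Q f) + enn2real (Pfun Q g)) / 2)"
    using PD Pfin Dfin by (simp add: less_top)
  then have Dr: "enn2real Df = (enn2real (Pfun Q f) + enn2real (Pfun Q g)) / 2 - enn2real (Pfun Q h)"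
    by (subst (asm) ennreal_inj) (auto simp: field_simps)
  have "hM Q M \<le> enn2real (Pfun Q h) - field_energy (rho h) / (8 * pi)"
    using hM_le[OF M hF] unfolding HC_eq .
  moreover have "(field_energy (rho f) + field_energy (rho g)) / 2 / (8 * pi) \<le> (field_energy (rho h) + D / 4) / (8 * pi)"
    using fe by (intro divide_right_mono) auto
  ultimately have "enn2real Df \<le> (HC Q f + HC Q g) / 2 - hM Q M + D / (32 * pi)"
    unfolding Dr HC_eq by (simp add: add_divide_distrib diff_divide_distrib)
  then have "ennreal (enn2real Df) \<le> ennreal ((HC Q f + HC Q g) / 2 - hM Q M + D / (32 * pi))" by (rule ennreal_leI)
  then show ?thesis using Dfin unfolding Df_def[symmetric] by (simp add: less_top)
qed

end

section \<open>Passage to the almost everywhere limit\<close>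

lemma nn_integral_rho_cut:
  assumes f: "phase f" and fin: "(\<integral>\<^sup>+z. ennreal (f z) \<partial>lborel) < \<infinity>" and S: "S \<in> sets borel"
  shows "(\<integral>\<^sup>+z. ennreal (f z) * indicator S (fst z) \<partial>lborel) = (\<integral>\<^sup>+x. ennreal (rho f x) * indicator S x \<partial>lborel)"
proof -
  have eq: "ennreal (f z) * indicator S (fst z) = ennreal (cut S f z)" for z
    by (auto simp: cut_def indicator_def)
  have "(\<integral>\<^sup>+z. ennreal (cut S f z) \<partial>lborel) \<le> (\<integral>\<^sup>+z. ennreal (f z) \<partial>lborel)"
    using phaseD(2)[OF f] by (intro nn_integral_mono ennreal_leI) (auto simp: cut_def indicator_def)
  then have c: "(\<integral>\<^sup>+z. ennreal (cut S f z) \<partial>lborel) < \<infinity>" using fin by (rule le_less_trans)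
  show ?thesis unfolding eq nn_integral_rho[OF phase_cut[OF f S] c, symmetric] rho_cut
    by (intro nn_integral_cong) (auto simp: indicator_def)
qed

text \<open>The mass lost to infinity in \<open>x\<close>, to large velocities and to large values of \<open>f\<close> is controlled
  uniformly, so no mass is lost in the limit.\<close>

lemma mass_of_AE_limit:
  fixes f :: "nat \<Rightarrow> phase_fun" and f0 :: phase_fun
  assumes f: "\<And>n. phase (f n)" and f0: "phase f0" and mass: "\<And>n. (\<integral>\<^sup>+z. ennreal (f n z) \<partial>lborel) = ennreal M"
    and ae: "AE z in lborel. (\<lambda>n. f n z) \<longlonglongrightarrow> f0 z"
    and tight: "\<And>e. 0 < e \<Longrightarrow> \<exists>j N. \<forall>n\<ge>N. (\<integral>\<^sup>+x. ennreal (rho (f n) x) * indicator (- ball 0 (real j)) x \<partial>lborel) \<le> ennreal e"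
    and kin: "\<And>n. Ekin (f n) \<le> ennreal P" and P: "0 \<le> P"
    and eqint: "\<And>n. (\<integral>\<^sup>+z. ennreal (f n z powr (5/3)) \<partial>lborel) \<le> ennreal F" and F: "0 \<le> F"
  shows "(\<integral>\<^sup>+z. ennreal (f0 z) \<partial>lborel) = ennreal M"
proof (rule antisym)
  note [measurable] = phaseD(1)[OF f] phaseD(1)[OF f0]
  have [measurable]: "f n \<in> borel_measurable lborel" "f0 \<in> borel_measurable lborel" for n by simp_all
  have "(\<integral>\<^sup>+z. ennreal (f0 z) \<partial>lborel) = (\<integral>\<^sup>+z. liminf (\<lambda>n. ennreal (f n z)) \<partial>lborel)"
  proof (rule nn_integral_cong_AE)
    show "AE z in lborel. ennreal (f0 z) = liminf (\<lambda>n. ennreal (f n z))"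
      using ae by eventually_elim (metis lim_imp_Liminf tendsto_ennrealI trivial_limit_sequentially)
  qed
  also have "\<dots> \<le> liminf (\<lambda>n. \<integral>\<^sup>+z. ennreal (f n z) \<partial>lborel)" by (rule nn_integral_liminf) measurable
  also have "\<dots> = ennreal M" unfolding mass by (simp add: Liminf_const)
  finally show le: "(\<integral>\<^sup>+z. ennreal (f0 z) \<partial>lborel) \<le> ennreal M" .
  show "ennreal M \<le> (\<integral>\<^sup>+z. ennreal (f0 z) \<partial>lborel)"
  proof (rule ennreal_le_epsilon)
    fix e :: real assume e: "0 < e"
    define e1 where "e1 = e / 4"
    have e1: "0 < e1" using e by (simp add: e1_def)
    obtain j N where jN: "\<And>n. N \<le> n \<Longrightarrow> (\<integral>\<^sup>+x. ennreal (rho (f n) x) * indicator (- ball 0 (real j)) x \<partial>lborel) \<le> ennreal e1"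
      using tight[OF e1] by blast
    \<comment> \<open>\<open>R\<close> and, further down, \<open>L\<close> are chosen so that the
      Chebyshev losses \<open>2 / R^2 * P\<close> at large velocities and
      \<open>L powr (- (2/3)) * F\<close> at large values stay below \<open>e1\<close>.\<close>
    define R where "R = sqrt (2 * P / e1) + 1"
    have R: "0 < R" unfolding R_def using P e1 by (intro add_nonneg_pos) auto
    have R2: "2 / R\<^sup>2 * P \<le> e1"
    proof -
      have "2 * P / e1 = (sqrt (2 * P / e1))\<^sup>2" using P e1 by simp
      also have "\<dots> \<le> R\<^sup>2" unfolding R_def using P e1 by (intro power_mono) auto
      finally show ?thesis using e1 R by (simp add: field_simps)
    qed
    define L where "L = ((F + 1) / e1) powr (3/2)"
    have L: "0 < L" using F e1 by (simp add: L_def)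
    have L2: "L powr (- (2/3)) * F \<le> e1"
    proof -
      have "L powr (- (2/3)) = ((F + 1) / e1) powr (- 1)" unfolding L_def powr_powr by simp
      also have "\<dots> = e1 / (F + 1)" using F e1 by (simp add: powr_minus_divide)
      finally have "L powr (- (2/3)) * F = e1 * (F / (F + 1))" by simp
      also have "\<dots> \<le> e1 * 1" using e1 F by (intro mult_left_mono) auto
      finally show ?thesis by simp
    qed
    define B where "B = ball (0::real^3) (real j)"
    define B' where "B' = cball (0::real^3) R"
    have [measurable]: "B \<in> sets borel" "B' \<in> sets borel" by (auto simp: B_def B'_def)
    define I where "I z = (indicator B (fst z) * indicator B' (snd z) :: real)" for z :: "(real^3) \<times> (real^3)"
    have [measurable]: "I \<in> borel_measurable borel" unfolding I_def[abs_def]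
      by (intro borel_measurable_times measurable_compose[OF measurable_fst_borel] measurable_compose[OF measurable_snd_borel]) auto
    \<comment> \<open>Truncated at \<open>L\<close> and restricted to a bounded region, the
      functions are dominated by the integrable \<open>L * I\<close>, so dominated convergence
      applies. Each of the three discarded parts costs at most \<open>e1\<close>.\<close>
    define u where "u n z = ennreal (min (f n z) L * I z)" for n z
    define u0 where "u0 z = ennreal (min (f0 z) L * I z)" for z
    have [measurable]: "u n \<in> borel_measurable lborel" "u0 \<in> borel_measurable lborel" for n
      unfolding u_def[abs_def] u0_def[abs_def] by measurable
    have key: "ennreal M \<le> (\<integral>\<^sup>+z. u n z \<partial>lborel) + ennreal (3 * e1)" if n: "N \<le> n" for n
    proof -
      let ?kin = "\<lambda>z. ennreal (norm (snd z) ^ 2 / 2 * f n z)"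
      have km: "?kin \<in> borel_measurable lborel"
        using measurable_compose[OF measurable_kinetic[OF phaseD(1)[OF f[of n]]] measurable_ennreal] by simp
      have bm: "(\<lambda>z. ennreal (f n z) * indicator (- B) (fst z)) \<in> borel_measurable lborel"
      proof -
        have "(\<lambda>z::(real^3)\<times>(real^3). indicator (- B) (fst z) :: ennreal) \<in> borel_measurable borel"
          by (intro measurable_compose[OF measurable_fst_borel]) auto
        then show ?thesis by simp
      qed
      have "ennreal M = (\<integral>\<^sup>+z. ennreal (f n z) \<partial>lborel)" by (simp add: mass)
      also have "\<dots> \<le> (\<integral>\<^sup>+z. (u n z + ennreal (f n z) * indicator (- B) (fst z)) + (ennreal (2 / R\<^sup>2) * ?kin z + ennreal (L powr (- (2/3))) * ennreal (f n z powr (5/3))) \<partial>lborel)"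
      proof (rule nn_integral_mono)
        fix z
        have fz: "0 \<le> f n z" using phaseD(2)[OF f] .
        consider "fst z \<notin> B" | "fst z \<in> B" "snd z \<notin> B'" | "fst z \<in> B" "snd z \<in> B'" "f n z \<le> L" | "L < f n z" by linarith
        then show "ennreal (f n z) \<le> (u n z + ennreal (f n z) * indicator (- B) (fst z)) + (ennreal (2 / R\<^sup>2) * ?kin z + ennreal (L powr (- (2/3))) * ennreal (f n z powr (5/3)))"
        proof cases
          case 1
          then have "ennreal (f n z) = ennreal (f n z) * indicator (- B) (fst z)" by simp
          also have "\<dots> \<le> u n z + ennreal (f n z) * indicator (- B) (fst z)" by simp
          also have "\<dots> \<le> (u n z + ennreal (f n z) * indicator (- B) (fst z)) + (ennreal (2 / R\<^sup>2) * ?kin z + ennreal (L powr (- (2/3))) * ennreal (f n z powr (5/3)))" by simp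
          finally show ?thesis .
        next
          case 2
          then have "R\<^sup>2 \<le> norm (snd z) ^ 2" using R by (intro power_mono) (auto simp: B'_def)
          then have "1 \<le> norm (snd z) ^ 2 / R\<^sup>2" using R by simp
          then have "1 * f n z \<le> norm (snd z) ^ 2 / R\<^sup>2 * f n z" using fz by (intro mult_right_mono)
          then have "f n z \<le> 2 / R\<^sup>2 * (norm (snd z) ^ 2 / 2 * f n z)" by simp
          then have "ennreal (f n z) \<le> ennreal (2 / R\<^sup>2 * (norm (snd z) ^ 2 / 2 * f n z))" by (rule ennreal_leI)
          also have "\<dots> = ennreal (2 / R\<^sup>2) * ?kin z" by (rule ennreal_mult') simp
          also have "\<dots> \<le> ennreal (2 / R\<^sup>2) * ?kin z + ennreal (L powr (- (2/3))) * ennreal (f n z powr (5/3))" by simp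
          also have "\<dots> \<le> (u n z + ennreal (f n z) * indicator (- B) (fst z)) + (ennreal (2 / R\<^sup>2) * ?kin z + ennreal (L powr (- (2/3))) * ennreal (f n z powr (5/3)))"
            by (rule add_increasing) auto
          finally show ?thesis .
        next
          case 3
          then have "ennreal (f n z) = u n z" by (simp add: u_def I_def)
          also have "\<dots> \<le> u n z + ennreal (f n z) * indicator (- B) (fst z)" by simp
          also have "\<dots> \<le> (u n z + ennreal (f n z) * indicator (- B) (fst z)) + (ennreal (2 / R\<^sup>2) * ?kin z + ennreal (L powr (- (2/3))) * ennreal (f n z powr (5/3)))" by simp
          finally show ?thesis .
        next
          case 4
          have "f n z = f n z powr (- (2/3)) * f n z powr (5/3)" using 4 L by (simp flip: powr_add)
          also have "\<dots> \<le> L powr (- (2/3)) * f n z powr (5/3)" using 4 L by (intro mult_right_mono powr_mono2') auto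
          finally have "ennreal (f n z) \<le> ennreal (L powr (- (2/3)) * f n z powr (5/3))" by (rule ennreal_leI)
          also have "\<dots> = ennreal (L powr (- (2/3))) * ennreal (f n z powr (5/3))" by (rule ennreal_mult') simp
          also have "\<dots> \<le> ennreal (2 / R\<^sup>2) * ?kin z + ennreal (L powr (- (2/3))) * ennreal (f n z powr (5/3))" by simp
          also have "\<dots> \<le> (u n z + ennreal (f n z) * indicator (- B) (fst z)) + (ennreal (2 / R\<^sup>2) * ?kin z + ennreal (L powr (- (2/3))) * ennreal (f n z powr (5/3)))"
            by (rule add_increasing) auto
          finally show ?thesis .
        qed
      qed
      also have "\<dots> = ((\<integral>\<^sup>+z. u n z \<partial>lborel) + (\<integral>\<^sup>+z. ennreal (f n z) * indicator (- B) (fst z) \<partial>lborel))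
          + (ennreal (2 / R\<^sup>2) * Ekin (f n) + ennreal (L powr (- (2/3))) * (\<integral>\<^sup>+z. ennreal (f n z powr (5/3)) \<partial>lborel))"
        unfolding Ekin_def using km bm by (simp add: nn_integral_add nn_integral_cmult)
      also have "\<dots> \<le> ((\<integral>\<^sup>+z. u n z \<partial>lborel) + ennreal e1) + (ennreal (2 / R\<^sup>2) * ennreal P + ennreal (L powr (- (2/3))) * ennreal F)"
      proof (intro add_mono mult_left_mono kin eqint order_refl)
        show "(\<integral>\<^sup>+z. ennreal (f n z) * indicator (- B) (fst z) \<partial>lborel) \<le> ennreal e1"
          using jN[OF n] nn_integral_rho_cut[OF f[of n], of "- B"] mass[of n] by (simp add: B_def)
      qed auto
      also have "ennreal (2 / R\<^sup>2) * ennreal P + ennreal (L powr (- (2/3))) * ennreal F = ennreal (2 / R\<^sup>2 * P + L powr (- (2/3)) * F)"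
        using P F by (simp add: ennreal_mult[symmetric] ennreal_plus[symmetric] del: ennreal_plus)
      also have "((\<integral>\<^sup>+z. u n z \<partial>lborel) + ennreal e1) + ennreal (2 / R\<^sup>2 * P + L powr (- (2/3)) * F) \<le> ((\<integral>\<^sup>+z. u n z \<partial>lborel) + ennreal e1) + ennreal (2 * e1)"
        using R2 L2 by (intro add_left_mono ennreal_leI) simp
      also have "\<dots> = (\<integral>\<^sup>+z. u n z \<partial>lborel) + ennreal (3 * e1)"
        using e1 by (simp add: add.assoc ennreal_plus[symmetric] del: ennreal_plus)
      finally show ?thesis .
    qed
    have lim: "(\<lambda>n. \<integral>\<^sup>+z. u n z \<partial>lborel) \<longlonglongrightarrow> (\<integral>\<^sup>+z. u0 z \<partial>lborel)"
    proof (rule nn_integral_dominated_convergence[where w = "\<lambda>z. ennreal (L * I z)"])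
      show "AE z in lborel. (\<lambda>n. u n z) \<longlonglongrightarrow> u0 z"
        using ae by eventually_elim (auto simp: u_def u0_def intro!: tendsto_ennrealI tendsto_intros)
      show "AE z in lborel. u n z \<le> ennreal (L * I z)" for n
        unfolding u_def by (intro AE_I2 ennreal_leI mult_right_mono) (auto simp: I_def)
      show "(\<integral>\<^sup>+z. ennreal (L * I z) \<partial>lborel) < \<infinity>"
      proof -
        have mI: "(\<lambda>z. ennreal (L * I z)) \<in> borel_measurable borel" by measurable
        have "(\<integral>\<^sup>+z. ennreal (L * I z) \<partial>lborel) = (\<integral>\<^sup>+x. \<integral>\<^sup>+v. ennreal L * indicator B x * indicator B' v \<partial>lborel \<partial>lborel)"
          using L by (subst nn_integral_phase[OF mI]) (auto intro!: nn_integral_cong simp: I_def indicator_def)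
        also have "\<dots> = (\<integral>\<^sup>+x. ennreal L * emeasure lborel B' * indicator B x \<partial>lborel)"
          by (intro nn_integral_cong) (subst nn_integral_cmult_indicator, simp_all add: mult_ac)
        also have "\<dots> = ennreal L * emeasure lborel B' * emeasure lborel B"
          by (subst nn_integral_cmult_indicator) auto
        also have "\<dots> < \<infinity>"
          using emeasure_lborel_cball_finite[of "0::real^3" R] emeasure_lborel_ball_finite[of "0::real^3" "real j"]
          by (simp add: B_def B'_def ennreal_mult_less_top)
        finally show ?thesis .
      qed
    qed measurable
    have "ennreal M \<le> (\<integral>\<^sup>+z. u0 z \<partial>lborel) + ennreal (3 * e1)"
    proof (rule LIMSEQ_le_const)
      show "(\<lambda>n. (\<integral>\<^sup>+z. u n z \<partial>lborel) + ennreal (3 * e1)) \<longlonglongrightarrow> (\<integral>\<^sup>+z. u0 z \<partial>lborel) + ennreal (3 * e1)"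
        by (intro tendsto_add lim tendsto_const)
    qed (use key in blast)
    also have "\<dots> \<le> (\<integral>\<^sup>+z. ennreal (f0 z) \<partial>lborel) + ennreal e"
    proof (intro add_mono nn_integral_mono)
      fix z show "u0 z \<le> ennreal (f0 z)" unfolding u0_def
        using phaseD(2)[OF f0, of z] L by (intro ennreal_leI) (auto simp: I_def indicator_def)
      show "ennreal (3 * e1) \<le> ennreal e" using e by (intro ennreal_leI) (simp add: e1_def)
    qed
    finally show "ennreal M \<le> (\<integral>\<^sup>+z. ennreal (f0 z) \<partial>lborel) + ennreal e" .
  qed
qed

text \<open>Scheffe's lemma: equal masses upgrade almost everywhere convergence to convergence in
  L^1.\<close>

lemma L1_convergence:
  fixes f :: "nat \<Rightarrow> phase_fun" and f0 :: phase_fun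
  assumes f: "\<And>n. f n \<in> FM Q M" and f0: "phase f0" "(\<integral>\<^sup>+z. ennreal (f0 z) \<partial>lborel) = ennreal M"
    and ae: "AE z in lborel. (\<lambda>n. f n z) \<longlonglongrightarrow> f0 z"
  shows "(\<lambda>n. \<integral>\<^sup>+z. ennreal \<bar>f n z - f0 z\<bar> \<partial>lborel) \<longlonglongrightarrow> 0"
proof -
  have i0: "integrable lborel f0"
    using f0 phaseD[OF f0(1)] by (intro integrableI_nonneg) auto
  have "(\<lambda>n. \<integral>\<^sup>+z. norm (f n z - f0 z) \<partial>lborel) \<longlonglongrightarrow> 0"
  proof (rule Scheffe_lemma1[OF FM_D(5)[OF f] i0 ae])
    have "(\<integral>\<^sup>+z. ennreal (norm (f n z)) \<partial>lborel) = ennreal M" for n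
      using FM_D(2)[OF f[of n]] phaseD(2)[OF FM_D(1)[OF f[of n]]] by simp
    moreover have "(\<integral>\<^sup>+z. ennreal (norm (f0 z)) \<partial>lborel) = ennreal M"
      using f0(2) phaseD(2)[OF f0(1)] by simp
    ultimately show "limsup (\<lambda>n. \<integral>\<^sup>+z. ennreal (norm (f n z)) \<partial>lborel) \<le> (\<integral>\<^sup>+z. ennreal (norm (f0 z)) \<partial>lborel)"
      by (simp add: Limsup_const)
  qed
  then show ?thesis by simp
qed

lemma rho_L1_le:
  assumes f: "phase f" "(\<integral>\<^sup>+z. ennreal (f z) \<partial>lborel) < \<infinity>" and g: "phase g" "(\<integral>\<^sup>+z. ennreal (g z) \<partial>lborel) < \<infinity>"
  shows "(\<integral>\<^sup>+x. ennreal \<bar>rho f x - rho g x\<bar> \<partial>lborel) \<le> (\<integral>\<^sup>+z. ennreal \<bar>f z - g z\<bar> \<partial>lborel)"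
proof -
  note [measurable] = phaseD(1)[OF f(1)] phaseD(1)[OF g(1)]
  have i: "integrable lborel f" "integrable lborel g"
    using f g phaseD[OF f(1)] phaseD[OF g(1)] by (auto intro!: integrableI_nonneg)
  have "AE x in lborel. integrable lborel (\<lambda>v. f (x, v))" "AE x in lborel. integrable lborel (\<lambda>v. g (x, v))"
    using lborel_pair.AE_integrable_fst'[of f] lborel_pair.AE_integrable_fst'[of g] i by (auto simp: lborel_prod)
  then have "AE x in lborel. ennreal \<bar>rho f x - rho g x\<bar> \<le> (\<integral>\<^sup>+v. ennreal \<bar>f (x, v) - g (x, v)\<bar> \<partial>lborel)"
  proof eventually_elim
    case (elim x)
    have "rho f x - rho g x = (\<integral>v. f (x, v) - g (x, v) \<partial>lborel)"
      unfolding rho_def using elim by simp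
    then show ?case using integral_norm_bound_ennreal[of lborel "\<lambda>v. f (x, v) - g (x, v)"] elim by simp
  qed
  then have "(\<integral>\<^sup>+x. ennreal \<bar>rho f x - rho g x\<bar> \<partial>lborel) \<le> (\<integral>\<^sup>+x. \<integral>\<^sup>+v. ennreal \<bar>f (x, v) - g (x, v)\<bar> \<partial>lborel \<partial>lborel)"
    by (rule nn_integral_mono_AE)
  also have "\<dots> = (\<integral>\<^sup>+z. ennreal \<bar>f z - g z\<bar> \<partial>lborel)"
    by (subst nn_integral_phase) auto
  finally show ?thesis .
qed

text \<open>The square of the triangle inequality with weight \<open>t\<close>: the coefficient of
  the reference energy comes arbitrarily close to 1, which keeps the limiting comparison
  sharp.\<close>

lemma field_energy_perturb:
  assumes p: "dens M A p" and q: "dens M' A' q" and t: "0 < t"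
    and d: "(\<integral>\<^sup>+x. ennreal (norm (fld p x - fld q x) ^ 2) \<partial>lborel) \<le> ennreal D" "0 \<le> D"
  shows "field_energy p \<le> (1 + t) * field_energy q + (1 + 1 / t) * D"
proof -
  have [measurable]: "fld p \<in> borel_measurable borel" "fld q \<in> borel_measurable borel"
    using densD(1)[OF p] densD(1)[OF q] by measurable
  have "ennreal (field_energy p) \<le> (\<integral>\<^sup>+x. ennreal (1 + t) * ennreal (norm (fld q x) ^ 2) + ennreal (1 + 1 / t) * ennreal (norm (fld p x - fld q x) ^ 2) \<partial>lborel)"
    unfolding ennreal_field_energy[OF p]
  proof (rule nn_integral_mono)
    fix x
    define a b where "a = norm (fld q x)" and "b = norm (fld p x - fld q x)"
    have "norm (fld p x) \<le> a + b" unfolding a_def b_def by norm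
    then have "norm (fld p x) ^ 2 \<le> (a + b)\<^sup>2" by (intro power_mono) auto
    also have "\<dots> = a\<^sup>2 + b\<^sup>2 + 2 * a * b" by (simp add: power2_sum)
    also have "2 * a * b \<le> t * a\<^sup>2 + 1 / t * b\<^sup>2"
    proof -
      have "2 * a * b * t \<le> t * (t * a\<^sup>2) + b\<^sup>2"
        using sum_squares_bound[of "t * a" b] by (simp add: power2_eq_square mult_ac)
      then show ?thesis using t by (simp add: field_simps)
    qed
    finally have "norm (fld p x) ^ 2 \<le> (1 + t) * a\<^sup>2 + (1 + 1 / t) * b\<^sup>2" by (simp add: algebra_simps)
    then have "ennreal (norm (fld p x) ^ 2) \<le> ennreal ((1 + t) * a\<^sup>2 + (1 + 1 / t) * b\<^sup>2)" by (rule ennreal_leI)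
    also have "\<dots> = ennreal ((1 + t) * a\<^sup>2) + ennreal ((1 + 1 / t) * b\<^sup>2)" using t by (intro ennreal_plus) auto
    also have "\<dots> = ennreal (1 + t) * ennreal (a\<^sup>2) + ennreal (1 + 1 / t) * ennreal (b\<^sup>2)"
      using t by (intro arg_cong2[where f = "(+)"] ennreal_mult') auto
    finally show "ennreal (norm (fld p x) ^ 2) \<le> ennreal (1 + t) * ennreal (norm (fld q x) ^ 2) + ennreal (1 + 1 / t) * ennreal (norm (fld p x - fld q x) ^ 2)"
      unfolding a_def b_def .
  qed
  also have "\<dots> = ennreal (1 + t) * ennreal (field_energy q) + ennreal (1 + 1 / t) * (\<integral>\<^sup>+x. ennreal (norm (fld p x - fld q x) ^ 2) \<partial>lborel)"
    unfolding ennreal_field_energy[OF q] by (subst nn_integral_add) (auto simp: nn_integral_cmult)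
  also have "\<dots> \<le> ennreal (1 + t) * ennreal (field_energy q) + ennreal (1 + 1 / t) * ennreal D"
    by (intro add_left_mono mult_left_mono d) simp
  also have "\<dots> = ennreal ((1 + t) * field_energy q + (1 + 1 / t) * D)"
    using t d field_energy_nonneg[of q] by (subst ennreal_plus) (auto simp: ennreal_mult)
  finally show ?thesis
    using t d field_energy_nonneg[of q] by (subst (asm) ennreal_le_iff) auto
qed

section \<open>Weak convergence\<close>

text \<open>Where the minimum is not \<open>h\<close>, one has
  \<open>h > t * b powr (q - 1)\<close>, so \<open>b\<close> is at most
  \<open>(h / t) powr (p - 1)\<close>. The first term is dominated by \<open>t * b powr q\<close>
  and vanishes with \<open>h\<close>; the second has a coefficient that is small for large
  \<open>t\<close>.\<close>

lemma young_split:
  fixes h b t p q :: real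
  assumes "0 \<le> h" "0 \<le> b" "0 < t" "1 < p" and q: "q = p / (p - 1)"
  shows "h * b \<le> min h (t * b powr (q - 1)) * b + t powr (1 - p) * h powr p"
proof (cases "h \<le> t * b powr (q - 1)")
  case True
  then show ?thesis by simp
next
  case False
  then have lt: "t * b powr (q - 1) < h" by simp
  have h: "0 < h" using lt assms by (meson le_less_trans mult_nonneg_nonneg powr_ge_zero less_imp_le)
  have q1: "q - 1 = 1 / (p - 1)" using assms by (simp add: q field_simps)
  have b: "b = (b powr (q - 1)) powr (p - 1)" unfolding powr_powr q1 using assms by simp
  have "b powr (q - 1) \<le> h / t" using lt assms(3) by (simp add: pos_le_divide_eq mult.commute less_imp_le)
  then have "(b powr (q - 1)) powr (p - 1) \<le> (h / t) powr (p - 1)" using assms by (intro powr_mono2) auto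
  also have "\<dots> = h powr (p - 1) * t powr (1 - p)" using h assms by (simp add: powr_divide powr_diff)
  finally have "b \<le> h powr (p - 1) * t powr (1 - p)" using b by simp
  then have "h * b \<le> h * (h powr (p - 1) * t powr (1 - p))" using h by (intro mult_left_mono) auto
  also have "\<dots> = t powr (1 - p) * h powr p" using h by (simp add: powr_diff)
  finally show ?thesis using assms by (simp add: add_increasing)
qed

text \<open>The integral of \<open>\<bar>F k z - f z\<bar> * \<bar>g z\<bar>\<close> tends to 0:
  after \<open>young_split\<close> one part converges by domination and the other is uniformly small
  by the L^p bound. Fatou puts the limit into L^p.\<close>

lemma weak_Lp_conv_of_AE:
  fixes F :: "nat \<Rightarrow> phase_fun" and f :: phase_fun
  assumes p: "1 < p" and F: "\<And>k. phase (F k)" and f: "phase f"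
    and B: "\<And>k. (\<integral>\<^sup>+z. ennreal (F k z powr p) \<partial>lborel) \<le> ennreal B" "0 \<le> B"
    and ae: "AE z in lborel. (\<lambda>k. F k z) \<longlonglongrightarrow> f z"
  shows "weak_Lp_conv p F f"
proof -
  have [measurable]: "F k \<in> borel_measurable lborel" "f \<in> borel_measurable lborel" for k
    using phaseD(1)[OF F[of k]] phaseD(1)[OF f] by simp_all
  have nn: "0 \<le> F k z" "0 \<le> f z" for k z using phaseD(2)[OF F] phaseD(2)[OF f] by auto
  have Bf: "(\<integral>\<^sup>+z. ennreal (f z powr p) \<partial>lborel) \<le> ennreal B"
  proof -
    have "(\<integral>\<^sup>+z. ennreal (f z powr p) \<partial>lborel) = (\<integral>\<^sup>+z. liminf (\<lambda>k. ennreal (F k z powr p)) \<partial>lborel)"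
    proof (rule nn_integral_cong_AE)
      show "AE z in lborel. ennreal (f z powr p) = liminf (\<lambda>k. ennreal (F k z powr p))"
        using ae
      proof eventually_elim
        case (elim z)
        have "(\<lambda>k. F k z powr p) \<longlonglongrightarrow> f z powr p"
          using p nn by (intro tendsto_powr' elim tendsto_const) auto
        then have "(\<lambda>k. ennreal (F k z powr p)) \<longlonglongrightarrow> ennreal (f z powr p)" by (rule tendsto_ennrealI)
        then show ?case by (metis lim_imp_Liminf trivial_limit_sequentially)
      qed
    qed
    also have "\<dots> \<le> liminf (\<lambda>k. \<integral>\<^sup>+z. ennreal (F k z powr p) \<partial>lborel)" by (rule nn_integral_liminf) measurable
    also have "\<dots> \<le> limsup (\<lambda>k. \<integral>\<^sup>+z. ennreal (F k z powr p) \<partial>lborel)" by (rule Liminf_le_Limsup) simp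
    also have "\<dots> \<le> ennreal B" using B(1) by (intro Limsup_bounded) simp
    finally show ?thesis .
  qed
  have inLp: "in_Lp p u" if "u \<in> borel_measurable lborel" "\<And>z. 0 \<le> u z" "(\<integral>\<^sup>+z. ennreal (u z powr p) \<partial>lborel) \<le> ennreal B" for u
    unfolding in_Lp_def using that le_less_trans[OF that(3) ennreal_less_top]
    by (auto intro!: integrableI_nonneg)
  define h where "h k z = \<bar>F k z - f z\<bar>" for k z
  have [measurable]: "h k \<in> borel_measurable lborel" for k unfolding h_def[abs_def] by measurable
  have h0: "0 \<le> h k z" for k z by (simp add: h_def)
  have Bh: "(\<integral>\<^sup>+z. ennreal (h k z powr p) \<partial>lborel) \<le> ennreal (2 * B)" for k
  proof -
    have "(\<integral>\<^sup>+z. ennreal (h k z powr p) \<partial>lborel) \<le> (\<integral>\<^sup>+z. ennreal (F k z powr p) + ennreal (f z powr p) \<partial>lborel)"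
    proof (rule nn_integral_mono)
      fix z
      have "h k z powr p \<le> (max (F k z) (f z)) powr p" using nn(1)[of k z] nn(2)[of z] p unfolding h_def by (intro powr_mono2) auto
      also have "\<dots> \<le> F k z powr p + f z powr p" by (simp add: max_def)
      finally show "ennreal (h k z powr p) \<le> ennreal (F k z powr p) + ennreal (f z powr p)"
        by (simp add: ennreal_plus[symmetric] ennreal_leI del: ennreal_plus)
    qed
    also have "\<dots> = (\<integral>\<^sup>+z. ennreal (F k z powr p) \<partial>lborel) + (\<integral>\<^sup>+z. ennreal (f z powr p) \<partial>lborel)"
      by (rule nn_integral_add) measurable
    also have "\<dots> \<le> ennreal B + ennreal B" by (intro add_mono B Bf)
    also have "\<dots> = ennreal (2 * B)" using B(2) by (simp add: ennreal_plus[symmetric] del: ennreal_plus)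
    finally show ?thesis .
  qed
  have conv: "(\<lambda>k. \<integral>z. F k z * g z \<partial>lborel) \<longlonglongrightarrow> (\<integral>z. f z * g z \<partial>lborel)" if g: "in_Lp (p / (p - 1)) g" for g
  proof -
    define q where "q = p / (p - 1)"
    have q: "1 < q" "q - 1 = 1 / (p - 1)" using p by (auto simp: q_def field_simps)
    have [measurable]: "g \<in> borel_measurable lborel" using g by (simp add: in_Lp_def)
    have gi: "integrable lborel (\<lambda>z. \<bar>g z\<bar> powr q)" using g by (simp add: in_Lp_def q_def)
    have gfin: "(\<integral>\<^sup>+z. ennreal (t * \<bar>g z\<bar> powr q) \<partial>lborel) < \<infinity>" if "0 < t" for t
      using integrable_mult_right[OF gi, of t] that unfolding integrable_iff_bounded by (simp add: abs_mult)
    have bq: "b powr (q - 1) * b = b powr q" if "0 \<le> b" for b :: real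
      using that by (cases "b = 0") (auto simp: powr_diff)
    have split: "ennreal (u * \<bar>g z\<bar>) \<le> ennreal (min u (t * \<bar>g z\<bar> powr (q - 1)) * \<bar>g z\<bar>) + ennreal (t powr (1 - p)) * ennreal (u powr p)"
      if "0 \<le> u" "0 < t" for u t z
    proof -
      have "ennreal (u * \<bar>g z\<bar>) \<le> ennreal (min u (t * \<bar>g z\<bar> powr (q - 1)) * \<bar>g z\<bar> + t powr (1 - p) * u powr p)"
        by (intro ennreal_leI young_split) (use that p q_def in auto)
      also have "\<dots> = ennreal (min u (t * \<bar>g z\<bar> powr (q - 1)) * \<bar>g z\<bar>) + ennreal (t powr (1 - p) * u powr p)"
        using that by (intro ennreal_plus) auto
      finally show ?thesis by (simp add: ennreal_mult)
    qed
    have dom: "ennreal (min u (t * \<bar>g z\<bar> powr (q - 1)) * \<bar>g z\<bar>) \<le> ennreal (t * \<bar>g z\<bar> powr q)" for u t z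
    proof (rule ennreal_leI)
      have "min u (t * \<bar>g z\<bar> powr (q - 1)) * \<bar>g z\<bar> \<le> (t * \<bar>g z\<bar> powr (q - 1)) * \<bar>g z\<bar>" by (intro mult_right_mono) auto
      also have "\<dots> = t * \<bar>g z\<bar> powr q" using bq[of "\<bar>g z\<bar>"] by (simp add: mult.assoc)
      finally show "min u (t * \<bar>g z\<bar> powr (q - 1)) * \<bar>g z\<bar> \<le> t * \<bar>g z\<bar> powr q" .
    qed
    have int: "integrable lborel (\<lambda>z. u z * g z)"
      if [measurable]: "u \<in> borel_measurable lborel" and u: "\<And>z. 0 \<le> u z" "(\<integral>\<^sup>+z. ennreal (u z powr p) \<partial>lborel) \<le> ennreal B" for u
    proof (rule integrableI_bounded)
      have "(\<integral>\<^sup>+z. ennreal (norm (u z * g z)) \<partial>lborel) \<le> (\<integral>\<^sup>+z. ennreal (1 * \<bar>g z\<bar> powr q) + ennreal (1 powr (1 - p)) * ennreal (u z powr p) \<partial>lborel)"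
      proof (rule nn_integral_mono)
        fix z
        have "ennreal (norm (u z * g z)) = ennreal (u z * \<bar>g z\<bar>)" using u(1)[of z] by (simp add: abs_mult)
        also have "\<dots> \<le> ennreal (min (u z) (1 * \<bar>g z\<bar> powr (q - 1)) * \<bar>g z\<bar>) + ennreal (1 powr (1 - p)) * ennreal (u z powr p)"
          by (rule split[OF u(1)]) simp
        also have "\<dots> \<le> ennreal (1 * \<bar>g z\<bar> powr q) + ennreal (1 powr (1 - p)) * ennreal (u z powr p)"
          by (intro add_right_mono dom)
        finally show "ennreal (norm (u z * g z)) \<le> ennreal (1 * \<bar>g z\<bar> powr q) + ennreal (1 powr (1 - p)) * ennreal (u z powr p)" .
      qed
      also have "\<dots> = (\<integral>\<^sup>+z. ennreal (1 * \<bar>g z\<bar> powr q) \<partial>lborel) + (\<integral>\<^sup>+z. ennreal (u z powr p) \<partial>lborel)"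
        by (subst nn_integral_add) auto
      also have "\<dots> < \<infinity>" using gfin[of 1] le_less_trans[OF u(2) ennreal_less_top] by simp
      finally show "(\<integral>\<^sup>+z. ennreal (norm (u z * g z)) \<partial>lborel) < \<infinity>" .
    qed measurable
    have hg: "(\<lambda>k. \<integral>\<^sup>+z. ennreal (h k z * \<bar>g z\<bar>) \<partial>lborel) \<longlonglongrightarrow> 0"
    proof (rule order_tendstoI)
      fix a :: ennreal assume "0 < a"
      then obtain b where b: "0 < b" "b < a" using dense by blast
      then have "b < top" using less_le_trans[OF b(2) top_greatest] by simp
      then obtain e where "b = ennreal e" "0 \<le> e" by (cases b) auto
      then have e: "0 < e" "ennreal e < a" using b by auto
      \<comment> \<open>This makes \<open>t powr (1 - p) = e / (4 * (B + 1))\<close>, so the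
        uniformly small part is at most \<open>e / 2\<close>.\<close>
      define t where "t = (4 * (B + 1) / e) powr (1 / (p - 1))"
      have t: "0 < t" using B(2) e by (simp add: t_def)
      have "1 / (p - 1) * (1 - p) = - 1" using p by (simp add: field_simps)
      then have "t powr (1 - p) = (4 * (B + 1) / e) powr (- 1)" unfolding t_def powr_powr by (simp only:)
      then have tp: "t powr (1 - p) = e / (4 * (B + 1))" using B(2) e by (simp add: powr_minus_divide)
      have small: "t powr (1 - p) * (2 * B) \<le> e / 2"
      proof -
        have "t powr (1 - p) * (2 * B) = e / 2 * (B / (B + 1))" unfolding tp using B(2) by (simp add: field_simps)
        also have "\<dots> \<le> e / 2 * 1" using B(2) e by (intro mult_left_mono) auto
        finally show ?thesis by simp
      qed
      have "(\<lambda>k. \<integral>\<^sup>+z. ennreal (min (h k z) (t * \<bar>g z\<bar> powr (q - 1)) * \<bar>g z\<bar>) \<partial>lborel) \<longlonglongrightarrow> (\<integral>\<^sup>+z. (0::ennreal) \<partial>(lborel :: ((real^3) \<times> (real^3)) measure))"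
      proof (rule nn_integral_dominated_convergence[where w = "\<lambda>z. ennreal (t * \<bar>g z\<bar> powr q)"])
        show "AE z in lborel. (\<lambda>k. ennreal (min (h k z) (t * \<bar>g z\<bar> powr (q - 1)) * \<bar>g z\<bar>)) \<longlonglongrightarrow> 0"
          using ae
        proof eventually_elim
          case (elim z)
          have "(\<lambda>k. h k z) \<longlonglongrightarrow> \<bar>f z - f z\<bar>" unfolding h_def by (intro tendsto_intros elim)
          then have "(\<lambda>k. min (h k z) (t * \<bar>g z\<bar> powr (q - 1)) * \<bar>g z\<bar>) \<longlonglongrightarrow> min \<bar>f z - f z\<bar> (t * \<bar>g z\<bar> powr (q - 1)) * \<bar>g z\<bar>"
            by (intro tendsto_intros)
          moreover have "min \<bar>f z - f z\<bar> (t * \<bar>g z\<bar> powr (q - 1)) * \<bar>g z\<bar> = 0" using t by simp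
          ultimately show ?case using tendsto_ennrealI by fastforce
        qed
        show "AE z in lborel. ennreal (min (h k z) (t * \<bar>g z\<bar> powr (q - 1)) * \<bar>g z\<bar>) \<le> ennreal (t * \<bar>g z\<bar> powr q)" for k
          by (intro AE_I2 dom)
        show "(\<integral>\<^sup>+z. ennreal (t * \<bar>g z\<bar> powr q) \<partial>lborel) < \<infinity>" by (rule gfin[OF t])
      qed measurable
      then have "(\<lambda>k. \<integral>\<^sup>+z. ennreal (min (h k z) (t * \<bar>g z\<bar> powr (q - 1)) * \<bar>g z\<bar>) \<partial>lborel) \<longlonglongrightarrow> 0" by simp
      moreover have "0 < ennreal (e / 2)" using e by simp
      ultimately have "\<forall>\<^sub>F k in sequentially. (\<integral>\<^sup>+z. ennreal (min (h k z) (t * \<bar>g z\<bar> powr (q - 1)) * \<bar>g z\<bar>) \<partial>lborel) < ennreal (e / 2)"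
        by (rule order_tendstoD(2))
      then show "\<forall>\<^sub>F k in sequentially. (\<integral>\<^sup>+z. ennreal (h k z * \<bar>g z\<bar>) \<partial>lborel) < a"
      proof eventually_elim
        case (elim k)
        have "(\<integral>\<^sup>+z. ennreal (h k z * \<bar>g z\<bar>) \<partial>lborel) \<le> (\<integral>\<^sup>+z. ennreal (min (h k z) (t * \<bar>g z\<bar> powr (q - 1)) * \<bar>g z\<bar>) + ennreal (t powr (1 - p)) * ennreal (h k z powr p) \<partial>lborel)"
          by (intro nn_integral_mono split h0 t)
        also have "\<dots> = (\<integral>\<^sup>+z. ennreal (min (h k z) (t * \<bar>g z\<bar> powr (q - 1)) * \<bar>g z\<bar>) \<partial>lborel) + ennreal (t powr (1 - p)) * (\<integral>\<^sup>+z. ennreal (h k z powr p) \<partial>lborel)"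
          by (subst nn_integral_add) (auto simp: nn_integral_cmult)
        also have "\<dots> \<le> ennreal (e / 2) + ennreal (t powr (1 - p)) * ennreal (2 * B)"
          using elim by (intro add_mono mult_left_mono Bh) auto
        also have "\<dots> = ennreal (e / 2 + t powr (1 - p) * (2 * B))"
          using e B(2) by (simp add: ennreal_mult[symmetric] ennreal_plus[symmetric] del: ennreal_plus)
        also have "\<dots> \<le> ennreal e" using small by (intro ennreal_leI) simp
        also have "\<dots> < a" by (rule e(2))
        finally show ?case .
      qed
    qed simp
    have "(\<lambda>k. ennreal (norm ((\<integral>z. F k z * g z \<partial>lborel) - (\<integral>z. f z * g z \<partial>lborel)))) \<longlonglongrightarrow> 0"
    proof (rule tendsto_sandwich[OF _ _ tendsto_const hg])
      show "\<forall>\<^sub>F k in sequentially. ennreal (norm ((\<integral>z. F k z * g z \<partial>lborel) - (\<integral>z. f z * g z \<partial>lborel))) \<le> (\<integral>\<^sup>+z. ennreal (h k z * \<bar>g z\<bar>) \<partial>lborel)"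
      proof (intro always_eventually allI)
        fix k
        have i: "integrable lborel (\<lambda>z. F k z * g z)" "integrable lborel (\<lambda>z. f z * g z)"
          by (auto intro!: int nn B Bf)
        have "(\<integral>z. F k z * g z \<partial>lborel) - (\<integral>z. f z * g z \<partial>lborel) = (\<integral>z. F k z * g z - f z * g z \<partial>lborel)"
          using i by simp
        also have "ennreal (norm \<dots>) \<le> (\<integral>\<^sup>+z. ennreal (norm (F k z * g z - f z * g z)) \<partial>lborel)"
          using i by (intro integral_norm_bound_ennreal) auto
        also have "\<dots> = (\<integral>\<^sup>+z. ennreal (h k z * \<bar>g z\<bar>) \<partial>lborel)"
          by (intro nn_integral_cong) (simp add: h_def abs_mult[symmetric] left_diff_distrib)
        finally show "ennreal (norm ((\<integral>z. F k z * g z \<partial>lborel) - (\<integral>z. f z * g z \<partial>lborel))) \<le> (\<integral>\<^sup>+z. ennreal (h k z * \<bar>g z\<bar>) \<partial>lborel)" .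
      qed
    qed simp
    then have "(\<lambda>k. ennreal (norm ((\<integral>z. F k z * g z \<partial>lborel) - (\<integral>z. f z * g z \<partial>lborel)))) \<longlonglongrightarrow> ennreal 0" by simp
    then have "(\<lambda>k. enn2real (ennreal (norm ((\<integral>z. F k z * g z \<partial>lborel) - (\<integral>z. f z * g z \<partial>lborel))))) \<longlonglongrightarrow> 0"
      by (rule tendsto_enn2real) simp
    then show ?thesis by (simp add: tendsto_rabs_zero_iff LIM_zero_iff)
  qed
  show ?thesis unfolding weak_Lp_conv_def using conv inLp[OF _ nn(1) B(1)] inLp[OF _ nn(2) Bf] by simp
qed

section \<open>Minimizing sequences\<close>

lemma shift_eq: "shift f a z = f (z + (a, 0))"
  by (cases z) (simp add: shift_def)

text \<open>\<open>G\<close> sees the velocity and the value of \<open>f\<close>, both unaffected by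
  a shift in position; mass, kinetic and Casimir energy are all of this form.\<close>

lemma nn_integral_shift:
  fixes G :: "real^3 \<Rightarrow> real \<Rightarrow> ennreal"
  assumes G: "(\<lambda>z. G (snd z) (f z)) \<in> borel_measurable borel"
  shows "(\<integral>\<^sup>+z. G (snd z) (shift f a z) \<partial>lborel) = (\<integral>\<^sup>+z. G (snd z) (f z) \<partial>lborel)"
  using nn_integral_lborel_translate[OF G, of "(a, 0)"] by (simp add: shift_eq)

lemma phase_shift:
  assumes "phase f"
  shows "phase (shift f a)"
proof -
  have "(\<lambda>z. f (z + (a, 0))) \<in> borel_measurable borel"
    by (rule measurable_compose[OF _ phaseD(1)[OF assms]])
       (intro borel_measurable_continuous_onI continuous_intros)
  then show ?thesis unfolding phase_def shift_eq[abs_def] using phaseD(2)[OF assms] by auto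
qed

lemma rho_shift: "rho (shift f a) x = rho f (x + a)"
  by (simp add: rho_def shift_def)

lemma fld_translate:
  assumes [measurable]: "p \<in> borel_measurable borel"
  shows "fld (\<lambda>x. p (x + a)) x = fld p (x + a)"
proof -
  have "fld p (x + a) = (\<integral>y. (p (a + 1 *\<^sub>R y) / norm (x + a - (a + 1 *\<^sub>R y)) ^ 3) *\<^sub>R (x + a - (a + 1 *\<^sub>R y)) \<partial>lborel)"
    unfolding fld_def
    using integral_lborel_affine[of "\<lambda>y. (p y / norm (x + a - y) ^ 3) *\<^sub>R (x + a - y)" 1 a] by simp
  then show ?thesis by (simp add: fld_def add.commute)
qed

lemma field_energy_shift:
  assumes f: "phase f"
  shows "field_energy (rho (shift f a)) = field_energy (rho f)"
proof -
  note [measurable] = measurable_rho[OF phaseD(1)[OF f]]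
  have "rho (shift f a) = (\<lambda>x. rho f (x + a))" by (simp add: fun_eq_iff rho_shift)
  then have "field_energy (rho (shift f a)) = (\<integral>x. norm (fld (rho f) (x + a)) ^ 2 \<partial>lborel)"
    unfolding field_energy_def by (simp add: fld_translate)
  also have "\<dots> = field_energy (rho f)"
    unfolding field_energy_def using integral_lborel_affine[of "\<lambda>x. norm (fld (rho f) x) ^ 2" 1 a] by (simp add: add.commute)
  finally show ?thesis .
qed

lemma smass_shift:
  assumes f: "phase f"
  shows "smass (shift f a) (ball 0 R) = smass f (ball a R)"
proof -
  note [measurable] = measurable_rho[OF phaseD(1)[OF f]]
  have "(\<integral>\<^sup>+x. ennreal (rho f (x + a)) * indicator (ball 0 R) x \<partial>lborel) = (\<integral>\<^sup>+x. (\<lambda>y. ennreal (rho f y) * indicator (ball a R) y) (x + a) \<partial>lborel)"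
    by (intro nn_integral_cong) (auto simp: indicator_def dist_norm norm_minus_commute)
  also have "\<dots> = (\<integral>\<^sup>+y. ennreal (rho f y) * indicator (ball a R) y \<partial>lborel)"
    by (rule nn_integral_lborel_translate) measurable
  finally show ?thesis by (simp add: smass_def rho_shift)
qed

context casimir
begin

lemma Pfun_shift:
  assumes f: "phase f"
  shows "Pfun Q (shift f a) = Pfun Q f"
proof -
  have Qm: "(\<lambda>z. ennreal (Q (f z))) \<in> borel_measurable borel"
    using phaseD[OF f] by (intro measurable_compose[OF measurable_Q_comp measurable_ennreal]) auto
  have km: "(\<lambda>z. ennreal (norm (snd z) ^ 2 / 2 * f z)) \<in> borel_measurable borel"
    using measurable_compose[OF measurable_kinetic[OF phaseD(1)[OF f]] measurable_ennreal] by simp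
  have "Cas Q (shift f a) = Cas Q f"
    unfolding Cas_def using nn_integral_shift[of "\<lambda>v s. ennreal (Q s)" f] Qm by simp
  moreover have "Ekin (shift f a) = Ekin f"
    unfolding Ekin_def using nn_integral_shift[of "\<lambda>v s. ennreal (norm v ^ 2 / 2 * s)" f] km by simp
  ultimately show ?thesis by (simp add: Pfun_def)
qed

lemma shift_in_FM:
  assumes f: "f \<in> FM Q M"
  shows "shift f a \<in> FM Q M"
proof (rule FM_I[OF phase_shift[OF FM_D(1)[OF f]]])
  have "(\<lambda>z. ennreal (f z)) \<in> borel_measurable borel" using phaseD(1)[OF FM_D(1)[OF f]] by measurable
  then show "(\<integral>\<^sup>+z. ennreal (shift f a z) \<partial>lborel) = ennreal M"
    using nn_integral_shift[of "\<lambda>v s. ennreal s" f] FM_D(2)[OF f] by simp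
  show "0 \<le> M" "Pfun Q (shift f a) < \<infinity>"
    using FM_D(3,7)[OF f] Pfun_shift[OF FM_D(1)[OF f]] by auto
qed

lemma HC_shift: "phase f \<Longrightarrow> HC Q (shift f a) = HC Q f"
  by (simp add: HC_eq Pfun_shift field_energy_shift)

text \<open>Above \<open>F0\<close> the power is controlled by (Q1), below \<open>F0\<close> by a
  multiple of \<open>f\<close> itself, that is, by the mass.\<close>

lemma FM_Lp_bound:
  assumes f: "f \<in> FM Q M" and P: "enn2real (Pfun Q f) \<le> P" "0 \<le> P"
  shows "(\<integral>\<^sup>+z. ennreal (f z powr (1 + 1 / k1)) \<partial>lborel) \<le> ennreal (F0 powr (1 / k1) * M + P / C1)"
proof -
  note F = FM_D[OF f]
  have [measurable]: "f \<in> borel_measurable lborel" using phaseD(1)[OF F(1)] by simp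
  have [measurable]: "(\<lambda>z. Q (f z)) \<in> borel_measurable lborel" using phaseD[OF F(1)] by (intro measurable_Q_comp) auto
  have "(\<integral>\<^sup>+z. ennreal (f z powr (1 + 1 / k1)) \<partial>lborel) \<le> (\<integral>\<^sup>+z. ennreal (F0 powr (1 / k1)) * ennreal (f z) + ennreal (1 / C1) * ennreal (Q (f z)) \<partial>lborel)"
  proof (rule nn_integral_mono)
    fix z
    have s: "0 \<le> f z" using phaseD(2)[OF F(1)] .
    have "f z powr (1 + 1 / k1) \<le> F0 powr (1 / k1) * f z + 1 / C1 * Q (f z)"
    proof (cases "f z \<le> F0")
      case True
      have "f z powr (1 + 1 / k1) = f z powr (1 / k1) * f z" using s by (cases "f z = 0") (auto simp: powr_add)
      also have "\<dots> \<le> F0 powr (1 / k1) * f z" using s True k_bounds by (intro mult_right_mono powr_mono2) auto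
      moreover have "0 \<le> 1 / C1 * Q (f z)" using Q_nonneg s const_pos by simp
      ultimately show ?thesis by linarith
    next
      case False
      then have "C1 * f z powr (1 + 1 / k1) \<le> Q (f z)" using Q1 by simp
      then have "f z powr (1 + 1 / k1) \<le> 1 / C1 * Q (f z)" using const_pos by (simp add: field_simps)
      moreover have "0 \<le> F0 powr (1 / k1) * f z" using s by simp
      ultimately show ?thesis by linarith
    qed
    then have "ennreal (f z powr (1 + 1 / k1)) \<le> ennreal (F0 powr (1 / k1) * f z + 1 / C1 * Q (f z))" by (rule ennreal_leI)
    also have "\<dots> = ennreal (F0 powr (1 / k1) * f z) + ennreal (1 / C1 * Q (f z))"
      using s Q_nonneg const_pos by (intro ennreal_plus) auto
    also have "\<dots> = ennreal (F0 powr (1 / k1)) * ennreal (f z) + ennreal (1 / C1) * ennreal (Q (f z))"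
      using const_pos by (intro arg_cong2[where f = "(+)"] ennreal_mult') auto
    finally show "ennreal (f z powr (1 + 1 / k1)) \<le> ennreal (F0 powr (1 / k1)) * ennreal (f z) + ennreal (1 / C1) * ennreal (Q (f z))" .
  qed
  also have "\<dots> = ennreal (F0 powr (1 / k1)) * ennreal M + ennreal (1 / C1) * Cas Q f"
    unfolding Cas_def F(2)[symmetric] by (subst nn_integral_add) (auto simp: nn_integral_cmult)
  also have "\<dots> \<le> ennreal (F0 powr (1 / k1)) * ennreal M + ennreal (1 / C1) * ennreal P"
  proof (intro add_left_mono mult_left_mono)
    have "Cas Q f \<le> Pfun Q f" by (simp add: Pfun_def)
    also have "\<dots> \<le> ennreal P" using F(4) P by (metis ennreal_leI)
    finally show "Cas Q f \<le> ennreal P" .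
  qed simp
  also have "\<dots> = ennreal (F0 powr (1 / k1) * M + P / C1)"
    using F(3) P const_pos by (simp add: ennreal_mult[symmetric] ennreal_plus[symmetric] del: ennreal_plus)
  finally show ?thesis .
qed

text \<open>Casimir and kinetic densities are added before Fatou is applied, so the bound passes to
  their sum. It is used twice: with a crude constant for admissibility and with a sharp one for
  minimality.\<close>

lemma Pfun_Fatou:
  assumes f: "\<And>n. phase (f n)" and f0: "phase f0" and ae: "AE z in lborel. (\<lambda>n. f n z) \<longlonglongrightarrow> f0 z"
    and ev: "\<forall>\<^sub>F n in sequentially. Pfun Q (f n) \<le> c"
  shows "Pfun Q f0 \<le> c"
proof -
  define G where "G u z = ennreal (Q (u z)) + ennreal (norm (snd z) ^ 2 / 2 * u z)" for u :: phase_fun and z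
  have Qm: "(\<lambda>z. ennreal (Q (u z))) \<in> borel_measurable lborel" if "phase u" for u
    using phaseD[OF that] measurable_compose[OF measurable_Q_comp[of u borel] measurable_ennreal] by auto
  have km: "(\<lambda>z. ennreal (norm (snd z) ^ 2 / 2 * u z)) \<in> borel_measurable lborel" if "phase u" for u
    using measurable_compose[OF measurable_kinetic[OF phaseD(1)[OF that]] measurable_ennreal] by simp
  have PG: "Pfun Q u = (\<integral>\<^sup>+z. G u z \<partial>lborel)" if "phase u" for u
    unfolding Pfun_def Cas_def Ekin_def G_def using Qm[OF that] km[OF that] by (rule nn_integral_add[symmetric])
  have Gm: "G u \<in> borel_measurable lborel" if "phase u" for u
    unfolding G_def[abs_def] using Qm[OF that] km[OF that] by measurable
  have "Pfun Q f0 = (\<integral>\<^sup>+z. liminf (\<lambda>n. G (f n) z) \<partial>lborel)"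
    unfolding PG[OF f0]
  proof (rule nn_integral_cong_AE)
    show "AE z in lborel. G f0 z = liminf (\<lambda>n. G (f n) z)"
      using ae
    proof eventually_elim
      case (elim z)
      have "(\<lambda>n. Q (f n z)) \<longlonglongrightarrow> Q (f0 z)"
        by (rule continuous_on_tendsto_compose[OF Q_continuous elim]) (use phaseD(2)[OF f] phaseD(2)[OF f0] in auto)
      then have "(\<lambda>n. G (f n) z) \<longlonglongrightarrow> G f0 z"
        unfolding G_def by (intro tendsto_add tendsto_ennrealI tendsto_mult tendsto_const elim)
      then show ?case by (metis lim_imp_Liminf trivial_limit_sequentially)
    qed
  qed
  also have "\<dots> \<le> liminf (\<lambda>n. \<integral>\<^sup>+z. G (f n) z \<partial>lborel)" by (rule nn_integral_liminf[OF Gm[OF f]])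
  also have "\<dots> = liminf (\<lambda>n. Pfun Q (f n))" using PG[OF f] by simp
  also have "\<dots> \<le> limsup (\<lambda>n. Pfun Q (f n))" by (rule Liminf_le_Limsup) simp
  also have "\<dots> \<le> c" using ev by (rule Limsup_bounded)
  finally show ?thesis .
qed

text \<open>Conservation of mass gives admissibility and L^1 convergence, and the latter carries
  over to densities and fields. Since the field energies converge, the bound on the total energies
  becomes a sharp bound on the convex part, which Fatou transfers to the limit.\<close>

lemma minimizer_of_AE_limit:
  fixes f :: "nat \<Rightarrow> phase_fun"
  assumes M: "0 < M" and f: "\<And>n. f n \<in> FM Q M" and f0: "phase f0"
    and ae: "AE z in lborel. (\<lambda>n. f n z) \<longlonglongrightarrow> f0 z"
    and lim: "(\<lambda>n. HC Q (f n)) \<longlonglongrightarrow> hM Q M"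
    and d: "\<And>n. dens M A (rho (f n))"
    and P: "\<And>n. enn2real (Pfun Q (f n)) \<le> P" "0 \<le> P"
    and tight: "\<And>e. 0 < e \<Longrightarrow> \<exists>j N. \<forall>n\<ge>N. (\<integral>\<^sup>+x. ennreal (rho (f n) x) * indicator (- ball 0 (real j)) x \<partial>lborel) \<le> ennreal e"
  shows "f0 \<in> FM Q M" "HC Q f0 = hM Q M"
    "(\<lambda>n. \<integral>\<^sup>+x. ennreal (norm (fld (rho (f n)) x - fld (rho f0) x) ^ 2) \<partial>lborel) \<longlonglongrightarrow> 0"
proof -
  note ph = FM_D(1)[OF f]
  have PP: "Pfun Q (f n) \<le> ennreal P" for n using FM_D(4)[OF f[of n]] P(1)[of n] by (metis ennreal_leI)
  have P0: "Pfun Q f0 \<le> ennreal P" by (rule Pfun_Fatou[OF ph f0 ae]) (simp add: PP)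
  have mass: "(\<integral>\<^sup>+z. ennreal (f0 z) \<partial>lborel) = ennreal M"
  proof -
    obtain C where C: "0 \<le> C" "\<And>s. 0 \<le> s \<Longrightarrow> s powr (5/3) \<le> 1 * Q s + C * s"
      using powr_five_thirds_le[of 1] by auto
    show ?thesis
    proof (rule mass_of_AE_limit[OF ph f0 FM_D(2)[OF f] ae tight])
      show "Ekin (f n) \<le> ennreal P" for n
        by (rule order_trans[OF _ PP[of n]]) (simp add: Pfun_def)
      show "(\<integral>\<^sup>+z. ennreal (f n z powr (5/3)) \<partial>lborel) \<le> ennreal (P + C * M)" for n
      proof -
        have [measurable]: "f n \<in> borel_measurable lborel" using phaseD(1)[OF ph[of n]] by simp
        have [measurable]: "(\<lambda>z. Q (f n z)) \<in> borel_measurable lborel" using phaseD[OF ph[of n]] by (intro measurable_Q_comp) auto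
        have "(\<integral>\<^sup>+z. ennreal (f n z powr (5/3)) \<partial>lborel) \<le> (\<integral>\<^sup>+z. ennreal (Q (f n z)) + ennreal C * ennreal (f n z) \<partial>lborel)"
        proof (rule nn_integral_mono)
          fix z
          have s: "0 \<le> f n z" using phaseD(2)[OF ph] .
          have "ennreal (f n z powr (5/3)) \<le> ennreal (Q (f n z) + C * f n z)" using C(2)[OF s] by (intro ennreal_leI) simp
          also have "\<dots> = ennreal (Q (f n z)) + ennreal (C * f n z)" using s C(1) Q_nonneg by (intro ennreal_plus) auto
          finally show "ennreal (f n z powr (5/3)) \<le> ennreal (Q (f n z)) + ennreal C * ennreal (f n z)" using C(1) by (simp add: ennreal_mult')
        qed
        also have "\<dots> = Cas Q (f n) + ennreal C * ennreal M"
          unfolding Cas_def FM_D(2)[OF f[of n], symmetric] by (subst nn_integral_add) (auto simp: nn_integral_cmult)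
        also have "\<dots> \<le> ennreal P + ennreal C * ennreal M"
          by (intro add_right_mono order_trans[OF _ PP[of n]]) (simp add: Pfun_def)
        also have "\<dots> = ennreal (P + C * M)" using P(2) C(1) M by (simp add: ennreal_mult[symmetric] ennreal_plus[symmetric] del: ennreal_plus)
        finally show ?thesis .
      qed
    qed (use P C M in auto)
  qed
  show f0F: "f0 \<in> FM Q M" using M P0 le_less_trans[OF P0 ennreal_less_top] by (intro FM_I[OF f0 mass]) auto
  obtain A0 where d0: "dens M A0 (rho f0)" using FM_dens[of 1] f0F by auto
  have L1: "(\<lambda>n. \<integral>\<^sup>+z. ennreal \<bar>f n z - f0 z\<bar> \<partial>lborel) \<longlonglongrightarrow> 0" by (rule L1_convergence[OF f f0 mass ae])
  have fin: "(\<integral>\<^sup>+z. ennreal (f n z) \<partial>lborel) < \<infinity>" "(\<integral>\<^sup>+z. ennreal (f0 z) \<partial>lborel) < \<infinity>" for n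
    using FM_D(2)[OF f[of n]] mass by auto
  have ev: "\<forall>\<^sub>F n in sequentially. (\<integral>\<^sup>+x. ennreal (norm (fld (rho (f n)) x - fld (rho f0) x) ^ 2) \<partial>lborel) \<le> ennreal e" if e: "0 < e" for e
  proof -
    obtain k where k: "coul_const (A + A0) (1 / real (Suc k)) (1 / real (Suc k)) (1 / real (Suc k)) < e"
      using coul_const_small[OF e, of 1 "A + A0" 1] by auto
    define dl where "dl = 1 / real (Suc k)"
    have dl: "0 < dl" by (simp add: dl_def)
    have "\<forall>\<^sub>F n in sequentially. (\<integral>\<^sup>+z. ennreal \<bar>f n z - f0 z\<bar> \<partial>lborel) < ennreal dl"
      using dl by (intro order_tendstoD(2)[OF L1]) simp
    then show ?thesis
    proof eventually_elim
      case (elim n)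
      have "(\<integral>\<^sup>+x. ennreal \<bar>rho (f n) x - rho f0 x\<bar> \<partial>lborel) \<le> ennreal dl"
        by (rule order_trans[OF rho_L1_le[OF ph fin(1) f0 fin(2)] less_imp_le[OF elim]])
      from fld_diff_square_le[OF d d0 this less_imp_le[OF dl] dl]
      show ?case using k unfolding dl_def[symmetric] by (meson ennreal_leI less_imp_le order_trans)
    qed
  qed
  show "(\<lambda>n. \<integral>\<^sup>+x. ennreal (norm (fld (rho (f n)) x - fld (rho f0) x) ^ 2) \<partial>lborel) \<longlonglongrightarrow> 0"
  proof (rule order_tendstoI)
    fix a :: ennreal assume "0 < a"
    then obtain b where b: "0 < b" "b < a" using dense by blast
    then have "b < top" using less_le_trans[OF b(2) top_greatest] by simp
    then obtain e where "b = ennreal e" "0 \<le> e" by (cases b) auto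
    then have e: "0 < e" "ennreal e < a" using b by auto
    show "\<forall>\<^sub>F n in sequentially. (\<integral>\<^sup>+x. ennreal (norm (fld (rho (f n)) x - fld (rho f0) x) ^ 2) \<partial>lborel) < a"
      using ev[OF e(1)] by eventually_elim (rule le_less_trans[OF _ e(2)])
  qed simp
  have "HC Q f0 \<le> hM Q M"
  proof (rule field_le_epsilon)
    fix e :: real assume e: "0 < e"
    define E where "E = field_energy (rho f0)"
    have E: "0 \<le> E" by (simp add: E_def field_energy_nonneg)
    \<comment> \<open>\<open>t\<close> and \<open>D\<close> bound the two errors of
      \<open>field_energy_perturb\<close> by \<open>e / 3\<close> each; the third
      \<open>e / 3\<close> is the distance of the energies from the infimum.\<close>
    define t where "t = e / (3 * (E + 1))"
    have t: "0 < t" using e E by (simp add: t_def)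
    define D where "D = e / (3 * (1 + 1 / t))"
    have D: "0 < D" using e t by (simp add: D_def add_pos_pos)
    have tE: "t * E \<le> e / 3"
    proof -
      have "t * E = e / 3 * (E / (E + 1))" using E by (simp add: t_def field_simps)
      also have "\<dots> \<le> e / 3 * 1" using e E by (intro mult_left_mono) auto
      finally show ?thesis by simp
    qed
    have tD: "(1 + 1 / t) * D = e / 3"
    proof -
      have "1 + 1 / t \<noteq> 0" using t by (metis add_pos_pos divide_pos_pos less_irrefl zero_less_one)
      moreover have "w * (e / (3 * w)) = e / 3" if "w \<noteq> 0" for w using that by simp
      ultimately show ?thesis unfolding D_def by blast
    qed
    have "\<forall>\<^sub>F n in sequentially. HC Q (f n) < hM Q M + e / 3"
      using e by (intro order_tendstoD(2)[OF lim]) simp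
    then have evr: "\<forall>\<^sub>F n in sequentially. enn2real (Pfun Q (f n)) \<le> hM Q M + E / (8 * pi) + e"
      using ev[OF D]
    proof eventually_elim
      case (elim n)
      have "field_energy (rho (f n)) \<le> (1 + t) * E + (1 + 1 / t) * D"
        unfolding E_def by (rule field_energy_perturb[OF d d0 t elim(2) less_imp_le[OF D]])
      also have "\<dots> \<le> E + 2 * e / 3" using tE tD by (simp add: distrib_right)
      finally have "field_energy (rho (f n)) / (8 * pi) \<le> (E + 2 * e / 3) / (8 * pi)" by (intro divide_right_mono) auto
      also have "\<dots> = E / (8 * pi) + 2 * e / 3 / (8 * pi)" by (rule add_divide_distrib)
      also have "2 * e / 3 / (8 * pi) \<le> 2 * e / 3 / 1" using e pi_gt3 by (intro divide_left_mono) auto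
      finally show "enn2real (Pfun Q (f n)) \<le> hM Q M + E / (8 * pi) + e"
        using elim(1) unfolding HC_eq by simp
    qed
    then have "\<forall>\<^sub>F n in sequentially. Pfun Q (f n) \<le> ennreal (hM Q M + E / (8 * pi) + e)"
    proof eventually_elim
      case (elim n)
      then show ?case using FM_D(4)[OF f[of n]] by (metis ennreal_leI)
    qed
    then have "Pfun Q f0 \<le> ennreal (hM Q M + E / (8 * pi) + e)" by (rule Pfun_Fatou[OF ph f0 ae])
    then have "enn2real (Pfun Q f0) \<le> enn2real (ennreal (hM Q M + E / (8 * pi) + e))"
      by (rule enn2real_mono) simp
    \<comment> \<open>\<open>ennreal\<close> truncates negative numbers to 0, so returning to the
      reals requires the bound to be nonnegative. A single index where it dominates a convex energy
      shows this.\<close>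
    moreover obtain n where "enn2real (Pfun Q (f n)) \<le> hM Q M + E / (8 * pi) + e"
      using eventually_happens[OF evr] by auto
    then have "0 \<le> hM Q M + E / (8 * pi) + e" using enn2real_nonneg[of "Pfun Q (f n)"] by linarith
    ultimately have "enn2real (Pfun Q f0) \<le> hM Q M + E / (8 * pi) + e" by simp
    then show "HC Q f0 \<le> hM Q M + e" unfolding HC_eq E_def by simp
  qed
  then show "HC Q f0 = hM Q M" using hM_le[OF M f0F] by simp
qed

end

section \<open>Extraction of the convergent subsequence\<close>

lemma diagonal_convergent:
  fixes u :: "nat \<Rightarrow> nat \<Rightarrow> real"
  assumes b: "\<And>j n. a \<le> u j n" "\<And>j n. u j n \<le> b"
  shows "\<exists>s. strict_mono (s::nat \<Rightarrow> nat) \<and> (\<forall>j. convergent (\<lambda>n. u j (s n)))"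
proof -
  define P where "P j s \<longleftrightarrow> convergent (\<lambda>n. u j (s n))" for j and s :: "nat \<Rightarrow> nat"
  have "\<exists>r'. strict_mono r' \<and> P j (s \<circ> r')" for j and s :: "nat \<Rightarrow> nat"
  proof -
    have "seq_compact {a..b}" by (simp add: compact_imp_seq_compact)
    moreover have "\<forall>n. (\<lambda>n. u j (s n)) n \<in> {a..b}" using b by auto
    ultimately obtain l r where "strict_mono r" "((\<lambda>n. u j (s n)) \<circ> r) \<longlonglongrightarrow> l"
      by (rule seq_compactE)
    then show ?thesis unfolding P_def convergent_def o_def by blast
  qed
  then interpret subseqs P by unfold_locales
  have diag: "P k (diagseq \<circ> (+) (Suc k))" for k
  proof (rule diagseq_holds)
    fix r s :: "nat \<Rightarrow> nat" and n assume r: "strict_mono r" and s: "P n s"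
    show "P n (s \<circ> r)"
      using convergent_subseq_convergent[OF s[unfolded P_def] r] unfolding P_def o_def .
  qed
  have "P k diagseq" for k
  proof (rule iffD2[OF P_def])
    have "convergent (\<lambda>n. u k (diagseq (Suc k + n)))"
      using iffD1[OF P_def diag[of k]] by (simp add: o_def)
    then have "convergent (\<lambda>n. (\<lambda>n. u k (diagseq n)) (n + Suc k))" by (simp add: add.commute)
    then show "convergent (\<lambda>n. u k (diagseq n))" by (rule convergent_ignore_initial_segment[THEN iffD1])
  qed
  then have "\<exists>s. strict_mono s \<and> (\<forall>k. P k s)" using subseq_diagseq by blast
  then show ?thesis unfolding P_def .
qed

context casimir
begin

lemma minimizing_sequence_bounds:
  assumes M: "0 < M" and fn: "\<And>n. fn n \<in> FM Q M" and lim: "(\<lambda>n. HC Q (fn n)) \<longlonglongrightarrow> hM Q M"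
  shows "\<exists>P A. 0 \<le> P \<and> 0 \<le> A \<and> (\<forall>n. enn2real (Pfun Q (fn n)) \<le> P \<and> dens M A (rho (fn n)))"
proof -
  obtain C where C: "\<And>f. f \<in> FM Q M \<Longrightarrow> enn2real (Pfun Q f) \<le> 2 * HC Q f + C"
    using Pfun_coercive[OF M] by blast
  obtain K where K: "\<And>n. norm (HC Q (fn n)) \<le> K"
    using convergent_imp_Bseq[OF convergentI[OF lim]] unfolding Bseq_def by blast
  define P where "P = \<bar>2 * K + C\<bar>"
  have P: "enn2real (Pfun Q (fn n)) \<le> P" for n
    using C[OF fn[of n]] K[of n] by (simp add: P_def)
  obtain Cd where Cd: "0 \<le> Cd" "\<And>f. f \<in> FM Q M \<Longrightarrow> dens M (1 * enn2real (Pfun Q f) + Cd * M) (rho f)"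
    using FM_dens[of 1] by auto
  have "dens M (P + Cd * M) (rho (fn n))" for n
    using P[of n] by (intro dens_mono[OF Cd(2)[OF fn[of n]]]) auto
  moreover have "0 \<le> P" by (simp add: P_def)
  ultimately show ?thesis using P Cd(1) M by (intro exI[of _ P] exI[of _ "P + Cd * M"]) auto
qed

text \<open>An energy below half of the negative infimum forces a definite amount of field energy,
  since the convex part is nonnegative. The density therefore concentrates on some ball, whose
  centre becomes the translation. The offset \<open>n0\<close> discards the terms before this takes
  effect.\<close>

lemma concentrating_translates:
  assumes M: "0 < M" and fn: "\<And>n. fn n \<in> FM Q M" and lim: "(\<lambda>n. HC Q (fn n)) \<longlonglongrightarrow> hM Q M"
    and d: "\<And>n. dens M A (rho (fn n))" and A: "0 \<le> A"
  shows "\<exists>n0 b d0 R0. 0 < d0 \<and> (\<forall>n. d0 \<le> smass (shift (fn (n + n0)) (b n)) (ball 0 (real (R0::nat))))"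
proof -
  \<comment> \<open>Half of \<open>- hM Q M\<close>, multiplied by the normalisation
    \<open>8 * pi\<close> of the field energy.\<close>
  define dl where "dl = - 4 * pi * hM Q M"
  have dl: "0 < dl" using hM_neg[OF M] by (simp add: dl_def mult_pos_neg)
  obtain R d0 where R: "0 < R" and d0: "0 < d0"
    and conc: "\<And>p. dens M A p \<Longrightarrow> dl \<le> field_energy p \<Longrightarrow> \<exists>y. ennreal d0 \<le> (\<integral>\<^sup>+x. ennreal (p x) * indicator (ball y R) x \<partial>lborel)"
    using dens_nonvanishing[OF dl M A] by blast
  have "\<forall>\<^sub>F n in sequentially. HC Q (fn n) < hM Q M / 2"
    using hM_neg[OF M] by (intro order_tendstoD(2)[OF lim]) simp
  then obtain n0 where n0: "\<And>n. n0 \<le> n \<Longrightarrow> HC Q (fn n) < hM Q M / 2"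
    by (auto simp: eventually_sequentially)
  obtain R0 :: nat where R0: "R < real R0" using reals_Archimedean2 by blast
  have "\<exists>y. d0 \<le> smass (shift (fn (n + n0)) y) (ball 0 (real R0))" for n
  proof -
    let ?f = "fn (n + n0)"
    have "enn2real (Pfun Q ?f) - field_energy (rho ?f) / (8 * pi) < hM Q M / 2"
      using n0[of "n + n0"] unfolding HC_eq by simp
    then have "- (hM Q M / 2) \<le> field_energy (rho ?f) / (8 * pi)"
      using enn2real_nonneg[of "Pfun Q ?f"] by linarith
    then have "- (hM Q M / 2) * (8 * pi) \<le> field_energy (rho ?f)" by (subst (asm) pos_le_divide_eq) auto
    then have "dl \<le> field_energy (rho ?f)" by (simp add: dl_def mult_ac)
    then obtain y where "ennreal d0 \<le> (\<integral>\<^sup>+x. ennreal (rho ?f x) * indicator (ball y R) x \<partial>lborel)"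
      using conc[OF d] by blast
    then have "ennreal d0 \<le> ennreal (smass ?f (ball y R))" unfolding smass_eq[OF fn] .
    then have "d0 \<le> smass ?f (ball y R)" by (simp add: smass_nonneg)
    also have "\<dots> \<le> smass ?f (ball y (real R0))" using R0 by (intro smass_mono[OF fn]) auto
    also have "\<dots> = smass (shift ?f y) (ball 0 (real R0))" by (rule smass_shift[OF FM_D(1)[OF fn], symmetric])
    finally show ?thesis by blast
  qed
  then obtain b where "\<And>n. d0 \<le> smass (shift (fn (n + n0)) (b n)) (ball 0 (real R0))" by metis
  then show ?thesis using d0 by blast
qed

text \<open>Three nested extractions: \<open>s1\<close> makes the masses of all centred balls
  converge, which gives tightness; \<open>s2\<close> makes the regularised fields Cauchy, and with
  tightness the fields; \<open>s3\<close> turns the resulting Cauchy property in measure into almost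
  everywhere convergence.\<close>

theorem minimizing_sequence_compact:
  assumes M: "0 < M" and fn: "\<And>n. fn n \<in> FM Q M" and lim: "(\<lambda>n. HC Q (fn n)) \<longlonglongrightarrow> hM Q M"
  shows "\<exists>f0 r (a :: nat \<Rightarrow> real^3). f0 \<in> FM Q M \<and> strict_mono (r :: nat \<Rightarrow> nat) \<and> HC Q f0 = hM Q M \<and>
     weak_Lp_conv (1 + 1 / k1) (\<lambda>k. shift (fn (r k)) (a k)) f0 \<and>
     (\<lambda>k. \<integral>\<^sup>+ x. ennreal (norm (gradU (shift (fn (r k)) (a k)) x - gradU f0 x) ^ 2) \<partial>lborel) \<longlonglongrightarrow> 0"
proof -
  obtain A where A: "0 \<le> A" "\<And>n. dens M A (rho (fn n))"
    using minimizing_sequence_bounds[OF M fn lim] by blast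
  obtain n0 b d0 R0 where d0: "0 < d0" and conc: "\<And>n. d0 \<le> smass (shift (fn (n + n0)) (b n)) (ball 0 (real (R0::nat)))"
    using concentrating_translates[OF M fn lim A(2,1)] by blast
  define g where "g n = shift (fn (n + n0)) (b n)" for n
  have gF: "g n \<in> FM Q M" for n unfolding g_def by (rule shift_in_FM[OF fn])
  have gH: "HC Q (g n) = HC Q (fn (n + n0))" for n unfolding g_def by (rule HC_shift[OF FM_D(1)[OF fn]])
  have glim: "(\<lambda>n. HC Q (g n)) \<longlonglongrightarrow> hM Q M" unfolding gH using LIMSEQ_ignore_initial_segment[OF lim] .
  obtain P' A' where P': "0 \<le> P'" "\<And>n. enn2real (Pfun Q (g n)) \<le> P'" and A': "0 \<le> A'" "\<And>n. dens M A' (rho (g n))"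
    using minimizing_sequence_bounds[OF M gF glim] by blast
  obtain s1 :: "nat \<Rightarrow> nat" where s1: "strict_mono s1" "\<And>j. convergent (\<lambda>n. smass (g (s1 n)) (ball 0 (real j)))"
  proof -
    have "smass (g n) (ball 0 (real j)) \<le> M" for j n
      using smass_mono[OF gF, of "ball 0 (real j)" UNIV n] smass_UNIV[OF gF, of n] by simp
    then show ?thesis
      using diagonal_convergent[of 0 "\<lambda>j n. smass (g n) (ball 0 (real j))" M] smass_nonneg that by blast
  qed
  obtain s2 :: "nat \<Rightarrow> nat" where s2: "strict_mono s2" and unif: "\<And>k e. 0 < e \<Longrightarrow> \<exists>N. \<forall>m\<ge>N. \<forall>n\<ge>N. \<forall>x\<in>cball 0 (real (Suc k)).
     norm (tfld (1 / real (Suc k)) (rho (g (s1 (s2 m)))) x - tfld (1 / real (Suc k)) (rho (g (s1 (s2 n)))) x) < e"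
    using tfld_subseq[of M A' "\<lambda>n. rho (g (s1 n))", OF A'(2)] by blast
  define s where "s = s1 \<circ> s2"
  have s: "strict_mono s" unfolding s_def using s1(1) s2 by (rule strict_mono_o)
  define u where "u n = g (s n)" for n
  have uF: "u n \<in> FM Q M" and uA: "dens M A' (rho (u n))" and uP: "enn2real (Pfun Q (u n)) \<le> P'" for n
    unfolding u_def using gF A' P' by auto
  have ulim: "(\<lambda>n. HC Q (u n)) \<longlonglongrightarrow> hM Q M"
    unfolding u_def using LIMSEQ_subseq_LIMSEQ[OF glim s] by (simp add: o_def)
  have tight: "\<exists>j N. \<forall>n\<ge>N. (\<integral>\<^sup>+x. ennreal (rho (u n) x) * indicator (- ball 0 (real j)) x \<partial>lborel) \<le> ennreal e" if e: "0 < e" for e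
  proof -
    have "convergent (\<lambda>n. smass (u n) (ball 0 (real j)))" for j
      using convergent_subseq_convergent[OF s1(2)[of j] s2] by (simp add: u_def s_def o_def)
    then have mu: "(\<lambda>n. smass (u n) (ball 0 (real j))) \<longlonglongrightarrow> lim (\<lambda>n. smass (u n) (ball 0 (real j)))" for j
      by (simp add: convergent_LIMSEQ_iff)
    have "d0 \<le> smass (u n) (ball 0 (real R0))" for n
      unfolding u_def using conc[of "s n"] by (simp add: g_def)
    from mass_tight[OF M uF uA ulim d0 this mu e]
    obtain j N where jN: "\<And>n. N \<le> n \<Longrightarrow> smass (u n) (- ball 0 (real j)) < e" by blast
    then have "(\<integral>\<^sup>+x. ennreal (rho (u n) x) * indicator (- ball 0 (real j)) x \<partial>lborel) \<le> ennreal e" if "N \<le> n" for n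
      using jN[OF that] unfolding smass_eq[OF uF, symmetric] by (intro ennreal_leI) simp
    then show ?thesis by blast
  qed
  have cauchy: "\<exists>N. \<forall>m\<ge>N. \<forall>n\<ge>N. (\<integral>\<^sup>+x. ennreal (norm (fld (rho (u m)) x - fld (rho (u n)) x) ^ 2) \<partial>lborel) \<le> ennreal e" if "0 < e" for e
    by (rule fld_cauchy[OF uA tight _ that]) (use unif in \<open>simp_all add: u_def s_def\<close>)
  have dfct: "\<exists>N. \<forall>m\<ge>N. \<forall>n\<ge>N. (\<integral>\<^sup>+z. ennreal (defect (u m z) (u n z)) \<partial>lborel) \<le> ennreal e" if e: "0 < e" for e
  proof -
    \<comment> \<open>With \<open>D = 16 * pi * e\<close> the field term
      \<open>D / (32 * pi)\<close> is \<open>e / 2\<close>; the energies supply the other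
      half.\<close>
    have e': "0 < 16 * pi * e" using e by simp
    obtain N1 where N1: "\<And>m n. N1 \<le> m \<Longrightarrow> N1 \<le> n \<Longrightarrow> (\<integral>\<^sup>+x. ennreal (norm (fld (rho (u m)) x - fld (rho (u n)) x) ^ 2) \<partial>lborel) \<le> ennreal (16 * pi * e)"
      using cauchy[OF e'] by blast
    have "\<forall>\<^sub>F n in sequentially. HC Q (u n) < hM Q M + e / 2" using e by (intro order_tendstoD(2)[OF ulim]) simp
    then obtain N2 where N2: "\<And>n. N2 \<le> n \<Longrightarrow> HC Q (u n) < hM Q M + e / 2" by (auto simp: eventually_sequentially)
    show ?thesis
    proof (intro exI[of _ "max N1 N2"] allI impI)
      fix m n assume mn: "max N1 N2 \<le> m" "max N1 N2 \<le> n"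
      have "(\<integral>\<^sup>+z. ennreal (defect (u m z) (u n z)) \<partial>lborel) \<le> ennreal ((HC Q (u m) + HC Q (u n)) / 2 - hM Q M + 16 * pi * e / (32 * pi))"
        using mn e' by (intro defect_integral_le[OF M uF uF uA uA N1]) auto
      also have "\<dots> \<le> ennreal e"
      proof (rule ennreal_leI)
        have eq: "16 * pi * e / (32 * pi) = e / 2" by simp
        have "HC Q (u m) < hM Q M + e / 2" "HC Q (u n) < hM Q M + e / 2" using N2 mn by auto
        then show "(HC Q (u m) + HC Q (u n)) / 2 - hM Q M + 16 * pi * e / (32 * pi) \<le> e"
          unfolding eq by argo
      qed
      finally show "(\<integral>\<^sup>+z. ennreal (defect (u m z) (u n z)) \<partial>lborel) \<le> ennreal e" .
    qed
  qed
  obtain s3 :: "nat \<Rightarrow> nat" where s3: "strict_mono s3" and conv: "AE z in lborel. convergent (\<lambda>k. u (s3 k) z)"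
    using AE_convergent_subseq_of_Cauchy_in_measure[of u lborel, OF _ Cauchy_in_measure_of_defect[OF FM_D(1)[OF uF] FM_D(2)[OF uF] M dfct]]
      phaseD(1)[OF FM_D(1)[OF uF]] by auto
  define w where "w k = u (s3 k)" for k
  have wF: "w k \<in> FM Q M" for k unfolding w_def by (rule uF)
  \<comment> \<open>\<open>lim\<close> has an arbitrary value where the sequence diverges; the
    maximum with 0 makes \<open>f0\<close> nonnegative everywhere and changes nothing almost
    everywhere.\<close>
  define f0 where "f0 z = max 0 (lim (\<lambda>k. w k z))" for z
  have f0: "phase f0"
  proof -
    have [measurable]: "w k \<in> borel_measurable borel" for k by (rule phaseD(1)[OF FM_D(1)[OF wF]])
    have "(\<lambda>z. lim (\<lambda>k. w k z)) \<in> borel_measurable borel" by (rule borel_measurable_lim_metric) measurable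
    then show ?thesis unfolding phase_def f0_def[abs_def] by auto
  qed
  have ae: "AE z in lborel. (\<lambda>k. w k z) \<longlonglongrightarrow> f0 z"
    using conv
  proof eventually_elim
    case (elim z)
    then have l: "(\<lambda>k. w k z) \<longlonglongrightarrow> lim (\<lambda>k. w k z)" by (simp add: w_def convergent_LIMSEQ_iff)
    then have "0 \<le> lim (\<lambda>k. w k z)" using phaseD(2)[OF FM_D(1)[OF wF]] by (intro LIMSEQ_le_const[OF l]) auto
    then show ?case using l by (simp add: f0_def)
  qed
  have wlim: "(\<lambda>n. HC Q (w n)) \<longlonglongrightarrow> hM Q M"
    unfolding w_def using LIMSEQ_subseq_LIMSEQ[OF ulim s3] by (simp add: o_def)
  have wtight: "\<exists>j N. \<forall>n\<ge>N. (\<integral>\<^sup>+x. ennreal (rho (w n) x) * indicator (- ball 0 (real j)) x \<partial>lborel) \<le> ennreal e" if "0 < e" for e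
    unfolding w_def using tight[OF that] seq_suble[OF s3] by (meson order_trans)
  have wA: "dens M A' (rho (w n))" and wP: "enn2real (Pfun Q (w n)) \<le> P'" for n
    unfolding w_def using uA uP by auto
  note min = minimizer_of_AE_limit[OF M wF f0 ae wlim wA wP P'(1) wtight]
  have weak: "weak_Lp_conv (1 + 1 / k1) w f0"
  proof (rule weak_Lp_conv_of_AE[OF _ FM_D(1)[OF wF] f0 FM_Lp_bound[OF wF wP P'(1)] _ ae])
    show "1 < 1 + 1 / k1" using k_bounds by simp
    show "0 \<le> F0 powr (1 / k1) * M + P' / C1" using M P' const_pos by simp
  qed
  \<comment> \<open>The offset \<open>n0\<close> returns here, so that \<open>r\<close> indexes the
    original sequence.\<close>
  define r where "r k = s (s3 k) + n0" for k
  define a where "a k = b (s (s3 k))" for k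
  have wa: "shift (fn (r k)) (a k) = w k" for k by (simp add: w_def u_def g_def r_def a_def)
  have "strict_mono r" using strict_mono_o[OF s s3] by (simp add: r_def strict_mono_def)
  then show ?thesis
    using min weak unfolding wa[symmetric] gradU_eq_fld
    by (intro exI[of _ f0] exI[of _ r] exI[of _ a]) (simp add: wa)
qed

end

theorem theorem1:
  fixes Q Q' Q'' :: "real \<Rightarrow> real"
    and C1 C2 F0 k1 k2 k3 M :: real
    and fn :: "nat \<Rightarrow> phase_fun"
  assumes Q_C1: "\<forall>s\<ge>0. (Q has_real_derivative Q' s) (at s within {0..})"
      and Q'_cont: "continuous_on {0..} Q'"
      and Q_C2: "\<forall>s>0. (Q' has_real_derivative Q'' s) (at s)"
      and Q''_cont: "continuous_on {0<..} Q''"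
      and Q_nonneg: "\<forall>s\<ge>0. 0 \<le> Q s"
      and const_pos: "C1 > 0" "C2 > 0" "F0 > 0"
      and k_bounds: "0 < k1" "k1 < 3/2" "0 < k2" "k2 < 3/2" "0 < k3" "k3 < 3/2"
      and Q1: "\<forall>s\<ge>F0. Q s \<ge> C1 * s powr (1 + 1 / k1)"
      and Q2: "\<forall>s. 0 \<le> s \<and> s \<le> F0 \<longrightarrow> Q s \<le> C2 * s powr (1 + 1 / k2)"
      and Q3: "\<forall>s\<ge>0. \<forall>t. 0 \<le> t \<and> t \<le> 1 \<longrightarrow> Q (t * s) \<ge> t powr (1 + 1 / k3) * Q s"
      and Q4: "\<forall>s>0. Q'' s > 0" "Q' 0 = 0"
      and M_pos: "M > 0"
      and fn_in: "\<forall>n. fn n \<in> FM Q M"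
      and minimizing: "(\<lambda>n. HC Q (fn n)) \<longlonglongrightarrow> hM Q M"
  shows "\<exists>f0 r (a :: nat \<Rightarrow> real^3). f0 \<in> FM Q M \<and> strict_mono (r :: nat \<Rightarrow> nat) \<and> 
           HC Q f0 = hM Q M \<and>
           weak_Lp_conv (1 + 1 / k1) (\<lambda>k. shift (fn (r k)) (a k)) f0 \<and>
           (\<lambda>k. \<integral>\<^sup>+ x. ennreal (norm (gradU (shift (fn (r k)) (a k)) x - gradU f0 x) ^ 2) \<partial>lborel)
             \<longlonglongrightarrow> 0"
proof -
  interpret casimir Q Q' Q'' C1 C2 F0 k1 k2 k3
    by unfold_locales fact+
  show ?thesis
    using minimizing_sequence_compact[OF M_pos fn_in[rule_format] minimizing] .
qed

end
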